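(* Let $\mathcal{X}=(X,\mathcal{B},\mu,T)$ be a measure preserving system and let $(\mathcal{Y}_\alpha)$ be its Furstenberg–Zimmer tower of factors. For every $k$, all functions $f_0,\ldots,f_{k-1}\in L^\infty(\mathcal{X})$, and every $\varepsilon>0$, there are a natural number $n\ge 1$ and an ordinal $\alpha<\omega^{\omega^\omega}$ such that for every $m\ge n$, $$\frac{1}{m}\sum_{i<m}\int\Big(E\big(\prod_{l<k}T^{li}f_l\mid\mathcal{Y}_\alpha\big)-\prod_{l<k}T^{li}E(f_l\mid\mathcal{Y}_\alpha)\Big)^2\,d\mu<\varepsilon .$$
   Context: A measure preserving system $\mathcal{X}=(X,\mathcal{B},\mu,T)$ is a finite measure space $(X,\mathcal{B},\mu)$ with a measure-preserving transformation $T$; $L^2(\mathcal{X})$ is the (separable) Hilbert space of real square integrable functions, $L^\infty(\mathcal{X})$ its essentially bounded elements, and $T$ also denotes the isometry $Tf=f\circ T$. A factor $\mathcal{Y}$ of $\mathcal{X}$ is a $T$-invariant closed subspace of $L^2(\mathcal{X})$ containing the constants and closed under $f\mapsto\max(f,0)$ (equivalently, the space of functions in $L^2(\mathcal X)$ measurable with respect to a sub-$\sigma$-algebra closed under $A\mapsto T^{-1}A$). $E(f\mid\mathcal{Y})$ is the projection of $f$ onto $\mathcal{Y}$ (conditional expectation). Given a factor $\mathcal{Y}$, write $\|f\|_y=\big(E(f^2\mid\mathcal{Y})(y)\big)^{1/2}$. A function $f\in L^2(\mathcal{X})$ is almost periodic relative to $\mathcal{Y}$ if for every $\delta>0$ there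 are finitely many $g_0,\ldots,g_j\in L^2(\mathcal{X})$ such that for every $n\in\mathbb{N}$, $\min_{i\le j}\|T^nf-g_i\|_y<\delta$ for almost every $y$. $Z(\mathcal{Y})$, the maximal compact extension of $\mathcal{Y}$, is the closed linear span in $L^2(\mathcal{X})$ of the functions almost periodic relative to $\mathcal{Y}$; it is a factor. The tower: $\mathcal{Y}_0$ is the trivial factor of constant functions; $\mathcal{Y}_{\alpha+1}=Z(\mathcal{Y}_\alpha)$ for every ordinal $\alpha$; for a limit ordinal $\lambda$, $\mathcal{Y}_\lambda$ is the factor spanned by $\bigcup_{\gamma<\lambda}\mathcal{Y}_\gamma$ (its $L^2$-closure). Exponentiation in $\omega^{\omega^\omega}$ is ordinal exponentiation. *)

theory Defs
  imports "HOL-Probability.Conditional_Expectation"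
begin

section \<open>Square integrable functions\<close>

text \<open>Elements of \<open>L\<^sup>2\<close> and \<open>L\<^sup>\<infinity>\<close> are represented by functions, not by classes modulo null sets;
  every set of functions playing the role of a factor below is closed under almost everywhere
  equality, because \<open>l2_closure\<close> is.\<close>

definition L2 :: "'a measure \<Rightarrow> ('a \<Rightarrow> real) set" where
  "L2 M = {f \<in> borel_measurable M. integrable M (\<lambda>x. (f x)\<^sup>2)}"

definition L_infty :: "'a measure \<Rightarrow> ('a \<Rightarrow> real) set" where
  "L_infty M = {f \<in> borel_measurable M. \<exists>C. AE x in M. \<bar>f x\<bar> \<le> C}"

definition l2_norm :: "'a measure \<Rightarrow> ('a \<Rightarrow> real) \<Rightarrow> real" where
  "l2_norm M f = sqrt (\<integral>x. (f x)\<^sup>2 \<partial>M)"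

definition l2_closure :: "'a measure \<Rightarrow> ('a \<Rightarrow> real) set \<Rightarrow> ('a \<Rightarrow> real) set" where
  "l2_closure M A = {f \<in> L2 M. \<forall>e>0. \<exists>g\<in>A. l2_norm M (\<lambda>x. f x - g x) < e}"

definition lin_span :: "('a \<Rightarrow> real) set \<Rightarrow> ('a \<Rightarrow> real) set" where
  "lin_span A = {(\<lambda>x. \<Sum>i<n. c i * g i x) | (n::nat) (c :: nat \<Rightarrow> real) g. \<forall>i<n. g i \<in> A}"

text \<open>The last assumption is separability of \<open>L\<^sup>2\<close>. The map \<open>T\<close> need not be invertible.\<close>

locale measure_preserving_system = finite_measure M
  for M :: "'a measure" +
  fixes T :: "'a \<Rightarrow> 'a"
  assumes measurable_T: "T \<in> M \<rightarrow>\<^sub>M M"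
    and distr_T: "distr M M T = M"
    and separable_L2: "\<exists>D. countable D \<and> D \<subseteq> L2 M \<and> l2_closure M D = L2 M"


section \<open>Conditional expectation onto a factor, and almost periodicity\<close>

definition factor :: "'a measure \<Rightarrow> ('a \<Rightarrow> 'a) \<Rightarrow> ('a \<Rightarrow> real) set \<Rightarrow> bool" where
  "factor M T Y \<longleftrightarrow> l2_closure M Y = Y \<and> (\<forall>c. (\<lambda>_. c) \<in> Y) \<and>
     (\<forall>f\<in>Y. \<forall>g\<in>Y. (\<lambda>x. f x + g x) \<in> Y) \<and> (\<forall>f\<in>Y. \<forall>c. (\<lambda>x. c * f x) \<in> Y) \<and>
     (\<forall>f\<in>Y. (\<lambda>x. max (f x) 0) \<in> Y) \<and> (\<forall>f\<in>Y. (\<lambda>x. f (T x)) \<in> Y)"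

text \<open>A factor \<open>Y\<close>, given as a subspace of \<open>L\<^sup>2\<close>, consists of the \<open>L\<^sup>2\<close> functions measurable with
  respect to the sub-sigma-algebra of the sets whose indicator lies in \<open>Y\<close>. Conditional
  expectation onto this sub-sigma-algebra is the orthogonal projection onto \<open>Y\<close> (see
  \<open>cond_exp_projection\<close>), and it extends the projection to \<open>L\<^sup>1\<close>; the latter is needed for \<open>cond_norm\<close>, since \<open>f\<^sup>2\<close> is only in \<open>L\<^sup>1\<close>.\<close>

definition factor_algebra :: "'a measure \<Rightarrow> ('a \<Rightarrow> real) set \<Rightarrow> 'a measure" where
  "factor_algebra M Y = sigma (space M) {A \<in> sets M. indicat_real A \<in> Y}"

definition cond_exp :: "'a measure \<Rightarrow> ('a \<Rightarrow> real) set \<Rightarrow> ('a \<Rightarrow> real) \<Rightarrow> 'a \<Rightarrow> real" where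
  "cond_exp M Y f = real_cond_exp M (factor_algebra M Y) f"

context
  fixes M :: "'a measure" and T :: "'a \<Rightarrow> 'a" and Y :: "('a \<Rightarrow> real) set"
  assumes finite_M: "finite_measure M" and factor_Y: "factor M T Y"
begin

interpretation finite_measure M by (rule finite_M)

lemma factor_L2: "f \<in> Y \<Longrightarrow> f \<in> L2 M"
  using factor_Y unfolding factor_def l2_closure_def by blast

lemma factor_const: "(\<lambda>_. c) \<in> Y"
  and factor_add: "f \<in> Y \<Longrightarrow> g \<in> Y \<Longrightarrow> (\<lambda>x. f x + g x) \<in> Y"
  and factor_cmult: "f \<in> Y \<Longrightarrow> (\<lambda>x. c * f x) \<in> Y"
  and factor_pos: "f \<in> Y \<Longrightarrow> (\<lambda>x. max (f x) 0) \<in> Y"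
  using factor_Y unfolding factor_def by blast+

lemma factor_diff: "f \<in> Y \<Longrightarrow> g \<in> Y \<Longrightarrow> (\<lambda>x. f x - g x) \<in> Y"
  using factor_add[of f "\<lambda>x. (-1) * g x"] factor_cmult[of g "-1"] by simp

lemma factor_min: "f \<in> Y \<Longrightarrow> g \<in> Y \<Longrightarrow> (\<lambda>x. min (f x) (g x)) \<in> Y"
proof -
  assume "f \<in> Y" "g \<in> Y"
  then have "(\<lambda>x. f x - max (f x - g x) 0) \<in> Y"
    by (intro factor_diff factor_pos)
  moreover have "(\<lambda>x. f x - max (f x - g x) 0) = (\<lambda>x. min (f x) (g x))"
    by (auto simp: fun_eq_iff min_def max_def)
  ultimately show ?thesis by simp
qed

lemma factor_sum: "finite I \<Longrightarrow> (\<And>i. i \<in> I \<Longrightarrow> f i \<in> Y) \<Longrightarrow> (\<lambda>x. \<Sum>i\<in>I. f i x) \<in> Y"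
  by (induction I rule: finite_induct) (auto intro: factor_const factor_add)

lemma factor_dominated_limit:
  assumes f[measurable]: "f \<in> borel_measurable M" and g: "\<And>n::nat. g n \<in> Y"
    and w: "integrable M (\<lambda>x. (w x)\<^sup>2)"
    and bound: "\<And>n x. x \<in> space M \<Longrightarrow> \<bar>g n x\<bar> \<le> w x"
    and lim: "\<And>x. x \<in> space M \<Longrightarrow> (\<lambda>n. g n x) \<longlonglongrightarrow> f x"
  shows "f \<in> Y"
proof -
  have [measurable]: "g n \<in> borel_measurable M" for n
    using factor_L2[OF g] by (simp add: L2_def)
  have fb: "\<bar>f x\<bar> \<le> w x" if "x \<in> space M" for x
    using LIMSEQ_le_const2[OF tendsto_rabs[OF lim[OF that]]] bound[OF that] by blast
  have "integrable M (\<lambda>x. (f x)\<^sup>2)"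
    by (rule Bochner_Integration.integrable_bound[OF w])
      (auto intro!: AE_I2 simp: abs_le_square_iff[symmetric] dest!: fb)
  then have "f \<in> L2 M" by (simp add: L2_def)
  have "(\<lambda>n. \<integral>x. (f x - g n x)\<^sup>2 \<partial>M) \<longlonglongrightarrow> (\<integral>x. 0 \<partial>M)"
  proof (rule integral_dominated_convergence[where w = "\<lambda>x. 4 * (w x)\<^sup>2"])
    show "integrable M (\<lambda>x. 4 * (w x)\<^sup>2)" using w by simp
    show "AE x in M. (\<lambda>n. (f x - g n x)\<^sup>2) \<longlonglongrightarrow> 0"
    proof (rule AE_I2)
      fix x assume "x \<in> space M"
      then have "(\<lambda>n. (f x - g n x)\<^sup>2) \<longlonglongrightarrow> (f x - f x)\<^sup>2"
        by (intro tendsto_intros lim)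
      then show "(\<lambda>n. (f x - g n x)\<^sup>2) \<longlonglongrightarrow> 0" by simp
    qed
    fix n show "AE x in M. norm ((f x - g n x)\<^sup>2) \<le> 4 * (w x)\<^sup>2"
    proof (rule AE_I2)
      fix x assume x: "x \<in> space M"
      have "\<bar>f x - g n x\<bar> \<le> 2 * w x" using fb[OF x] bound[OF x, of n] by linarith
      then have "\<bar>f x - g n x\<bar>\<^sup>2 \<le> (2 * w x)\<^sup>2" by (intro power_mono) auto
      then show "norm ((f x - g n x)\<^sup>2) \<le> 4 * (w x)\<^sup>2" by (simp add: power_mult_distrib)
    qed
  qed simp_all
  then have lim_norm: "(\<lambda>n. l2_norm M (\<lambda>x. f x - g n x)) \<longlonglongrightarrow> 0"
    unfolding l2_norm_def using tendsto_real_sqrt by fastforce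
  have "\<exists>g\<in>Y. l2_norm M (\<lambda>x. f x - g x) < e" if "e > 0" for e
  proof -
    from order_tendstoD(2)[OF lim_norm that] obtain n
      where "l2_norm M (\<lambda>x. f x - g n x) < e"
      unfolding eventually_sequentially by blast
    then show ?thesis using g by blast
  qed
  then have "f \<in> l2_closure M Y"
    using \<open>f \<in> L2 M\<close> by (auto simp: l2_closure_def)
  then show ?thesis using factor_Y by (simp add: factor_def)
qed

lemma factor_cong:
  assumes "g \<in> Y" "f \<in> borel_measurable M" "\<And>x. x \<in> space M \<Longrightarrow> f x = g x"
  shows "f \<in> Y"
  using factor_L2[OF assms(1)] assms
  by (intro factor_dominated_limit[of f "\<lambda>_. g" "\<lambda>x. \<bar>g x\<bar>"]) (auto simp: L2_def)

lemma sets_factor_algebra: "sets (factor_algebra M Y) = {A \<in> sets M. indicat_real A \<in> Y}"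
proof -
  let ?A = "{A \<in> sets M. indicat_real A \<in> Y}"
  have compl: "space M - A \<in> ?A" if "A \<in> ?A" for A
  proof -
    have "(\<lambda>x. 1 - indicat_real A x) \<in> Y"
      using that by (intro factor_diff factor_const) auto
    then have "indicat_real (space M - A) \<in> Y"
      by (rule factor_cong) (use that in \<open>auto simp: indicator_def\<close>)
    then show ?thesis using that by auto
  qed
  have Int: "A \<inter> B \<in> ?A" if "A \<in> ?A" "B \<in> ?A" for A B
  proof -
    have "(\<lambda>x. min (indicat_real A x) (indicat_real B x)) \<in> Y"
      using that by (intro factor_min) auto
    then have "indicat_real (A \<inter> B) \<in> Y"
      by (rule factor_cong) (use that in \<open>auto simp: indicator_def\<close>)
    then show ?thesis using that by auto
  qed
  have Un: "A \<union> B \<in> ?A" if "A \<in> ?A" "B \<in> ?A" for A B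
  proof -
    have "A \<union> B = space M - ((space M - A) \<inter> (space M - B))"
      using that sets.sets_into_space by auto
    then show ?thesis using compl[OF Int[OF compl[OF that(1)] compl[OF that(2)]]] by simp
  qed
  have empty: "{} \<in> ?A"
    by (auto intro: factor_cong[OF factor_const[of 0]])
  have UN: "(\<Union>i. A i) \<in> ?A" if "range A \<subseteq> ?A" for A :: "nat \<Rightarrow> 'a set"
  proof -
    have fin: "(\<Union>i<n. A i) \<in> ?A" for n
    proof (induction n)
      case (Suc n)
      then show ?case using Un[of "A n" "\<Union>i<n. A i"] that by (auto simp: lessThan_Suc)
    qed (use empty in simp)
    have "(\<Union>i. A i) \<in> sets M" using that by auto
    moreover have "indicat_real (\<Union>i. A i) \<in> Y"
    proof (rule factor_dominated_limit[where g = "\<lambda>n. indicat_real (\<Union>i<n. A i)" and w = "\<lambda>_. 1"])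
      show "(\<lambda>n. indicat_real (\<Union>i<n. A i) x) \<longlonglongrightarrow> indicat_real (\<Union>i. A i) x" for x
        by (rule LIMSEQ_indicator_UN)
      show "indicat_real (\<Union>i. A i) \<in> borel_measurable M"
        using \<open>(\<Union>i. A i) \<in> sets M\<close> by simp
    qed (use fin in \<open>auto simp: indicator_def\<close>)
    ultimately show ?thesis by simp
  qed
  have "?A \<subseteq> Pow (space M)" using sets.sets_into_space by auto
  then have "sigma_algebra (space M) ?A"
    unfolding sigma_algebra_iff2 using compl empty UN by blast
  then show ?thesis
    by (simp add: factor_algebra_def sigma_algebra.sets_measure_of_eq)
qed

lemma subalgebra_factor_algebra: "subalgebra M (factor_algebra M Y)"
  unfolding subalgebra_def sets_factor_algebra
  by (auto simp: factor_algebra_def space_measure_of_conv)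

lemma factor_measurable:
  assumes "h \<in> Y"
  shows "h \<in> borel_measurable (factor_algebra M Y)"
proof (rule borel_measurableI_greater)
  fix c
  have sp: "space (factor_algebra M Y) = space M"
    using subalgebra_factor_algebra by (simp add: subalgebra_def)
  have [measurable]: "h \<in> borel_measurable M"
    using factor_L2[OF assms] by (simp add: L2_def)
  let ?C = "{x \<in> space M. c < h x}"
  have "indicat_real ?C \<in> Y"
  proof (rule factor_dominated_limit[where w = "\<lambda>_. 1"
        and g = "\<lambda>n x. min 1 (real n * max (h x - c) 0)"])
    fix n show "(\<lambda>x. min 1 (real n * max (h x - c) 0)) \<in> Y"
      by (intro factor_min factor_const factor_cmult factor_pos factor_diff assms)
  next
    fix x assume x: "x \<in> space M"
    show "(\<lambda>n. min 1 (real n * max (h x - c) 0)) \<longlonglongrightarrow> indicat_real ?C x"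
    proof (cases "c < h x")
      case True
      obtain N :: nat where N: "1 / (h x - c) \<le> real N"
        using real_arch_simple by blast
      have "min 1 (real n * max (h x - c) 0) = 1" if "n \<ge> N" for n
      proof -
        have "1 / (h x - c) \<le> real n" using N that by linarith
        then have "1 \<le> real n * (h x - c)" using True by (simp add: pos_divide_le_eq)
        then show ?thesis using True by simp
      qed
      then have "eventually (\<lambda>n. min 1 (real n * max (h x - c) 0) = 1) sequentially"
        by (auto simp: eventually_sequentially)
      then show ?thesis using True x by (simp add: tendsto_eventually)
    qed simp
  qed (auto simp: mult_nonneg_nonneg)
  then show "{x \<in> space (factor_algebra M Y). c < h x} \<in> sets (factor_algebra M Y)"
    by (simp add: sp sets_factor_algebra)
qed

lemma measurable_factor:
  assumes F: "h \<in> borel_measurable (factor_algebra M Y)" and h: "h \<in> L2 M"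
  shows "h \<in> Y"
proof -
  let ?F = "factor_algebra M Y"
  have sp: "space ?F = space M"
    using subalgebra_factor_algebra by (simp add: subalgebra_def)
  obtain s where s: "\<And>i. simple_function ?F (s i)" "\<And>x. x \<in> space M \<Longrightarrow> (\<lambda>i. s i x) \<longlonglongrightarrow> h x"
      "\<And>i x. x \<in> space M \<Longrightarrow> dist (s i x) 0 \<le> 2 * dist (h x) 0"
    using borel_measurable_implies_sequence_metric[OF F, of 0] unfolding sp by metis
  have s_Y: "s i \<in> Y" for i
  proof -
    have sets: "s i -` {v} \<inter> space M \<in> sets ?F" if "v \<in> s i ` space M" for v
      using s(1)[of i] that by (auto simp: simple_function_def sp)
    have fin: "finite (s i ` space M)"
      using s(1)[of i] by (auto simp: simple_function_def sp)
    have "(\<lambda>x. \<Sum>v\<in>s i ` space M. v * indicat_real (s i -` {v} \<inter> space M) x) \<in> Y"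
      using sets by (intro factor_sum fin factor_cmult) (auto simp: sets_factor_algebra)
    moreover have "s i \<in> borel_measurable M"
      using borel_measurable_simple_function[OF s(1)] measurable_from_subalg
        subalgebra_factor_algebra by blast
    moreover have "s i x = (\<Sum>v\<in>s i ` space M. v * indicat_real (s i -` {v} \<inter> space M) x)"
      if "x \<in> space M" for x
    proof -
      have "(\<Sum>v\<in>s i ` space M. v * indicat_real (s i -` {v} \<inter> space M) x)
          = (\<Sum>v\<in>s i ` space M. if v = s i x then v else 0)"
        using that by (intro sum.cong) (auto simp: indicator_def)
      then show ?thesis using fin that by simp
    qed
    ultimately show ?thesis by (rule factor_cong)
  qed
  show ?thesis
    by (rule factor_dominated_limit[of h s "\<lambda>x. 2 * \<bar>h x\<bar>"])
      (use s s_Y h in \<open>auto simp: L2_def power_mult_distrib\<close>)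
qed

lemma cond_exp_projection:
  assumes "f \<in> L2 M"
  shows "cond_exp M Y f \<in> Y"
    and "g \<in> Y \<Longrightarrow> (\<integral>x. (f x - cond_exp M Y f x) * g x \<partial>M) = 0"
proof -
  let ?F = "factor_algebra M Y"
  interpret F: finite_measure_subalgebra M ?F
    by unfold_locales (rule subalgebra_factor_algebra)
  have f[measurable]: "f \<in> borel_measurable M" and f2: "integrable M (\<lambda>x. (f x)\<^sup>2)"
    using assms by (auto simp: L2_def)
  have f1: "integrable M f" using square_integrable_imp_integrable[OF f f2] .
  have "integrable M (\<lambda>x. (real_cond_exp M ?F f x)\<^sup>2)"
    by (rule F.integrable_convex_cond_exp[of f UNIV undefined undefined "\<lambda>x. x\<^sup>2"])
      (use f1 f2 in \<open>auto simp: convex_power2\<close>)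
  then have E_L2: "cond_exp M Y f \<in> L2 M"
    by (simp add: L2_def cond_exp_def)
  have "cond_exp M Y f \<in> borel_measurable ?F"
    by (simp add: cond_exp_def)
  then show "cond_exp M Y f \<in> Y" using E_L2 by (rule measurable_factor)
  assume g: "g \<in> Y"
  have [measurable]: "g \<in> borel_measurable ?F" using g by (rule factor_measurable)
  have g2: "g \<in> borel_measurable M" "integrable M (\<lambda>x. (g x)\<^sup>2)"
    using factor_L2[OF g] by (auto simp: L2_def)
  have fg: "integrable M (\<lambda>x. g x * f x)"
  proof (rule Bochner_Integration.integrable_bound)
    show "integrable M (\<lambda>x. (f x)\<^sup>2 + (g x)\<^sup>2)" using f2 g2 by simp
    have "\<bar>g x * f x\<bar> \<le> (f x)\<^sup>2 + (g x)\<^sup>2" for x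
    proof -
      have "2 * \<bar>f x\<bar> * \<bar>g x\<bar> \<le> (f x)\<^sup>2 + (g x)\<^sup>2"
        using sum_squares_bound[of "\<bar>f x\<bar>" "\<bar>g x\<bar>"] by simp
      moreover have "0 \<le> \<bar>f x\<bar> * \<bar>g x\<bar>" by simp
      ultimately show ?thesis unfolding abs_mult mult.commute[of "\<bar>g x\<bar>"] by linarith
    qed
    then show "AE x in M. norm (g x * f x) \<le> norm ((f x)\<^sup>2 + (g x)\<^sup>2)"
      by (intro AE_I2) simp
  qed (use g2(1) f in simp)
  have "(\<integral>x. g x * f x - g x * real_cond_exp M ?F f x \<partial>M) = 0"
    using F.real_cond_exp_intg[OF fg] fg by simp
  then show "(\<integral>x. (f x - cond_exp M Y f x) * g x \<partial>M) = 0"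
    by (simp add: cond_exp_def algebra_simps)
qed

end

definition cond_norm :: "'a measure \<Rightarrow> ('a \<Rightarrow> real) set \<Rightarrow> ('a \<Rightarrow> real) \<Rightarrow> 'a \<Rightarrow> real" where
  "cond_norm M Y f y = sqrt (cond_exp M Y (\<lambda>x. (f x)\<^sup>2) y)"

definition almost_periodic ::
    "'a measure \<Rightarrow> ('a \<Rightarrow> 'a) \<Rightarrow> ('a \<Rightarrow> real) set \<Rightarrow> ('a \<Rightarrow> real) \<Rightarrow> bool" where
  "almost_periodic M T Y f \<longleftrightarrow> f \<in> L2 M \<and>
     (\<forall>\<delta>>0. \<exists>(j::nat) g. (\<forall>i\<le>j. g i \<in> L2 M) \<and>
        (\<forall>n::nat. AE y in M. (MIN i\<in>{..j}. cond_norm M Y (\<lambda>x. f ((T ^^ n) x) - g i x) y) < \<delta>))"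

definition max_compact_ext ::
    "'a measure \<Rightarrow> ('a \<Rightarrow> 'a) \<Rightarrow> ('a \<Rightarrow> real) set \<Rightarrow> ('a \<Rightarrow> real) set" where
  "max_compact_ext M T Y = l2_closure M (lin_span {f. almost_periodic M T Y f})"

definition trivial_factor :: "'a measure \<Rightarrow> ('a \<Rightarrow> real) set" where
  "trivial_factor M = {f \<in> L2 M. \<exists>c. AE x in M. f x = c}"


section \<open>The Furstenberg--Zimmer tower\<close>

text \<open>Ordinals are represented by positions in a well-order: \<open>a \<in> Field r\<close> stands for the order type
  of \<open>underS r a\<close>, so that \<open>Field r\<close> is the set of all ordinals below the order type of \<open>r\<close>.
  The position \<open>a\<close> is the successor of \<open>b\<close> iff \<open>underS r a = under r b\<close>.\<close>

definition fz_step :: "'a measure \<Rightarrow> ('a \<Rightarrow> 'a) \<Rightarrow> 'i rel \<Rightarrow>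
    ('i \<Rightarrow> ('a \<Rightarrow> real) set) \<Rightarrow> 'i \<Rightarrow> ('a \<Rightarrow> real) set" where
  "fz_step M T r Y a =
    (if underS r a = {} then trivial_factor M
     else if \<exists>b\<in>Field r. underS r a = under r b
       then max_compact_ext M T (Y (THE b. b \<in> Field r \<and> underS r a = under r b))
     else l2_closure M (\<Union>c\<in>underS r a. Y c))"

definition fz_tower :: "'a measure \<Rightarrow> ('a \<Rightarrow> 'a) \<Rightarrow> 'i rel \<Rightarrow> 'i \<Rightarrow> ('a \<Rightarrow> real) set" where
  "fz_tower M T r = wo_rel.worec r (fz_step M T r)"

lemma under_inj:
  assumes "Well_order r" "b \<in> Field r" "c \<in> Field r" "under r b = under r c"
  shows "b = c"
proof -
  interpret wo_rel r using assms(1) by (simp add: wo_rel_def)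
  have "(b, b) \<in> r" "(c, c) \<in> r"
    using REFL assms(2,3) by (auto simp: refl_on_def)
  then have "(b, c) \<in> r" "(c, b) \<in> r"
    using assms(4) by (auto simp: under_def)
  then show ?thesis using ANTISYM by (auto simp: antisym_def)
qed

lemma fz_tower_unfold:
  fixes M :: "'a measure" and r :: "'i rel"
  assumes "Well_order r"
  shows "fz_tower M T r a = fz_step M T r (fz_tower M T r) a"
proof -
  interpret wo_rel r using assms by (simp add: wo_rel_def)
  have "adm_wo (fz_step M T r)"
    unfolding adm_wo_def
  proof (intro allI impI)
    fix Y Y' :: "'i \<Rightarrow> ('a \<Rightarrow> real) set" and a
    assume eq: "\<forall>c\<in>underS a. Y c = Y' c"
    have "(THE b. b \<in> Field r \<and> underS a = under b) \<in> underS a"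
      if b: "b \<in> Field r" "underS a = under b" for b
    proof -
      have "(THE b. b \<in> Field r \<and> underS a = under b) = b"
        using b under_inj[OF assms] by (intro the_equality) auto
      then show ?thesis
        using b REFL by (auto simp: under_def refl_on_def)
    qed
    then show "fz_step M T r Y a = fz_step M T r Y' a"
      using eq unfolding fz_step_def by auto
  qed
  from worec_fixpoint[OF this] show ?thesis
    unfolding fz_tower_def by metis
qed

lemma fz_tower_zero:
  assumes "Well_order r" "underS r a = {}"
  shows "fz_tower M T r a = trivial_factor M"
  using assms by (subst fz_tower_unfold) (auto simp: fz_step_def)

lemma fz_tower_succ:
  assumes "Well_order r" "b \<in> Field r" "underS r a = under r b"
  shows "fz_tower M T r a = max_compact_ext M T (fz_tower M T r b)"
proof -
  have "(THE b. b \<in> Field r \<and> underS r a = under r b) = b"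
    using assms under_inj[OF assms(1)] by (intro the_equality) auto
  moreover have "b \<in> underS r a"
    using assms by (auto simp: under_def well_order_on_def linear_order_on_def
        partial_order_on_def preorder_on_def refl_on_def)
  ultimately show ?thesis
    using assms by (subst fz_tower_unfold) (auto simp: fz_step_def)
qed

lemma fz_tower_limit:
  assumes "Well_order r" "underS r a \<noteq> {}" "\<And>b. b \<in> Field r \<Longrightarrow> underS r a \<noteq> under r b"
  shows "fz_tower M T r a = l2_closure M (\<Union>c\<in>underS r a. fz_tower M T r c)"
  using assms by (subst fz_tower_unfold) (auto simp: fz_step_def)


section \<open>Ordinal exponentiation\<close>

text \<open>The ordinal power \<open>r\<close> to the \<open>s\<close>: finitely supported functions from \<open>s\<close> to \<open>r\<close>, that is, Cantor
  normal forms with exponents in \<open>s\<close> and digits in \<open>r\<close>, compared at the largest argument where they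
  differ. Functions take the value zero (the least element of \<open>r\<close>) outside \<open>Field s\<close>.\<close>

definition ord_zero :: "'i rel \<Rightarrow> 'i" where
  "ord_zero r = wo_rel.minim r (Field r)"

definition fin_supp_funs :: "'i rel \<Rightarrow> 'j rel \<Rightarrow> ('j \<Rightarrow> 'i) set" where
  "fin_supp_funs r s = {f. (\<forall>x\<in>Field s. f x \<in> Field r) \<and>
     (\<forall>x. x \<notin> Field s \<longrightarrow> f x = ord_zero r) \<and> finite {x. f x \<noteq> ord_zero r}}"

definition ord_exp :: "'i rel \<Rightarrow> 'j rel \<Rightarrow> ('j \<Rightarrow> 'i) rel" where
  "ord_exp r s = {(f, g). f \<in> fin_supp_funs r s \<and> g \<in> fin_supp_funs r s \<and>
     (f = g \<or> (\<exists>x\<in>Field s. (f x, g x) \<in> r - Id \<and> (\<forall>y. (x, y) \<in> s - Id \<longrightarrow> f y = g y)))}"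

definition omega_omega_omega :: "((nat \<Rightarrow> nat) \<Rightarrow> nat) rel" where
  "omega_omega_omega = ord_exp natLeq (ord_exp natLeq natLeq)"

lemma Well_order_ord_exp:
  assumes r: "Well_order r" and s: "Well_order s"
  shows "Well_order (ord_exp r s)"
proof -
  interpret r: wo_rel r using r by (simp add: wo_rel_def)
  interpret s: wo_rel s using s by (simp add: wo_rel_def)
  let ?z = "ord_zero r" and ?F = "fin_supp_funs r s"
  define lt where "lt x f g \<longleftrightarrow> x \<in> Field s \<and> (f x, g x) \<in> r - Id \<and> (\<forall>y. (x, y) \<in> s - Id \<longrightarrow> f y = g y)"
    for x and f g :: "'b \<Rightarrow> 'a"
  have E: "(f, g) \<in> ord_exp r s \<longleftrightarrow> f \<in> ?F \<and> g \<in> ?F \<and> (f = g \<or> (\<exists>x. lt x f g))" for f g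
    by (auto simp: ord_exp_def lt_def)
  have s_tot: "x = y \<or> (x, y) \<in> s - Id \<or> (y, x) \<in> s - Id" if "x \<in> Field s" "y \<in> Field s" for x y
    using s.TOTALS that by auto
  have s_tr: "(x, z) \<in> s - Id" if "(x, y) \<in> s - Id" "(y, z) \<in> s - Id" for x y z
    using that s.TRANS s.ANTISYM by (auto dest: transD antisymD)
  have r_tr: "(x, z) \<in> r - Id" if "(x, y) \<in> r - Id" "(y, z) \<in> r - Id" for x y z
    using that r.TRANS r.ANTISYM by (auto dest: transD antisymD)
  have lt_trans: "\<exists>z. lt z f h" if "lt x f g" "lt y g h" for x y f g h
  proof -
    have "x \<in> Field s" "y \<in> Field s" using that by (auto simp: lt_def)
    from s_tot[OF this] consider "x = y" | "(x, y) \<in> s - Id" | "(y, x) \<in> s - Id" by blast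
    then show ?thesis
    proof cases
      case 1
      then have "lt x f h" using that r_tr unfolding lt_def by metis
      then show ?thesis ..
    next
      case 2
      then have "lt y f h" using that s_tr unfolding lt_def by metis
      then show ?thesis ..
    next
      case 3
      then have "lt x f h" using that s_tr unfolding lt_def by metis
      then show ?thesis ..
    qed
  qed
  have lt_asym: "\<not> lt y g f" if "lt x f g" for x y f g
  proof
    assume "lt y g f"
    have "x \<in> Field s" "y \<in> Field s" using that \<open>lt y g f\<close> by (auto simp: lt_def)
    from s_tot[OF this] consider "x = y" | "(x, y) \<in> s - Id" | "(y, x) \<in> s - Id" by blast
    then show False
    proof cases
      case 1
      then have "(f x, g x) \<in> r - Id" "(g x, f x) \<in> r - Id"
        using that \<open>lt y g f\<close> by (auto simp: lt_def)
      from r_tr[OF this] show False by simp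
    next
      case 2
      then have "f y = g y" using that by (simp add: lt_def)
      then show False using \<open>lt y g f\<close> by (simp add: lt_def)
    next
      case 3
      then have "g x = f x" using \<open>lt y g f\<close> by (simp add: lt_def)
      then show False using that by (simp add: lt_def)
    qed
  qed
  have max_ex: "\<exists>x\<in>A. \<forall>y. (x, y) \<in> s - Id \<longrightarrow> y \<notin> A"
    if "finite A" "A \<noteq> {}" "A \<subseteq> Field s" for A
    using that
  proof (induction A rule: finite_ne_induct)
    case (singleton x) then show ?case by auto
  next
    case (insert a A)
    then obtain x where x: "x \<in> A" "\<forall>y. (x, y) \<in> s - Id \<longrightarrow> y \<notin> A" by auto
    show ?case
    proof (cases "(x, a) \<in> s - Id")
      case True
      then have "\<forall>y. (a, y) \<in> s - Id \<longrightarrow> y \<notin> insert a A"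
        using x s_tr by blast
      then show ?thesis by blast
    next
      case False
      then show ?thesis using x by blast
    qed
  qed
  have lt_total: "\<exists>x. lt x f g \<or> lt x g f" if "f \<in> ?F" "g \<in> ?F" "f \<noteq> g" for f g
  proof -
    let ?D = "{x. f x \<noteq> g x}"
    have "?D \<subseteq> {x. f x \<noteq> ?z} \<union> {x. g x \<noteq> ?z}" by auto
    then have "finite ?D" using that by (auto simp: fin_supp_funs_def elim: finite_subset)
    moreover have sub: "?D \<subseteq> Field s" using that by (force simp: fin_supp_funs_def)
    moreover have "?D \<noteq> {}" using that by auto
    ultimately obtain x where x: "x \<in> ?D" "\<forall>y. (x, y) \<in> s - Id \<longrightarrow> y \<notin> ?D"
      using max_ex by meson
    then have "x \<in> Field s" using sub by auto
    then have "f x \<in> Field r" "g x \<in> Field r" using that by (auto simp: fin_supp_funs_def)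
    then have "(f x, g x) \<in> r - Id \<or> (g x, f x) \<in> r - Id" using x r.TOTALS by auto
    then have "lt x f g \<or> lt x g f" using x \<open>x \<in> Field s\<close> by (auto simp: lt_def)
    then show ?thesis ..
  qed
  have Field_E: "Field (ord_exp r s) = ?F" by (auto simp: Field_def E)
  have zero_least: "(?z, v) \<in> r" if "v \<in> Field r" for v
    using r.minim_least[of "Field r" v] that by (auto simp: ord_zero_def)
  have not_lt_zero: "(v, ?z) \<notin> r - Id" for v
  proof
    assume v: "(v, ?z) \<in> r - Id"
    then have "(?z, v) \<in> r" by (intro zero_least) (auto simp: Field_def)
    then show False using v r.ANTISYM antisymD by fastforce
  qed
  have "Linear_order (ord_exp r s)"
    unfolding linear_order_on_def partial_order_on_def preorder_on_def Field_E
  proof (intro conjI)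
    show "refl_on ?F (ord_exp r s)" by (auto simp: refl_on_def E)
    show "trans (ord_exp r s)" unfolding trans_def E using lt_trans by blast
    show "antisym (ord_exp r s)" unfolding antisym_def E using lt_asym by blast
    show "total_on ?F (ord_exp r s)" unfolding total_on_def E using lt_total by blast
  qed (auto simp: E)
  moreover have "wf (ord_exp r s - Id)"
  proof -
    define R where "R = ord_exp r s - Id"
    have RE: "(f, g) \<in> R \<longleftrightarrow> f \<in> ?F \<and> g \<in> ?F \<and> (\<exists>x. lt x f g)" for f g
      using lt_asym by (auto simp: R_def E)
    define P where "P a f \<longleftrightarrow> f \<in> ?F \<and> (\<forall>x. f x \<noteq> ?z \<longrightarrow> (x, a) \<in> s)" for a f
    have P_down: "P a g" if "P a f" and gf0: "(g, f) \<in> R" for a f g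
    proof -
      obtain x where x: "lt x g f" and gf: "g \<in> ?F" "f \<in> ?F"
        using RE[THEN iffD1, OF gf0] by blast
      have "f x \<noteq> ?z" using x not_lt_zero unfolding lt_def by metis
      then have xa: "(x, a) \<in> s" using that by (simp add: P_def)
      have "(y, a) \<in> s" if y: "g y \<noteq> ?z" for y
      proof -
        have "y \<in> Field s" using y gf(1) unfolding fin_supp_funs_def by blast
        moreover have "x \<in> Field s" using x by (simp add: lt_def)
        ultimately consider "y = x" | "(y, x) \<in> s" | "(x, y) \<in> s - Id"
          using s_tot by blast
        then show ?thesis
        proof cases
          case 1 then show ?thesis using xa by simp
        next
          case 2 then show ?thesis using xa s.TRANS transD by metis
        next
          case 3
          then have "g y = f y" using x unfolding lt_def by blast
          then show ?thesis using y \<open>P a f\<close> by (simp add: P_def)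
        qed
      qed
      then show ?thesis using gf by (simp add: P_def)
    qed
    have zero_acc: "f \<in> Wellfounded.acc R" if "\<And>x. f x = ?z" for f
    proof (rule accI)
      fix g assume "(g, f) \<in> R"
      then obtain x where x: "lt x g f" using RE[THEN iffD1] by blast
      then show "g \<in> Wellfounded.acc R"
        using not_lt_zero that[of x] unfolding lt_def by metis
    qed
    have upd: "P a (f(a := ?z))" if "P a f" for a f
    proof -
      have "?z \<in> Field r" if "a \<in> Field s"
        using \<open>P a f\<close> that zero_least[of "f a"] by (auto simp: P_def fin_supp_funs_def Field_def)
      moreover have "finite {x. (f(a := ?z)) x \<noteq> ?z}"
        by (rule finite_subset[of _ "{x. f x \<noteq> ?z}"])
          (use \<open>P a f\<close> in \<open>auto simp: P_def fin_supp_funs_def\<close>)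
      ultimately show ?thesis
        using \<open>P a f\<close> by (auto simp: P_def fin_supp_funs_def)
    qed
    have max_supp: "\<exists>b. P b f \<and> f b \<noteq> ?z" if "f \<in> ?F" "\<exists>x. f x \<noteq> ?z" for f
    proof -
      let ?S = "{x. f x \<noteq> ?z}"
      have S: "finite ?S" "?S \<noteq> {}" "?S \<subseteq> Field s"
        using that by (auto simp: fin_supp_funs_def)
      then obtain b where b: "b \<in> ?S" "\<forall>y. (b, y) \<in> s - Id \<longrightarrow> y \<notin> ?S"
        using max_ex by meson
      have "(x, b) \<in> s" if "f x \<noteq> ?z" for x
        using s_tot[of x b] that b S s.REFL by (auto simp: refl_on_def)
      then show ?thesis using b that by (auto simp: P_def)
    qed
    have acc_P: "\<forall>f. P a f \<longrightarrow> f \<in> Wellfounded.acc R" for a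
    proof (induction a rule: s.well_order_induct)
      case (1 a)
      note IH_a = 1
      have small: "f \<in> Wellfounded.acc R" if f: "P a f" "f a = ?z" for f
      proof (cases "\<forall>x. f x = ?z")
        case True then show ?thesis using zero_acc by blast
      next
        case False
        then obtain b where b: "P b f" "f b \<noteq> ?z"
          using max_supp[of f] f by (auto simp: P_def)
        then have "b \<noteq> a" "(b, a) \<in> s" using f by (auto simp: P_def)
        then show ?thesis using IH_a b by blast
      qed
      have "\<forall>f. P a f \<longrightarrow> f a = v \<longrightarrow> f \<in> Wellfounded.acc R" for v
      proof (induction v rule: r.well_order_induct)
        case (1 v)
        note IH_v = 1
        have digit: "\<forall>f. P a f \<longrightarrow> f a = v \<longrightarrow> f(a := ?z) = h \<longrightarrow> f \<in> Wellfounded.acc R"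
          if "h \<in> Wellfounded.acc R" for h
          using that
        proof (induction rule: acc_induct_rule)
          case (1 h)
          note IH_h = 1
          show ?case
          proof (intro allI impI, rule accI)
            fix f g assume f: "P a f" "f a = v" "f(a := ?z) = h" and gf: "(g, f) \<in> R"
            have g: "P a g" using P_down f gf by blast
            obtain x where x: "lt x g f" using RE[THEN iffD1, OF gf] by blast
            show "g \<in> Wellfounded.acc R"
            proof (cases "x = a")
              case True
              then have "g a \<noteq> v" "(g a, v) \<in> r" using x f by (auto simp: lt_def)
              then show ?thesis using IH_v g by blast
            next
              case False
              have "f x \<noteq> ?z" using x not_lt_zero unfolding lt_def by metis
              then have "(x, a) \<in> s - Id" using f False by (auto simp: P_def)
              then have "g a = v" using x f by (auto simp: lt_def)
              have "lt x (g(a := ?z)) h" using x f False by (auto simp: lt_def)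
              then have "(g(a := ?z), h) \<in> R"
                using upd[OF g] upd[OF f(1)] f(3) by (auto simp: P_def RE)
              then show ?thesis using IH_h g \<open>g a = v\<close> by blast
            qed
          qed
        qed
        show ?case
        proof (intro allI impI)
          fix f assume f: "P a f" "f a = v"
          have "f(a := ?z) \<in> Wellfounded.acc R" using small[OF upd[OF f(1)]] by simp
          then show "f \<in> Wellfounded.acc R" using digit f by blast
        qed
      qed
      then show ?case by blast
    qed
    have "f \<in> Wellfounded.acc R" for f
    proof (cases "f \<in> ?F \<and> (\<exists>x. f x \<noteq> ?z)")
      case True
      then show ?thesis using max_supp acc_P by blast
    next
      case False
      then have "f \<notin> ?F \<or> (\<forall>x. f x = ?z)" by blast
      then show ?thesis
      proof
        assume "f \<notin> ?F"
        then show ?thesis by (auto intro!: accI[of f] simp: RE)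
      qed (simp add: zero_acc)
    qed
    then show ?thesis unfolding R_def by (simp add: wf_iff_acc)
  qed
  ultimately show ?thesis by (simp add: well_order_on_def)
qed

corollary Well_order_omega_omega_omega: "Well_order omega_omega_omega"
  unfolding omega_omega_omega_def by (intro Well_order_ord_exp natLeq_Well_order)

end

theory Submission
  imports Defs
begin

text \<open>Why finitely many steps of the tower suffice. Write \<open>Z(Y)\<close> for the maximal compact extension of
a factor \<open>Y\<close> and \<open>Z\<^sup>k(Y)\<close> for its \<open>k\<close>-fold iterate (\<open>tower Y k\<close> below). The core is
\<open>multiple_correlation_tendsto_zero\<close>: if \<open>Y\<close> satisfies \<open>E(F \<circ> T | Y) = E(F | Y) \<circ> T\<close> for all bounded \<open>F\<close>
and one of \<open>k + 1\<close> bounded functions is orthogonal to \<open>Z\<^sup>k(Y)\<close>, then the conditional expectation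
onto \<open>Y\<close> of \<open>\<Prod>l. f l \<circ> T\<^bsup>a(l)i\<^esup>\<close>, with distinct exponents \<open>a(l)\<close>, tends to zero in \<open>L\<^sup>2\<close> on average over
\<open>i\<close>. The proof is an induction on the number of functions with \<open>Y\<close> fixed. Van der Corput's
inequality removes one function, with exponent \<open>b\<close> say, and replaces every other \<open>f l\<close> by
\<open>g = f l \<circ> T\<^bsup>bd\<^esup> * f l \<circ> T\<^bsup>a(l)d\<^esup>\<close>. For the distinguished function split \<open>g\<close> into its projection to
\<open>Z\<^bsup>k-1\<^esup>(Y)\<close> and the rest: the rest is handled by induction, and the projection is small for most \<open>d\<close>
by the case of two functions, \<open>correlation_averages_tendsto_zero\<close>, applied to \<open>Z\<^bsup>k-1\<^esup>(Y)\<close>.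

Given this, let \<open>Y\<^sub>n\<close> be the \<open>n\<close>-th level of the tower. The norms of the projections of finitely
many functions to \<open>Y\<^sub>n\<close> increase with \<open>n\<close> and are bounded, so for some finite \<open>n\<close> the projections to
\<open>Y\<^sub>n\<close> and to \<open>Y\<^bsub>n+k\<^esub> = Z\<^sup>k(Y\<^sub>n)\<close> are as close as desired (\<open>stable_level\<close>). Replacing the functions one by
one by their projections to \<open>Y\<^sub>n\<close> then costs little (\<open>defect_le\<close>).

For two functions consider the kernels \<open>f\<^sub>r \<otimes> f\<^sub>r\<close> over \<open>Y\<close>, where \<open>f\<^sub>r = f \<circ> T\<^sup>r\<close>. A sequence of convex
combinations whose Hilbert-Schmidt norms tend to the infimum converges to a kernel \<open>K\<close> that is
invariant under \<open>T\<close>. The function \<open>\<theta> = K * f\<close> satisfies \<open>\<theta> \<circ> T\<^sup>n = K * f\<^sub>n\<close>, and since \<open>K\<close> is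
approximated by kernels of finite rank, uniformly on the fibres outside a small set of \<open>Y\<close>, \<open>\<theta>\<close>
multiplied by the indicator of the complement of this set is almost periodic relative to \<open>Y\<close>. If
\<open>f\<close> is orthogonal to all such functions then \<open>K\<close> is orthogonal to every \<open>f\<^sub>r \<otimes> f\<^sub>r\<close>, hence to itself,
so \<open>K = 0\<close>, and this forces the correlations of \<open>f\<close> with \<open>f\<^sub>r\<close> to vanish on average. No relatively
independent product is formed: a combination of the kernels is represented by its finitely
supported vector of coefficients, and its fibrewise Hilbert-Schmidt norm by the entrywise
square of the matrix \<open>E(f\<^sub>r * f\<^sub>s | Y)\<close>.

Since \<open>T\<close> need not be invertible, the identity \<open>E(F \<circ> T | Y) = E(F | Y) \<circ> T\<close> may fail for a factor
\<open>Y\<close>. It holds for the constants, and passes from \<open>Y\<close> to \<open>Z(Y)\<close> because almost periodic functions are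
recurrent on the fibres of \<open>Y\<close> (\<open>equivariant_Z\<close>).\<close>



section \<open>Bounded and square integrable functions\<close>

lemma square_sum_le: "(a + b)\<^sup>2 \<le> 2 * a\<^sup>2 + 2 * b\<^sup>2" for a b :: real
  using sum_squares_bound[of a b] by (simp add: power2_sum)

lemma square_triangle_le: "(a - c)\<^sup>2 \<le> 2 * (a - b)\<^sup>2 + 2 * (b - c)\<^sup>2" for a b c :: real
  using square_sum_le[of "a - b" "b - c"] by simp

lemma abs_mult_le_squares: "\<bar>a * b\<bar> \<le> a\<^sup>2 + b\<^sup>2" for a b :: real
  using sum_squares_bound[of "\<bar>a\<bar>" "\<bar>b\<bar>"] abs_ge_zero[of "a*b"] unfolding abs_mult power2_abs by linarith

lemma abs_le_weighted_square:
  fixes t \<eta> :: real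
  assumes "\<eta> > 0"
  shows "\<bar>t\<bar> \<le> \<eta> + t\<^sup>2 / \<eta>"
proof -
  have "2 * \<bar>t\<bar> * \<eta> \<le> t\<^sup>2 + \<eta>\<^sup>2"
    using sum_squares_bound[of "\<bar>t\<bar>" \<eta>] by simp
  moreover have "0 \<le> \<bar>t\<bar> * \<eta>" using assms by simp
  ultimately have "\<bar>t\<bar> * \<eta> \<le> \<eta>\<^sup>2 + t\<^sup>2" by linarith
  then have "\<bar>t\<bar> \<le> (\<eta>\<^sup>2 + t\<^sup>2) / \<eta>" using assms by (simp add: pos_le_divide_eq)
  then show ?thesis using assms by (simp add: add_divide_distrib power2_eq_square)
qed

lemma nonneg_quadratic_discriminant:
  fixes a b c :: real
  assumes "\<And>t. a + 2 * t * b + t\<^sup>2 * c \<ge> 0" "c \<ge> 0"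
  shows "b\<^sup>2 \<le> a * c"
proof (cases "c = 0")
  case True
  have "b = 0"
  proof (rule ccontr)
    assume "b \<noteq> 0"
    then have "2 * (-(a + 1) / (2 * b)) * b = -(a + 1)" by simp
    then show False using assms(1)[of "-(a + 1) / (2 * b)"] True by simp
  qed
  then show ?thesis using True by simp
next
  case False
  then have "c > 0" using assms(2) by simp
  have "0 \<le> c * (a + 2 * (-b/c) * b + (-b/c)\<^sup>2 * c)" using assms(1)[of "-b/c"] assms(2) by simp
  also have "\<dots> = a * c - b\<^sup>2" using \<open>c > 0\<close> by (simp add: field_simps power2_eq_square)
  finally show ?thesis by simp
qed

context finite_measure
begin

lemma L_inftyI: "f \<in> borel_measurable M \<Longrightarrow> (AE x in M. \<bar>f x\<bar> \<le> C) \<Longrightarrow> f \<in> L_infty M"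
  by (auto simp: L_infty_def)

lemma L_infty_measurable: "f \<in> L_infty M \<Longrightarrow> f \<in> borel_measurable M"
  by (simp add: L_infty_def)

lemma L_inftyE:
  assumes "f \<in> L_infty M"
  obtains C where "C > 0" "AE x in M. \<bar>f x\<bar> \<le> C"
proof -
  obtain C where "AE x in M. \<bar>f x\<bar> \<le> C" using assms by (auto simp: L_infty_def)
  then have "AE x in M. \<bar>f x\<bar> \<le> max C 1" by eventually_elim auto
  then show ?thesis using that[of "max C 1"] by auto
qed

lemma L_infty_const: "(\<lambda>_. c) \<in> L_infty M"
  by (rule L_inftyI[where C = "\<bar>c\<bar>"]) auto

lemma L_infty_indicator: "A \<in> sets M \<Longrightarrow> indicat_real A \<in> L_infty M"
  by (rule L_inftyI[where C = 1]) (auto simp: indicator_def)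

lemma L_infty_add:
  assumes "f \<in> L_infty M" "g \<in> L_infty M" shows "(\<lambda>x. f x + g x) \<in> L_infty M"
proof -
  obtain C D where C: "AE x in M. \<bar>f x\<bar> \<le> C" "AE x in M. \<bar>g x\<bar> \<le> D"
    using assms by (auto simp: L_infty_def)
  then have "AE x in M. \<bar>f x + g x\<bar> \<le> C + D" by eventually_elim linarith
  then show ?thesis using assms by (intro L_inftyI) (auto simp: L_infty_def)
qed

lemma L_infty_mult:
  assumes "f \<in> L_infty M" "g \<in> L_infty M" shows "(\<lambda>x. f x * g x) \<in> L_infty M"
proof -
  obtain C D where C: "AE x in M. \<bar>f x\<bar> \<le> C" "AE x in M. \<bar>g x\<bar> \<le> D"
    using assms by (auto simp: L_infty_def)
  then have "AE x in M. \<bar>f x * g x\<bar> \<le> C * D"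
    by eventually_elim (auto simp: abs_mult intro!: mult_mono)
  then show ?thesis using assms by (intro L_inftyI) (auto simp: L_infty_def)
qed

lemma L_infty_cmult: "f \<in> L_infty M \<Longrightarrow> (\<lambda>x. c * f x) \<in> L_infty M"
  by (intro L_infty_mult L_infty_const)

lemma L_infty_diff: "f \<in> L_infty M \<Longrightarrow> g \<in> L_infty M \<Longrightarrow> (\<lambda>x. f x - g x) \<in> L_infty M"
  using L_infty_add[of f "\<lambda>x. (-1) * g x"] L_infty_cmult[of g "-1"] by simp

lemma L_infty_power2: "f \<in> L_infty M \<Longrightarrow> (\<lambda>x. (f x)\<^sup>2) \<in> L_infty M"
  unfolding power2_eq_square by (intro L_infty_mult)

lemma L_infty_sum: "(\<And>i. i \<in> I \<Longrightarrow> f i \<in> L_infty M) \<Longrightarrow> (\<lambda>x. \<Sum>i\<in>I. f i x) \<in> L_infty M"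
  by (induction I rule: infinite_finite_induct) (auto intro: L_infty_const L_infty_add)

lemma L_infty_prod: "(\<And>i. i \<in> I \<Longrightarrow> f i \<in> L_infty M) \<Longrightarrow> (\<lambda>x. \<Prod>i\<in>I. f i x) \<in> L_infty M"
  by (induction I rule: infinite_finite_induct) (auto intro: L_infty_const L_infty_mult)

lemmas L_infty_intros = L_infty_const L_infty_indicator L_infty_add L_infty_mult L_infty_diff
  L_infty_power2 L_infty_sum L_infty_prod

lemma L_infty_integrable: "f \<in> L_infty M \<Longrightarrow> integrable M f"
proof -
  assume "f \<in> L_infty M"
  then obtain C where "AE x in M. norm (f x) \<le> C" "f \<in> borel_measurable M"
    by (auto simp: L_infty_def)
  then show ?thesis by (rule integrable_const_bound)
qed

lemma L_infty_L2: "f \<in> L_infty M \<Longrightarrow> f \<in> L2 M"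
  using L_infty_integrable[OF L_infty_power2] by (simp add: L2_def L_infty_def)

lemma L2_mult_integrable:
  assumes "f \<in> L2 M" "g \<in> L2 M" shows "integrable M (\<lambda>x. f x * g x)"
proof (rule Bochner_Integration.integrable_bound)
  show "integrable M (\<lambda>x. (f x)\<^sup>2 + (g x)\<^sup>2)" using assms by (simp add: L2_def)
  show "AE x in M. norm (f x * g x) \<le> norm ((f x)\<^sup>2 + (g x)\<^sup>2)"
    using abs_mult_le_squares by (intro AE_I2) auto
  show "(\<lambda>x. f x * g x) \<in> borel_measurable M"
    using assms by (intro borel_measurable_times) (auto simp: L2_def)
qed

lemma L2_integrable: "f \<in> L2 M \<Longrightarrow> integrable M f"
  using L2_mult_integrable[of f "\<lambda>_. 1"] L_infty_L2[OF L_infty_const[of 1]] by simp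

lemma L2_add: "f \<in> L2 M \<Longrightarrow> g \<in> L2 M \<Longrightarrow> (\<lambda>x. f x + g x) \<in> L2 M"
  using L2_mult_integrable[of f g] by (auto simp: L2_def power2_sum mult.assoc)

lemma L2_cmult: "f \<in> L2 M \<Longrightarrow> (\<lambda>x. c * f x) \<in> L2 M"
  by (auto simp: L2_def power_mult_distrib)

lemma L2_diff: "f \<in> L2 M \<Longrightarrow> g \<in> L2 M \<Longrightarrow> (\<lambda>x. f x - g x) \<in> L2 M"
  using L2_add[of f "\<lambda>x. (-1) * g x"] L2_cmult[of g "-1"] by simp

lemma L2_integrable_power2: "f \<in> L2 M \<Longrightarrow> integrable M (\<lambda>x. (f x)\<^sup>2)"
  by (simp add: L2_def)

lemma L2_measurable: "f \<in> L2 M \<Longrightarrow> f \<in> borel_measurable M"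
  by (simp add: L2_def)

lemma L2_bounded_by:
  assumes "f \<in> L2 M" "g \<in> borel_measurable M" "\<And>x. \<bar>g x\<bar> \<le> \<bar>f x\<bar>"
  shows "g \<in> L2 M"
proof -
  have "integrable M (\<lambda>x. (g x)\<^sup>2)"
    by (rule Bochner_Integration.integrable_bound[OF L2_integrable_power2[OF assms(1)]])
      (use assms in \<open>auto simp: abs_le_square_iff[symmetric]\<close>)
  then show ?thesis using assms by (simp add: L2_def)
qed

lemma L2_max: "f \<in> L2 M \<Longrightarrow> (\<lambda>x. max (f x) 0) \<in> L2 M"
  by (rule L2_bounded_by[of f]) (auto simp: L2_def)

lemma L2_cauchy_schwarz:
  assumes "f \<in> L2 M" "g \<in> L2 M"
  shows "(\<integral>x. f x * g x \<partial>M)\<^sup>2 \<le> (\<integral>x. (f x)\<^sup>2 \<partial>M) * (\<integral>x. (g x)\<^sup>2 \<partial>M)"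
proof (rule nonneg_quadratic_discriminant)
  fix t :: real
  have "0 \<le> (\<integral>x. (f x + t * g x)\<^sup>2 \<partial>M)" by simp
  also have "(\<integral>x. (f x + t * g x)\<^sup>2 \<partial>M) = (\<integral>x. (f x)\<^sup>2 + 2 * t * (f x * g x) + t\<^sup>2 * (g x)\<^sup>2 \<partial>M)"
    by (intro Bochner_Integration.integral_cong) (auto simp: power2_eq_square algebra_simps)
  also have "\<dots> = (\<integral>x. (f x)\<^sup>2 \<partial>M) + 2 * t * (\<integral>x. f x * g x \<partial>M) + t\<^sup>2 * (\<integral>x. (g x)\<^sup>2 \<partial>M)"
    using L2_mult_integrable[OF assms] assms by (simp add: L2_integrable_power2)
  finally show "0 \<le> (\<integral>x. (f x)\<^sup>2 \<partial>M) + 2 * t * (\<integral>x. f x * g x \<partial>M) + t\<^sup>2 * (\<integral>x. (g x)\<^sup>2 \<partial>M)" .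
qed simp

lemma L2_integral_abs_le:
  assumes "f \<in> L2 M"
  shows "(\<integral>x. \<bar>f x\<bar> \<partial>M) \<le> sqrt (measure M (space M)) * sqrt (\<integral>x. (f x)\<^sup>2 \<partial>M)"
proof -
  have "(\<lambda>x. \<bar>f x\<bar>) \<in> L2 M" by (rule L2_bounded_by[OF assms]) (use assms in \<open>auto simp: L2_def\<close>)
  from L2_cauchy_schwarz[OF this L_infty_L2[OF L_infty_const[of 1]]]
  have "(\<integral>x. \<bar>f x\<bar> \<partial>M)\<^sup>2 \<le> (\<integral>x. (f x)\<^sup>2 \<partial>M) * measure M (space M)" by simp
  then have "sqrt ((\<integral>x. \<bar>f x\<bar> \<partial>M)\<^sup>2) \<le> sqrt ((\<integral>x. (f x)\<^sup>2 \<partial>M) * measure M (space M))"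
    by (rule real_sqrt_le_mono)
  then show ?thesis by (simp add: real_sqrt_mult mult.commute)
qed

lemma l2_norm_less_iff: "e > 0 \<Longrightarrow> l2_norm M f < e \<longleftrightarrow> (\<integral>x. (f x)\<^sup>2 \<partial>M) < e\<^sup>2"
  using real_sqrt_less_iff[of "\<integral>x. (f x)\<^sup>2 \<partial>M" "e\<^sup>2"] by (simp add: l2_norm_def)

text \<open>Without the square root the distance can be estimated by \<open>(a + b)\<^sup>2 \<le> 2 a\<^sup>2 + 2 b\<^sup>2\<close>, which replaces
the triangle inequality for this distance.\<close>

lemma l2_closure_iff:
  "f \<in> l2_closure M A \<longleftrightarrow> f \<in> L2 M \<and> (\<forall>e>0. \<exists>g\<in>A. (\<integral>x. (f x - g x)\<^sup>2 \<partial>M) < e)"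
proof -
  have "(\<forall>e>0. \<exists>g\<in>A. l2_norm M (\<lambda>x. f x - g x) < e) \<longleftrightarrow> (\<forall>e>0. \<exists>g\<in>A. (\<integral>x. (f x - g x)\<^sup>2 \<partial>M) < e)"
    (is "?L \<longleftrightarrow> ?R")
  proof
    assume L: ?L show ?R
    proof (intro allI impI)
      fix e :: real assume "e > 0"
      then have "sqrt e > 0" by simp
      then show "\<exists>g\<in>A. (\<integral>x. (f x - g x)\<^sup>2 \<partial>M) < e"
        using L[rule_format, OF \<open>sqrt e > 0\<close>] l2_norm_less_iff[OF \<open>sqrt e > 0\<close>] \<open>e > 0\<close> by simp
    qed
  next
    assume R: ?R show ?L
    proof (intro allI impI)
      fix e :: real assume "e > 0"
      then have "\<exists>g\<in>A. (\<integral>x. (f x - g x)\<^sup>2 \<partial>M) < e\<^sup>2" using R by simp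
      then show "\<exists>g\<in>A. l2_norm M (\<lambda>x. f x - g x) < e"
        using l2_norm_less_iff[OF \<open>e > 0\<close>] by simp
    qed
  qed
  then show ?thesis by (auto simp: l2_closure_def)
qed

lemma l2_closure_superset: "A \<subseteq> L2 M \<Longrightarrow> A \<subseteq> l2_closure M A"
proof
  fix f assume "A \<subseteq> L2 M" "f \<in> A"
  then show "f \<in> l2_closure M A"
    by (auto simp: l2_closure_iff intro!: bexI[of _ f])
qed

lemma l2_closure_idem:
  assumes "A \<subseteq> L2 M"
  shows "l2_closure M (l2_closure M A) = l2_closure M A"
proof
  show "l2_closure M (l2_closure M A) \<subseteq> l2_closure M A"
  proof
    fix f assume f: "f \<in> l2_closure M (l2_closure M A)"
    have "\<exists>h\<in>A. (\<integral>x. (f x - h x)\<^sup>2 \<partial>M) < e" if e: "e > 0" for e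
    proof -
      obtain g where g: "g \<in> l2_closure M A" "(\<integral>x. (f x - g x)\<^sup>2 \<partial>M) < e / 4"
        using f[unfolded l2_closure_iff[of f "l2_closure M A"], THEN conjunct2, rule_format, of "e / 4"] e
        by auto
      obtain h where h: "h \<in> A" "(\<integral>x. (g x - h x)\<^sup>2 \<partial>M) < e / 4"
        using g(1)[unfolded l2_closure_iff[of g A], THEN conjunct2, rule_format, of "e / 4"] e by auto
      have L2: "f \<in> L2 M" "g \<in> L2 M" "h \<in> L2 M" using f g h assms by (auto simp: l2_closure_def)
      have "(\<integral>x. (f x - h x)\<^sup>2 \<partial>M) \<le> (\<integral>x. 2 * (f x - g x)\<^sup>2 + 2 * (g x - h x)\<^sup>2 \<partial>M)"
        using L2 by (intro integral_mono square_triangle_le Bochner_Integration.integrable_add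
            integrable_mult_right L2_integrable_power2 L2_diff)
      also have "\<dots> = 2 * (\<integral>x. (f x - g x)\<^sup>2 \<partial>M) + 2 * (\<integral>x. (g x - h x)\<^sup>2 \<partial>M)"
        using L2_integrable_power2[OF L2_diff[OF L2(1,2)]] L2_integrable_power2[OF L2_diff[OF L2(2,3)]]
        by simp
      finally show ?thesis using g h by (intro bexI[of _ h]) auto
    qed
    then show "f \<in> l2_closure M A" using f l2_closure_iff[of f A] by (auto simp: l2_closure_def[of M "l2_closure M A"])
  qed
next
  show "l2_closure M A \<subseteq> l2_closure M (l2_closure M A)"
    by (rule l2_closure_superset) (auto simp: l2_closure_def)
qed

end

context measure_preserving_system
begin

lemma measurable_Tn [measurable]: "(T ^^ n) \<in> M \<rightarrow>\<^sub>M M"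
proof (induction n)
  case (Suc n)
  then show ?case using measurable_comp[OF Suc measurable_T] by (simp add: o_def)
qed (simp add: id_def)

lemma distr_Tn: "distr M M (T ^^ n) = M"
proof (induction n)
  case 0
  show ?case by (simp add: id_def distr_id)
next
  case (Suc n)
  have "distr M M (T \<circ> (T ^^ n)) = distr (distr M M (T ^^ n)) M T"
    by (rule distr_distr[symmetric]) (auto simp: measurable_T)
  then show ?case unfolding funpow.simps using Suc distr_T by metis
qed

lemma integral_Tn:
  fixes f :: "'a \<Rightarrow> real"
  assumes "f \<in> borel_measurable M"
  shows "(\<integral>x. f ((T ^^ n) x) \<partial>M) = (\<integral>x. f x \<partial>M)"
  using integral_distr[of "T ^^ n" M M f] assms by (simp add: distr_Tn)

lemma integrable_Tn:
  fixes f :: "'a \<Rightarrow> real"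
  assumes "integrable M f"
  shows "integrable M (\<lambda>x. f ((T ^^ n) x))"
  using integrable_distr[of "T ^^ n" M M f] assms by (simp add: distr_Tn)

lemma AE_Tn:
  assumes "AE x in M. P x"
  shows "AE x in M. P ((T ^^ n) x)"
  using AE_distrD[OF measurable_Tn[of n], of P] assms unfolding distr_Tn by blast

lemma AE_T: "AE x in M. P x \<Longrightarrow> AE x in M. P (T x)"
  using AE_Tn[of P 1] by simp

lemma L_infty_Tn: "f \<in> L_infty M \<Longrightarrow> (\<lambda>x. f ((T ^^ n) x)) \<in> L_infty M"
proof -
  assume f: "f \<in> L_infty M"
  then obtain C where "AE x in M. \<bar>f x\<bar> \<le> C" by (auto simp: L_infty_def)
  from AE_Tn[OF this, of n] show ?thesis
    using f by (rule_tac L_inftyI[OF measurable_compose[OF measurable_Tn L_infty_measurable]])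
qed

lemma L_infty_T: "f \<in> L_infty M \<Longrightarrow> (\<lambda>x. f (T x)) \<in> L_infty M"
  using L_infty_Tn[of f 1] by simp

lemma L2_Tn: "f \<in> L2 M \<Longrightarrow> (\<lambda>x. f ((T ^^ n) x)) \<in> L2 M"
  unfolding L2_def using integrable_Tn[of "\<lambda>x. (f x)\<^sup>2" n]
  by (auto intro: measurable_compose[OF measurable_Tn])

lemma L2_T: "f \<in> L2 M \<Longrightarrow> (\<lambda>x. f (T x)) \<in> L2 M"
  using L2_Tn[of f 1] by simp

end

section \<open>Conditional expectation onto a factor\<close>

locale system_factor = measure_preserving_system +
  fixes Y :: "('a \<Rightarrow> real) set"
  assumes factor_Y: "factor M T Y"
begin

abbreviation E :: "('a \<Rightarrow> real) \<Rightarrow> 'a \<Rightarrow> real" where "E \<equiv> cond_exp M Y"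
abbreviation \<F> :: "'a measure" where "\<F> \<equiv> factor_algebra M Y"

lemma finite_M: "finite_measure M" by unfold_locales

sublocale \<F>: finite_measure_subalgebra M \<F>
  by unfold_locales (rule subalgebra_factor_algebra[OF finite_M factor_Y])

lemma space_\<F>: "space \<F> = space M"
  using \<F>.subalg by (simp add: subalgebra_def)

lemma sets_\<F>_M: "A \<in> sets \<F> \<Longrightarrow> A \<in> sets M"
  using \<F>.subalg by (auto simp: subalgebra_def)

lemma indicator_factor: "A \<in> sets \<F> \<Longrightarrow> indicat_real A \<in> Y"
  by (simp add: sets_factor_algebra[OF finite_M factor_Y])

lemma sets_\<F>_I: "A \<in> sets M \<Longrightarrow> indicat_real A \<in> Y \<Longrightarrow> A \<in> sets \<F>"
  by (simp add: sets_factor_algebra[OF finite_M factor_Y])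

lemma factor_iff: "h \<in> Y \<longleftrightarrow> h \<in> borel_measurable \<F> \<and> h \<in> L2 M"
  by (intro iffI conjI factor_measurable[OF finite_M factor_Y] factor_L2[OF finite_M factor_Y])
    (auto intro: measurable_factor[OF finite_M factor_Y])

lemma T_\<F>: "T \<in> \<F> \<rightarrow>\<^sub>M \<F>"
proof (rule measurableI)
  fix x assume "x \<in> space \<F>" then show "T x \<in> space \<F>"
    using measurable_T by (auto simp: space_\<F> measurable_def)
next
  fix A assume A: "A \<in> sets \<F>"
  have 1: "(\<lambda>x. indicat_real A (T x)) \<in> Y"
    using indicator_factor[OF A] factor_Y by (auto simp: factor_def)
  have M: "T -` A \<inter> space M \<in> sets M" using measurable_sets[OF measurable_T sets_\<F>_M[OF A]] .
  then have "indicat_real (T -` A \<inter> space M) \<in> Y"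
    by (intro factor_cong[OF finite_M factor_Y 1]) (auto simp: indicator_def)
  then show "T -` A \<inter> space \<F> \<in> sets \<F>"
    using M by (simp add: space_\<F> sets_\<F>_I)
qed

lemma Tn_\<F> [measurable]: "(T ^^ n) \<in> \<F> \<rightarrow>\<^sub>M \<F>"
proof (induction n)
  case (Suc n)
  then show ?case using measurable_comp[OF Suc T_\<F>] by (simp add: o_def)
qed (simp add: id_def)

lemma E_measurable [measurable]: "E f \<in> borel_measurable \<F>" "E f \<in> borel_measurable M"
  by (auto simp: cond_exp_def)

lemma E_bound:
  assumes "f \<in> L_infty M" "AE x in M. \<bar>f x\<bar> \<le> C"
  shows "AE x in M. \<bar>E f x\<bar> \<le> C"
proof -
  have i: "integrable M f" using assms(1) by (rule L_infty_integrable)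
  have "AE x in M. E f x \<le> C" unfolding cond_exp_def
    by (rule \<F>.real_cond_exp_le_c[OF i]) (use assms(2) in \<open>eventually_elim, auto\<close>)
  moreover have "AE x in M. E f x \<ge> - C" unfolding cond_exp_def
    by (rule \<F>.real_cond_exp_ge_c[OF i]) (use assms(2) in \<open>eventually_elim, auto\<close>)
  ultimately show ?thesis by eventually_elim auto
qed

lemma E_L_infty: "f \<in> L_infty M \<Longrightarrow> E f \<in> L_infty M"
proof -
  assume f: "f \<in> L_infty M"
  then obtain C where "AE x in M. \<bar>f x\<bar> \<le> C" by (auto simp: L_infty_def)
  from E_bound[OF f this] show ?thesis by (intro L_inftyI) auto
qed

lemma E_integrable: "integrable M f \<Longrightarrow> integrable M (E f)"
  unfolding cond_exp_def by (rule \<F>.real_cond_exp_int)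

lemma E_integral: "integrable M f \<Longrightarrow> (\<integral>x. E f x \<partial>M) = (\<integral>x. f x \<partial>M)"
  unfolding cond_exp_def by (rule \<F>.real_cond_exp_int)

lemma E_factor: "f \<in> L2 M \<Longrightarrow> E f \<in> Y"
  by (rule cond_exp_projection[OF finite_M factor_Y])

lemma E_L2: "f \<in> L2 M \<Longrightarrow> E f \<in> L2 M"
  using E_factor factor_iff by blast

lemma E_cong: "AE x in M. f x = g x \<Longrightarrow> f \<in> borel_measurable M \<Longrightarrow> g \<in> borel_measurable M
    \<Longrightarrow> AE x in M. E f x = E g x"
  unfolding cond_exp_def by (rule \<F>.real_cond_exp_cong)

lemma E_add: "integrable M f \<Longrightarrow> integrable M g \<Longrightarrow> AE x in M. E (\<lambda>x. f x + g x) x = E f x + E g x"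
  unfolding cond_exp_def by (rule \<F>.real_cond_exp_add)

lemma E_diff: "integrable M f \<Longrightarrow> integrable M g \<Longrightarrow> AE x in M. E (\<lambda>x. f x - g x) x = E f x - E g x"
  unfolding cond_exp_def by (rule \<F>.real_cond_exp_diff)

lemma E_cmult: "integrable M f \<Longrightarrow> AE x in M. E (\<lambda>x. c * f x) x = c * E f x"
  unfolding cond_exp_def by (rule \<F>.real_cond_exp_cmult)

lemma E_mono: "AE x in M. f x \<le> g x \<Longrightarrow> integrable M f \<Longrightarrow> integrable M g \<Longrightarrow> AE x in M. E f x \<le> E g x"
  unfolding cond_exp_def by (rule \<F>.real_cond_exp_mono)

lemma E_nonneg: "AE x in M. 0 \<le> f x \<Longrightarrow> f \<in> borel_measurable M \<Longrightarrow> AE x in M. 0 \<le> E f x"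
  unfolding cond_exp_def by (rule \<F>.real_cond_exp_pos)

lemma E_sum:
  assumes "finite I" "\<And>i. i \<in> I \<Longrightarrow> integrable M (f i)"
  shows "AE x in M. E (\<lambda>x. \<Sum>i\<in>I. f i x) x = (\<Sum>i\<in>I. E (f i) x)"
  using assms
proof (induction I rule: finite_induct)
  case empty
  show ?case using E_cmult[of "\<lambda>_. 0" 0] by simp
next
  case (insert i I)
  have "AE x in M. E (\<lambda>x. \<Sum>i\<in>I. f i x) x = (\<Sum>i\<in>I. E (f i) x)" using insert by auto
  moreover have "AE x in M. E (\<lambda>x. f i x + (\<Sum>i\<in>I. f i x)) x = E (f i) x + E (\<lambda>x. \<Sum>i\<in>I. f i x) x"
    using insert by (intro E_add) auto
  ultimately have "AE x in M. E (\<lambda>x. f i x + (\<Sum>i\<in>I. f i x)) x = E (f i) x + (\<Sum>i\<in>I. E (f i) x)"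
    by eventually_elim simp
  then show ?case using insert by simp
qed

lemma E_mult: "h \<in> borel_measurable \<F> \<Longrightarrow> f \<in> borel_measurable M \<Longrightarrow> integrable M (\<lambda>x. h x * f x)
    \<Longrightarrow> AE x in M. E (\<lambda>x. h x * f x) x = h x * E f x"
  unfolding cond_exp_def by (rule \<F>.real_cond_exp_mult)

lemma E_ident: "h \<in> borel_measurable \<F> \<Longrightarrow> integrable M h \<Longrightarrow> AE x in M. E h x = h x"
  unfolding cond_exp_def by (rule \<F>.real_cond_exp_F_meas)

lemma E_const: "AE x in M. E (\<lambda>_. c) x = c"
  by (rule E_ident) auto

lemma E_intg: "h \<in> borel_measurable \<F> \<Longrightarrow> f \<in> borel_measurable M \<Longrightarrow> integrable M (\<lambda>x. h x * f x)
    \<Longrightarrow> (\<integral>x. h x * E f x \<partial>M) = (\<integral>x. h x * f x \<partial>M)"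
  unfolding cond_exp_def by (rule \<F>.real_cond_exp_intg)

lemma E_unique:
  assumes "integrable M f" "integrable M g" "g \<in> borel_measurable \<F>"
    and "\<And>A. A \<in> sets \<F> \<Longrightarrow> (\<integral>x. indicat_real A x * f x \<partial>M) = (\<integral>x. indicat_real A x * g x \<partial>M)"
  shows "AE x in M. E f x = g x"
  unfolding cond_exp_def
  by (rule \<F>.real_cond_exp_charact) (use assms in \<open>auto simp: set_lebesgue_integral_def\<close>)

text \<open>Multiplication by the indicator of a set of the factor commutes with \<open>E\<close>.\<close>

lemma E_local:
  assumes A: "A \<in> sets \<F>" and f: "integrable M f" and g: "integrable M g"
    and eq: "\<And>x. x \<in> A \<Longrightarrow> f x = g x"
  shows "AE x in M. x \<in> A \<longrightarrow> E f x = E g x"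
proof -
  note [measurable] = A sets_\<F>_M[OF A] borel_measurable_integrable[OF f] borel_measurable_integrable[OF g]
  have i: "integrable M (\<lambda>x. indicat_real A x * f x)" "integrable M (\<lambda>x. indicat_real A x * g x)"
    using integrable_mult_indicator[OF sets_\<F>_M[OF A] f] integrable_mult_indicator[OF sets_\<F>_M[OF A] g]
    by auto
  have eq': "(\<lambda>x. indicat_real A x * f x) = (\<lambda>x. indicat_real A x * g x)"
    using eq by (auto simp: indicator_def)
  have "AE x in M. E (\<lambda>x. indicat_real A x * f x) x = indicat_real A x * E f x"
    using i by (intro E_mult) auto
  moreover have "AE x in M. E (\<lambda>x. indicat_real A x * g x) x = indicat_real A x * E g x"
    using i by (intro E_mult) auto
  ultimately show ?thesis unfolding eq' by eventually_elim auto
qed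

lemma E_square_le:
  assumes "f \<in> L2 M"
  shows "AE x in M. (E f x)\<^sup>2 \<le> E (\<lambda>x. (f x)\<^sup>2) x"
  unfolding cond_exp_def
  by (rule \<F>.real_cond_exp_jensens_inequality[of f UNIV undefined undefined "\<lambda>x. x\<^sup>2"])
    (use assms L2_integrable[OF assms] in \<open>auto simp: convex_power2 L2_def\<close>)

lemma E_square_integral_le:
  assumes "f \<in> L2 M"
  shows "(\<integral>x. (E f x)\<^sup>2 \<partial>M) \<le> (\<integral>x. (f x)\<^sup>2 \<partial>M)"
proof -
  have "(\<integral>x. (E f x)\<^sup>2 \<partial>M) \<le> (\<integral>x. E (\<lambda>x. (f x)\<^sup>2) x \<partial>M)"
    by (rule integral_mono_AE)
      (use assms E_square_le in \<open>auto intro!: L2_integrable_power2 E_L2 E_integrable\<close>)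
  also have "\<dots> = (\<integral>x. (f x)\<^sup>2 \<partial>M)" using assms by (intro E_integral L2_integrable_power2)
  finally show ?thesis .
qed

lemma E_square_add_le:
  assumes "f \<in> L2 M" "g \<in> L2 M"
  shows "AE x in M. E (\<lambda>x. (f x + g x)\<^sup>2) x \<le> 2 * E (\<lambda>x. (f x)\<^sup>2) x + 2 * E (\<lambda>x. (g x)\<^sup>2) x"
proof -
  have i: "integrable M (\<lambda>x. (f x)\<^sup>2)" "integrable M (\<lambda>x. (g x)\<^sup>2)" "integrable M (\<lambda>x. (f x + g x)\<^sup>2)"
    using assms by (auto intro: L2_integrable_power2 L2_add)
  have "AE x in M. E (\<lambda>x. (f x + g x)\<^sup>2) x \<le> E (\<lambda>x. 2 * (f x)\<^sup>2 + 2 * (g x)\<^sup>2) x"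
    using i square_sum_le by (intro E_mono) auto
  moreover have "AE x in M. E (\<lambda>x. 2 * (f x)\<^sup>2 + 2 * (g x)\<^sup>2) x
      = E (\<lambda>x. 2 * (f x)\<^sup>2) x + E (\<lambda>x. 2 * (g x)\<^sup>2) x"
    using i by (intro E_add) auto
  moreover have "AE x in M. E (\<lambda>x. 2 * (f x)\<^sup>2) x = 2 * E (\<lambda>x. (f x)\<^sup>2) x"
    "AE x in M. E (\<lambda>x. 2 * (g x)\<^sup>2) x = 2 * E (\<lambda>x. (g x)\<^sup>2) x"
    using i by (auto intro!: E_cmult)
  ultimately show ?thesis by eventually_elim simp
qed

end


section \<open>Relatively almost periodic functions\<close>

context measure_preserving_system
begin

text \<open>Each of the operations is Lipschitz for the \<open>L\<^sup>2\<close> distance.\<close>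

lemma l2_closure_factorI:
  assumes A: "A \<subseteq> L2 M" and const: "\<And>c. (\<lambda>_. c) \<in> A"
    and add: "\<And>f g. f \<in> A \<Longrightarrow> g \<in> A \<Longrightarrow> (\<lambda>x. f x + g x) \<in> A"
    and cmult: "\<And>f c. f \<in> A \<Longrightarrow> (\<lambda>x. c * f x) \<in> A"
    and pos: "\<And>f. f \<in> A \<Longrightarrow> (\<lambda>x. max (f x) 0) \<in> A"
    and T: "\<And>f. f \<in> A \<Longrightarrow> (\<lambda>x. f (T x)) \<in> A"
  shows "factor M T (l2_closure M A)"
proof -
  let ?C = "l2_closure M A"
  have L2: "f \<in> L2 M" if "f \<in> ?C" for f using that by (simp add: l2_closure_def)
  have approx: "\<exists>g\<in>A. (\<integral>x. (f x - g x)\<^sup>2 \<partial>M) < e" if "f \<in> ?C" "e > 0" for f e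
    using that by (auto simp: l2_closure_iff)
  have sq: "integrable M (\<lambda>x. (f x - g x)\<^sup>2)" if "f \<in> L2 M" "g \<in> L2 M" for f g
    using that by (intro L2_integrable_power2 L2_diff)
  have 1: "(\<lambda>_. c) \<in> ?C" for c using l2_closure_superset[OF A] const by blast
  have 2: "(\<lambda>x. f x + g x) \<in> ?C" if fg: "f \<in> ?C" "g \<in> ?C" for f g
    unfolding l2_closure_iff
  proof (intro conjI allI impI)
    show "(\<lambda>x. f x + g x) \<in> L2 M" using fg by (intro L2_add L2)
    fix e :: real assume e: "e > 0"
    obtain f' where f': "f' \<in> A" "(\<integral>x. (f x - f' x)\<^sup>2 \<partial>M) < e / 4" using approx[OF fg(1), of "e/4"] e by auto
    obtain g' where g': "g' \<in> A" "(\<integral>x. (g x - g' x)\<^sup>2 \<partial>M) < e / 4" using approx[OF fg(2), of "e/4"] e by auto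
    have l: "f \<in> L2 M" "f' \<in> L2 M" "g \<in> L2 M" "g' \<in> L2 M" using fg f' g' A L2 by auto
    have "(\<integral>x. (f x + g x - (f' x + g' x))\<^sup>2 \<partial>M) \<le> (\<integral>x. 2 * (f x - f' x)\<^sup>2 + 2 * (g x - g' x)\<^sup>2 \<partial>M)"
    proof (rule integral_mono)
      show "integrable M (\<lambda>x. (f x + g x - (f' x + g' x))\<^sup>2)" using l by (intro sq L2_add)
      show "integrable M (\<lambda>x. 2 * (f x - f' x)\<^sup>2 + 2 * (g x - g' x)\<^sup>2)" using sq[OF l(1,2)] sq[OF l(3,4)] by simp
      show "(f x + g x - (f' x + g' x))\<^sup>2 \<le> 2 * (f x - f' x)\<^sup>2 + 2 * (g x - g' x)\<^sup>2" for x
        using square_sum_le[of "f x - f' x" "g x - g' x"] by (simp add: algebra_simps)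
    qed
    also have "\<dots> = 2 * (\<integral>x. (f x - f' x)\<^sup>2 \<partial>M) + 2 * (\<integral>x. (g x - g' x)\<^sup>2 \<partial>M)"
      using sq[OF l(1,2)] sq[OF l(3,4)] by simp
    finally have "(\<integral>x. (f x + g x - (f' x + g' x))\<^sup>2 \<partial>M) < e" using f' g' by simp
    then show "\<exists>h\<in>A. (\<integral>x. (f x + g x - h x)\<^sup>2 \<partial>M) < e"
      using add[OF f'(1) g'(1)] by (rule_tac x = "\<lambda>x. f' x + g' x" in bexI) auto
  qed
  have 3: "(\<lambda>x. c * f x) \<in> ?C" if f: "f \<in> ?C" for f c
    unfolding l2_closure_iff
  proof (intro conjI allI impI)
    show "(\<lambda>x. c * f x) \<in> L2 M" using f by (intro L2_cmult L2)
    fix e :: real assume e: "e > 0"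
    have c: "c\<^sup>2 + 1 > 0" by (smt (verit) zero_le_power2)
    obtain f' where f': "f' \<in> A" "(\<integral>x. (f x - f' x)\<^sup>2 \<partial>M) < e / (c\<^sup>2 + 1)"
      using approx[OF f, of "e / (c\<^sup>2 + 1)"] e c by auto
    have "(\<integral>x. (c * f x - c * f' x)\<^sup>2 \<partial>M) = (\<integral>x. c\<^sup>2 * (f x - f' x)\<^sup>2 \<partial>M)"
      by (simp add: power_mult_distrib flip: right_diff_distrib)
    also have "\<dots> = c\<^sup>2 * (\<integral>x. (f x - f' x)\<^sup>2 \<partial>M)" by simp
    also have "\<dots> \<le> (c\<^sup>2 + 1) * (\<integral>x. (f x - f' x)\<^sup>2 \<partial>M)" by (intro mult_right_mono) auto
    also have "\<dots> < e" using f'(2) c by (simp add: pos_less_divide_eq mult.commute)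
    finally show "\<exists>h\<in>A. (\<integral>x. (c * f x - h x)\<^sup>2 \<partial>M) < e"
      using cmult[OF f'(1), of c] by (rule_tac x = "\<lambda>x. c * f' x" in bexI) auto
  qed
  have 4: "(\<lambda>x. max (f x) 0) \<in> ?C" if f: "f \<in> ?C" for f
    unfolding l2_closure_iff
  proof (intro conjI allI impI)
    show "(\<lambda>x. max (f x) 0) \<in> L2 M" using f by (intro L2_max L2)
    fix e :: real assume e: "e > 0"
    obtain f' where f': "f' \<in> A" "(\<integral>x. (f x - f' x)\<^sup>2 \<partial>M) < e" using approx[OF f e] by auto
    have l: "f \<in> L2 M" "f' \<in> L2 M" using f f' A L2 by auto
    have "(\<integral>x. (max (f x) 0 - max (f' x) 0)\<^sup>2 \<partial>M) \<le> (\<integral>x. (f x - f' x)\<^sup>2 \<partial>M)"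
      using l by (intro integral_mono sq L2_max) (auto simp: abs_le_square_iff[symmetric] max_def)
    then show "\<exists>h\<in>A. (\<integral>x. (max (f x) 0 - h x)\<^sup>2 \<partial>M) < e"
      using pos[OF f'(1)] f'(2) by (rule_tac x = "\<lambda>x. max (f' x) 0" in bexI) auto
  qed
  have 5: "(\<lambda>x. f (T x)) \<in> ?C" if f: "f \<in> ?C" for f
    unfolding l2_closure_iff
  proof (intro conjI allI impI)
    show "(\<lambda>x. f (T x)) \<in> L2 M" using f by (intro L2_T L2)
    fix e :: real assume e: "e > 0"
    obtain f' where f': "f' \<in> A" "(\<integral>x. (f x - f' x)\<^sup>2 \<partial>M) < e" using approx[OF f e] by auto
    have l: "f \<in> L2 M" "f' \<in> L2 M" using f f' A L2 by auto
    have "(\<integral>x. (f (T x) - f' (T x))\<^sup>2 \<partial>M) = (\<integral>x. (f x - f' x)\<^sup>2 \<partial>M)"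
      using integral_Tn[of "\<lambda>x. (f x - f' x)\<^sup>2" 1] borel_measurable_integrable[OF sq[OF l]] by simp
    then show "\<exists>h\<in>A. (\<integral>x. (f (T x) - h x)\<^sup>2 \<partial>M) < e"
      using T[OF f'(1)] f'(2) by (rule_tac x = "\<lambda>x. f' (T x)" in bexI) auto
  qed
  show ?thesis
    unfolding factor_def using 1 2 3 4 5 l2_closure_idem[OF A] by auto
qed

lemma trivial_factor_factor: "factor M T (trivial_factor M)"
proof -
  let ?A = "trivial_factor M"
  have "factor M T (l2_closure M ?A)"
  proof (rule l2_closure_factorI)
    show "(\<lambda>_. c) \<in> ?A" for c using L_infty_L2[OF L_infty_const] by (auto simp: trivial_factor_def)
    show "(\<lambda>x. f x + g x) \<in> ?A" if h: "f \<in> ?A" "g \<in> ?A" for f g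
    proof -
      obtain c d where "AE x in M. f x = c" "AE x in M. g x = d" using h by (auto simp: trivial_factor_def)
      then have "AE x in M. f x + g x = c + d" by eventually_elim simp
      then show ?thesis using h by (auto simp: trivial_factor_def L2_add)
    qed
    show "(\<lambda>x. c * f x) \<in> ?A" if h: "f \<in> ?A" for f c
    proof -
      obtain d where "AE x in M. f x = d" using h by (auto simp: trivial_factor_def)
      then have "AE x in M. c * f x = c * d" by eventually_elim simp
      then show ?thesis using h by (auto simp: trivial_factor_def L2_cmult)
    qed
    show "(\<lambda>x. max (f x) 0) \<in> ?A" if h: "f \<in> ?A" for f
    proof -
      obtain d where "AE x in M. f x = d" using h by (auto simp: trivial_factor_def)
      then have "AE x in M. max (f x) 0 = max d 0" by eventually_elim simp
      then show ?thesis using h by (auto simp: trivial_factor_def L2_max)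
    qed
    show "(\<lambda>x. f (T x)) \<in> ?A" if h: "f \<in> ?A" for f
    proof -
      obtain d where "AE x in M. f x = d" using h by (auto simp: trivial_factor_def)
      then have "AE x in M. f (T x) = d" by (rule AE_T)
      then show ?thesis using h by (auto simp: trivial_factor_def L2_T)
    qed
  qed (auto simp: trivial_factor_def)
  moreover have "l2_closure M ?A = ?A"
  proof
    show "?A \<subseteq> l2_closure M ?A" by (rule l2_closure_superset) (auto simp: trivial_factor_def)
    show "l2_closure M ?A \<subseteq> ?A"
    proof
      fix f assume f: "f \<in> l2_closure M ?A"
      then have L2: "f \<in> L2 M" by (simp add: l2_closure_def)
      have "\<exists>c. AE x in M. f x = c"
      proof (cases "measure M (space M) = 0")
        case True
        then have "emeasure M (space M) = 0" by (simp add: emeasure_eq_measure)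
        then have "AE x in M. f x = 0" by (intro AE_I[where N = "space M"]) auto
        then show ?thesis by blast
      next
        case False
        \<comment> \<open>The mean is the constant closest to \<open>f\<close>, so its distance to \<open>f\<close> is zero.\<close>
        define m where "m = (\<integral>x. f x \<partial>M) / measure M (space M)"
        have int: "integrable M f" "integrable M (\<lambda>x. (f x)\<^sup>2)" using L2_integrable[OF L2] L2 by (auto simp: L2_def)
        have quad: "(\<integral>x. (f x - c)\<^sup>2 \<partial>M) = (\<integral>x. (f x)\<^sup>2 \<partial>M) - 2 * c * (\<integral>x. f x \<partial>M) + c\<^sup>2 * measure M (space M)" for c
        proof -
          have "(\<integral>x. (f x - c)\<^sup>2 \<partial>M) = (\<integral>x. (f x)\<^sup>2 - 2 * c * f x + c\<^sup>2 \<partial>M)"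
            by (intro Bochner_Integration.integral_cong) (auto simp: power2_eq_square algebra_simps)
          then show ?thesis using int by (simp add: mult.commute)
        qed
        have "(\<integral>x. (f x - m)\<^sup>2 \<partial>M) \<le> (\<integral>x. (f x - c)\<^sup>2 \<partial>M)" for c
        proof -
          have "0 \<le> (m - c)\<^sup>2 * measure M (space M)" by simp
          moreover have "(\<integral>x. f x \<partial>M) = m * measure M (space M)" using False by (simp add: m_def)
          ultimately show ?thesis unfolding quad by (simp add: power2_eq_square algebra_simps)
        qed
        moreover have "\<exists>c. (\<integral>x. (f x - c)\<^sup>2 \<partial>M) < e" if e: "e > 0" for e
        proof -
          obtain g where g: "g \<in> ?A" "(\<integral>x. (f x - g x)\<^sup>2 \<partial>M) < e" using f e by (auto simp: l2_closure_iff)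
          then obtain c where c: "AE x in M. g x = c" "g \<in> L2 M" by (auto simp: trivial_factor_def)
          have "(\<integral>x. (f x - g x)\<^sup>2 \<partial>M) = (\<integral>x. (f x - c)\<^sup>2 \<partial>M)"
            using L2_measurable[OF L2] L2_measurable[OF c(2)] c(1)
            by (intro integral_cong_AE) (auto elim: eventually_mono)
          then show ?thesis using g by auto
        qed
        ultimately have "(\<integral>x. (f x - m)\<^sup>2 \<partial>M) \<le> 0"
          by (meson field_le_epsilon less_eq_real_def order.trans not_less)
        then have "(\<integral>x. (f x - m)\<^sup>2 \<partial>M) = 0" by (simp add: order_antisym)
        moreover have "integrable M (\<lambda>x. (f x - m)\<^sup>2)"
          by (intro L2_integrable_power2 L2_diff L2 L_infty_L2 L_infty_const)
        ultimately have "AE x in M. (f x - m)\<^sup>2 = 0"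
          using integral_nonneg_eq_0_iff_AE[of M "\<lambda>x. (f x - m)\<^sup>2"] by simp
        then show ?thesis by auto
      qed
      then show "f \<in> ?A" using L2 by (simp add: trivial_factor_def)
    qed
  qed
  ultimately show ?thesis by simp
qed

end

context system_factor
begin

abbreviation AP :: "('a \<Rightarrow> real) \<Rightarrow> bool" where "AP \<equiv> almost_periodic M T Y"

text \<open>A finite set of squares avoids both the enumeration and the square root in the definition.\<close>

lemma almost_periodic_iff:
  "AP f \<longleftrightarrow> f \<in> L2 M \<and> (\<forall>\<delta>>0. \<exists>G. finite G \<and> G \<subseteq> L2 M \<and>
     (\<forall>n. AE y in M. \<exists>g\<in>G. E (\<lambda>x. (f ((T ^^ n) x) - g x)\<^sup>2) y < \<delta>))"
  (is "_ \<longleftrightarrow> _ \<and> (\<forall>\<delta>>0. ?Q \<delta>)")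
proof -
  have "?Q \<delta>" if AP: "AP f" and \<delta>: "\<delta> > 0" for \<delta>
  proof -
    obtain j :: nat and g where g: "\<forall>i\<le>j. g i \<in> L2 M"
      "\<forall>n. AE y in M. (MIN i\<in>{..j}. cond_norm M Y (\<lambda>x. f ((T ^^ n) x) - g i x) y) < sqrt \<delta>"
      using AP \<delta> unfolding almost_periodic_def by (meson real_sqrt_gt_0_iff)
    have "AE y in M. \<exists>h\<in>g ` {..j}. E (\<lambda>x. (f ((T ^^ n) x) - h x)\<^sup>2) y < \<delta>" for n
      using g(2)[rule_format, of n]
    proof eventually_elim
      case (elim y)
      then have "\<exists>i\<in>{..j}. cond_norm M Y (\<lambda>x. f ((T ^^ n) x) - g i x) y < sqrt \<delta>"
        by (subst (asm) Min_less_iff) auto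
      then show ?case by (auto simp: cond_norm_def)
    qed
    then show ?thesis using g(1) by (intro exI[of _ "g ` {..j}"]) auto
  qed
  moreover have "AP f" if f: "f \<in> L2 M" and Q: "\<forall>\<delta>>0. ?Q \<delta>"
    unfolding almost_periodic_def
  proof (intro conjI allI impI f)
    fix \<delta> :: real assume \<delta>: "\<delta> > 0"
    obtain G where G: "finite G" "G \<subseteq> L2 M"
      "\<And>n. AE y in M. \<exists>g\<in>G. E (\<lambda>x. (f ((T ^^ n) x) - g x)\<^sup>2) y < \<delta>\<^sup>2"
      using Q \<delta> by (meson zero_less_power)
    have "finite (insert (\<lambda>_. 0) G)" using G by simp
    then obtain k g where kg: "insert (\<lambda>_. 0) G = g ` {i::nat. i < k}"
      using finite_imp_nat_seg_image_inj_on by metis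
    then have "k > 0" by (cases k) auto
    then have k: "{i. i < k} = {..k - 1}" by auto
    have gL2: "\<forall>i\<le>k - 1. g i \<in> L2 M"
      using kg G(2) L_infty_L2[OF L_infty_const] k by (metis atMost_iff image_eqI insert_iff subsetD)
    moreover have "AE y in M. (MIN i\<in>{..k - 1}. cond_norm M Y (\<lambda>x. f ((T ^^ n) x) - g i x) y) < \<delta>" for n
      using G(3)[of n]
    proof eventually_elim
      case (elim y)
      then obtain h where h: "h \<in> G" "E (\<lambda>x. (f ((T ^^ n) x) - h x)\<^sup>2) y < \<delta>\<^sup>2" by blast
      then obtain i where i: "i \<le> k - 1" "h = g i" using kg k by (metis (lifting) atMost_iff imageE insert_iff)
      have "cond_norm M Y (\<lambda>x. f ((T ^^ n) x) - g i x) y < \<delta>"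
        using h(2) i \<delta> real_sqrt_less_iff[of _ "\<delta>\<^sup>2"] by (simp add: cond_norm_def)
      then show ?case using i by (subst Min_less_iff) auto
    qed
    ultimately show "\<exists>(j::nat) g. (\<forall>i\<le>j. g i \<in> L2 M) \<and>
        (\<forall>n. AE y in M. (MIN i\<in>{..j}. cond_norm M Y (\<lambda>x. f ((T ^^ n) x) - g i x) y) < \<delta>)"
      by (intro exI[of _ "k - 1"] exI[of _ g]) auto
  qed
  ultimately show ?thesis by (auto simp: almost_periodic_def)
qed

lemma AP_L2: "AP f \<Longrightarrow> f \<in> L2 M"
  by (simp add: almost_periodic_def)

lemma AP_approx:
  assumes "AP f" "\<delta> > 0"
  obtains G where "finite G" "G \<subseteq> L2 M"
    "\<And>n. AE y in M. \<exists>g\<in>G. E (\<lambda>x. (f ((T ^^ n) x) - g x)\<^sup>2) y < \<delta>"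
  using assms unfolding almost_periodic_iff by blast

lemma AP_add:
  assumes "AP f" "AP f'"
  shows "AP (\<lambda>x. f x + f' x)"
  unfolding almost_periodic_iff
proof (intro conjI allI impI)
  note L2 = AP_L2[OF assms(1)] AP_L2[OF assms(2)]
  show "(\<lambda>x. f x + f' x) \<in> L2 M" using L2 by (rule L2_add)
  fix \<delta> :: real assume \<delta>: "\<delta> > 0"
  then have "\<delta> / 4 > 0" by simp
  obtain G where G: "finite G" "G \<subseteq> L2 M"
    "\<And>n. AE y in M. \<exists>g\<in>G. E (\<lambda>x. (f ((T ^^ n) x) - g x)\<^sup>2) y < \<delta> / 4"
    using AP_approx[OF assms(1) \<open>\<delta> / 4 > 0\<close>] by blast
  obtain G' where G': "finite G'" "G' \<subseteq> L2 M"
    "\<And>n. AE y in M. \<exists>g\<in>G'. E (\<lambda>x. (f' ((T ^^ n) x) - g x)\<^sup>2) y < \<delta> / 4"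
    using AP_approx[OF assms(2) \<open>\<delta> / 4 > 0\<close>] by blast
  let ?H = "(\<lambda>(g, g'). \<lambda>x. g x + g' x) ` (G \<times> G')"
  have "AE y in M. \<exists>h\<in>?H. E (\<lambda>x. (f ((T ^^ n) x) + f' ((T ^^ n) x) - h x)\<^sup>2) y < \<delta>" for n
  proof -
    have "AE y in M. \<forall>p\<in>G \<times> G'. E (\<lambda>x. (f ((T ^^ n) x) - fst p x + (f' ((T ^^ n) x) - snd p x))\<^sup>2) y
        \<le> 2 * E (\<lambda>x. (f ((T ^^ n) x) - fst p x)\<^sup>2) y + 2 * E (\<lambda>x. (f' ((T ^^ n) x) - snd p x)\<^sup>2) y"
      using G G' by (intro AE_finite_allI E_square_add_le L2_diff L2_Tn L2) auto
    then show ?thesis using G(3)[of n] G'(3)[of n]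
    proof eventually_elim
      case (elim y)
      then obtain g g' where g: "g \<in> G" "g' \<in> G'" "E (\<lambda>x. (f ((T ^^ n) x) - g x)\<^sup>2) y < \<delta> / 4"
        "E (\<lambda>x. (f' ((T ^^ n) x) - g' x)\<^sup>2) y < \<delta> / 4" by blast
      have "E (\<lambda>x. (f ((T ^^ n) x) - g x + (f' ((T ^^ n) x) - g' x))\<^sup>2) y < \<delta>"
        using elim(1)[rule_format, of "(g, g')"] g by simp
      moreover have "(\<lambda>x. (f ((T ^^ n) x) - g x + (f' ((T ^^ n) x) - g' x))\<^sup>2)
          = (\<lambda>x. (f ((T ^^ n) x) + f' ((T ^^ n) x) - (g x + g' x))\<^sup>2)"
        by (simp add: algebra_simps)
      ultimately show ?case using g by (intro bexI[of _ "\<lambda>x. g x + g' x"]) auto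
    qed
  qed
  moreover have "finite ?H" "?H \<subseteq> L2 M" using G G' by (auto intro!: L2_add)
  ultimately show "\<exists>H. finite H \<and> H \<subseteq> L2 M \<and>
     (\<forall>n. AE y in M. \<exists>h\<in>H. E (\<lambda>x. (f ((T ^^ n) x) + f' ((T ^^ n) x) - h x)\<^sup>2) y < \<delta>)" by blast
qed

text \<open>Scalar multiples, positive parts and truncations are all of this form: a finite approximating set for \<open>f\<close>
is carried by \<open>\<phi>\<close> to one for \<open>\<phi> \<circ> f\<close>.\<close>

lemma AP_lipschitz:
  fixes \<phi> :: "real \<Rightarrow> real"
  assumes f: "AP f" and lip: "\<And>s t. \<bar>\<phi> s - \<phi> t\<bar> \<le> K * \<bar>s - t\<bar>" and [measurable]: "\<phi> \<in> borel_measurable borel"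
  shows "AP (\<lambda>x. \<phi> (f x))"
  unfolding almost_periodic_iff
proof (intro conjI allI impI)
  note L2 = AP_L2[OF f]
  have \<phi>L2: "(\<lambda>x. \<phi> (g x)) \<in> L2 M" if g: "g \<in> L2 M" for g
  proof (rule L2_bounded_by)
    show "(\<lambda>x. K * \<bar>g x\<bar> + \<bar>\<phi> 0\<bar>) \<in> L2 M"
      by (intro L2_add L2_cmult L_infty_L2[OF L_infty_const] L2_bounded_by[OF g])
        (use g in \<open>auto simp: L2_def\<close>)
    show "(\<lambda>x. \<phi> (g x)) \<in> borel_measurable M" using g by (auto simp: L2_def)
    show "\<bar>\<phi> (g x)\<bar> \<le> \<bar>K * \<bar>g x\<bar> + \<bar>\<phi> 0\<bar>\<bar>" for x using lip[of "g x" 0] by auto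
  qed
  show "(\<lambda>x. \<phi> (f x)) \<in> L2 M" by (rule \<phi>L2[OF L2])
  fix \<delta> :: real assume \<delta>: "\<delta> > 0"
  have K: "K\<^sup>2 + 1 > 0" by (smt (verit) zero_le_power2)
  then have "\<delta> / (K\<^sup>2 + 1) > 0" using \<delta> by simp
  obtain G where G: "finite G" "G \<subseteq> L2 M"
    "\<And>n. AE y in M. \<exists>g\<in>G. E (\<lambda>x. (f ((T ^^ n) x) - g x)\<^sup>2) y < \<delta> / (K\<^sup>2 + 1)"
    using AP_approx[OF f \<open>\<delta> / (K\<^sup>2 + 1) > 0\<close>] by blast
  let ?H = "(\<lambda>g x. \<phi> (g x)) ` G"
  have "AE y in M. \<exists>h\<in>?H. E (\<lambda>x. (\<phi> (f ((T ^^ n) x)) - h x)\<^sup>2) y < \<delta>" for n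
  proof -
    have "AE y in M. \<forall>g\<in>G. E (\<lambda>x. (\<phi> (f ((T ^^ n) x)) - \<phi> (g x))\<^sup>2) y \<le> (K\<^sup>2 + 1) * E (\<lambda>x. (f ((T ^^ n) x) - g x)\<^sup>2) y"
    proof (rule AE_finite_allI[OF G(1)])
      fix g assume "g \<in> G"
      then have g: "g \<in> L2 M" using G by auto
      have i: "integrable M (\<lambda>x. (f ((T ^^ n) x) - g x)\<^sup>2)"
        by (intro L2_integrable_power2 L2_diff L2_Tn L2 g)
      have "AE x in M. E (\<lambda>x. (\<phi> (f ((T ^^ n) x)) - \<phi> (g x))\<^sup>2) x \<le> E (\<lambda>x. (K\<^sup>2 + 1) * (f ((T ^^ n) x) - g x)\<^sup>2) x"
      proof (rule E_mono)
        show "AE x in M. (\<phi> (f ((T ^^ n) x)) - \<phi> (g x))\<^sup>2 \<le> (K\<^sup>2 + 1) * (f ((T ^^ n) x) - g x)\<^sup>2"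
        proof (rule AE_I2)
          fix x
          have "\<bar>\<phi> (f ((T ^^ n) x)) - \<phi> (g x)\<bar>\<^sup>2 \<le> (K * \<bar>f ((T ^^ n) x) - g x\<bar>)\<^sup>2"
            by (intro power_mono lip) auto
          then show "(\<phi> (f ((T ^^ n) x)) - \<phi> (g x))\<^sup>2 \<le> (K\<^sup>2 + 1) * (f ((T ^^ n) x) - g x)\<^sup>2"
            by (simp add: power_mult_distrib distrib_right add_increasing2)
        qed
        show "integrable M (\<lambda>x. (\<phi> (f ((T ^^ n) x)) - \<phi> (g x))\<^sup>2)"
          by (intro L2_integrable_power2 L2_diff \<phi>L2 L2_Tn L2 g)
      qed (use i in simp)
      with E_cmult[OF i, of "K\<^sup>2 + 1"]
      show "AE x in M. E (\<lambda>x. (\<phi> (f ((T ^^ n) x)) - \<phi> (g x))\<^sup>2) x \<le> (K\<^sup>2 + 1) * E (\<lambda>x. (f ((T ^^ n) x) - g x)\<^sup>2) x"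
        by eventually_elim simp
    qed
    then show ?thesis using G(3)[of n]
    proof eventually_elim
      case (elim y)
      then obtain g where g: "g \<in> G" "E (\<lambda>x. (f ((T ^^ n) x) - g x)\<^sup>2) y < \<delta> / (K\<^sup>2 + 1)" by blast
      then have "(K\<^sup>2 + 1) * E (\<lambda>x. (f ((T ^^ n) x) - g x)\<^sup>2) y < \<delta>"
        using K by (simp add: pos_less_divide_eq mult.commute)
      then have "E (\<lambda>x. (\<phi> (f ((T ^^ n) x)) - \<phi> (g x))\<^sup>2) y < \<delta>" using elim(1) g by force
      then show ?case using g by (intro bexI[of _ "\<lambda>x. \<phi> (g x)"]) auto
    qed
  qed
  moreover have "finite ?H" "?H \<subseteq> L2 M" using G \<phi>L2 by auto
  ultimately show "\<exists>H. finite H \<and> H \<subseteq> L2 M \<and>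
     (\<forall>n. AE y in M. \<exists>h\<in>H. E (\<lambda>x. (\<phi> (f ((T ^^ n) x)) - h x)\<^sup>2) y < \<delta>)" by blast
qed

lemma AP_T:
  assumes "AP f" shows "AP (\<lambda>x. f (T x))"
  unfolding almost_periodic_iff
proof (intro conjI allI impI)
  show "(\<lambda>x. f (T x)) \<in> L2 M" using assms by (intro L2_T AP_L2)
  fix \<delta> :: real assume \<delta>: "\<delta> > 0"
  obtain G where G: "finite G" "G \<subseteq> L2 M"
    "\<And>n. AE y in M. \<exists>g\<in>G. E (\<lambda>x. (f ((T ^^ n) x) - g x)\<^sup>2) y < \<delta>"
    using AP_approx[OF assms \<delta>] by blast
  have "AE y in M. \<exists>g\<in>G. E (\<lambda>x. (f (T ((T ^^ n) x)) - g x)\<^sup>2) y < \<delta>" for n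
    using G(3)[of "Suc n"] by simp
  then show "\<exists>G. finite G \<and> G \<subseteq> L2 M \<and>
     (\<forall>n. AE y in M. \<exists>g\<in>G. E (\<lambda>x. (f (T ((T ^^ n) x)) - g x)\<^sup>2) y < \<delta>)" using G by blast
qed

lemma finite_grid:
  fixes C \<eta> :: real
  assumes "\<eta> > 0"
  obtains V where "finite V" "\<And>t. \<bar>t\<bar> \<le> C \<Longrightarrow> \<exists>v\<in>V. \<bar>t - v\<bar> < \<eta>"
proof -
  obtain V where V: "finite V" "{-C..C} \<subseteq> (\<Union>v\<in>V. ball v \<eta>)"
    using compact_eq_totally_bounded[of "{-C..C}"] assms by auto
  have "\<exists>v\<in>V. \<bar>t - v\<bar> < \<eta>" if "\<bar>t\<bar> \<le> C" for t
  proof -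
    have "t \<in> {-C..C}" using that by auto
    then show ?thesis using V(2) by (force simp: dist_real_def abs_minus_commute)
  qed
  then show ?thesis using that V(1) by blast
qed

text \<open>On the fibres of \<open>Y\<close> a function of \<open>Y\<close> is constant, so finitely many constants suffice.\<close>

lemma AP_of_factor:
  assumes h: "h \<in> Y" "h \<in> L_infty M"
  shows "AP h"
  unfolding almost_periodic_iff
proof (intro conjI allI impI)
  show "h \<in> L2 M" using h L_infty_L2 by blast
  fix \<delta> :: real assume "\<delta> > 0"
  then have "sqrt \<delta> > 0" by simp
  obtain C where C: "C > 0" "AE x in M. \<bar>h x\<bar> \<le> C" using h(2) by (rule L_inftyE)
  obtain V where V: "finite V" "\<And>t. \<bar>t\<bar> \<le> C \<Longrightarrow> \<exists>v\<in>V. \<bar>t - v\<bar> < sqrt \<delta>"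
    using finite_grid[OF \<open>sqrt \<delta> > 0\<close>] by blast
  let ?G = "(\<lambda>v. \<lambda>_::'a. v) ` V"
  have "AE y in M. \<exists>g\<in>?G. E (\<lambda>x. (h ((T ^^ n) x) - g x)\<^sup>2) y < \<delta>" for n
  proof -
    have hF: "h \<in> borel_measurable \<F>" using h factor_iff by blast
    have "AE y in M. \<forall>v\<in>V. E (\<lambda>x. (h ((T ^^ n) x) - v)\<^sup>2) y = (h ((T ^^ n) y) - v)\<^sup>2"
    proof (intro AE_finite_allI E_ident V)
      fix v
      show "integrable M (\<lambda>x. (h ((T ^^ n) x) - v)\<^sup>2)"
        by (intro L_infty_integrable L_infty_power2 L_infty_diff L_infty_const L_infty_Tn h)
      show "(\<lambda>x. (h ((T ^^ n) x) - v)\<^sup>2) \<in> borel_measurable \<F>"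
        using measurable_compose[OF Tn_\<F> hF] by measurable
    qed
    then show ?thesis using AE_Tn[OF C(2), of n]
    proof eventually_elim
      case (elim y)
      obtain v where v: "v \<in> V" "\<bar>h ((T ^^ n) y) - v\<bar> < sqrt \<delta>" using V(2)[OF elim(2)] by blast
      have "\<bar>h ((T ^^ n) y) - v\<bar>\<^sup>2 < (sqrt \<delta>)\<^sup>2" using v(2) by (intro power_strict_mono) auto
      then have "E (\<lambda>x. (h ((T ^^ n) x) - v)\<^sup>2) y < \<delta>" using elim(1) v(1) \<open>\<delta> > 0\<close> by simp
      then show ?case using v(1) by (intro bexI[of _ "\<lambda>_. v"]) auto
    qed
  qed
  moreover have "finite ?G" "?G \<subseteq> L2 M" using V(1) L_infty_L2[OF L_infty_const] by auto
  ultimately show "\<exists>G. finite G \<and> G \<subseteq> L2 M \<and> (\<forall>n. AE y in M. \<exists>g\<in>G. E (\<lambda>x. (h ((T ^^ n) x) - g x)\<^sup>2) y < \<delta>)"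
    by blast
qed

lemma AP_const: "AP (\<lambda>_. c)"
  using factor_Y by (intro AP_of_factor L_infty_const) (simp add: factor_def)

lemma AP_cmult: "AP f \<Longrightarrow> AP (\<lambda>x. c * f x)"
  by (rule AP_lipschitz[where K = "\<bar>c\<bar>"]) (auto simp flip: right_diff_distrib simp: abs_mult)

lemma AP_max: "AP f \<Longrightarrow> AP (\<lambda>x. max (f x) 0)"
  by (rule AP_lipschitz[where K = 1]) (auto simp: max_def)

lemma AP_truncate: "AP f \<Longrightarrow> C \<ge> 0 \<Longrightarrow> AP (\<lambda>x. max (min (f x) C) (-C))"
  by (rule AP_lipschitz[where K = 1 and \<phi> = "\<lambda>t. max (min t C) (-C)"]) (auto simp: max_def min_def)

text \<open>Almost periodic functions already form a subspace, so \<open>Z\<close> is just their closure.\<close>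

lemma lin_span_AP: "lin_span {f. AP f} = {f. AP f}"
proof
  show "lin_span {f. AP f} \<subseteq> {f. AP f}"
  proof
    fix h assume "h \<in> lin_span {f. AP f}"
    then obtain n and c :: "nat \<Rightarrow> real" and g where h: "h = (\<lambda>x. \<Sum>i<n. c i * g i x)" "\<forall>i<n. AP (g i)"
      unfolding lin_span_def by blast
    have "AP (\<lambda>x. \<Sum>i<m. c i * g i x)" if "m \<le> n" for m
      using that
    proof (induction m)
      case (Suc m)
      then have "AP (\<lambda>x. (\<Sum>i<m. c i * g i x) + c m * g m x)" using h(2) by (intro AP_add AP_cmult) auto
      then show ?case by simp
    qed (simp add: AP_const)
    then show "h \<in> {f. AP f}" using h by simp
  qed
  show "{f. AP f} \<subseteq> lin_span {f. AP f}"
  proof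
    fix f assume "f \<in> {f. AP f}"
    then show "f \<in> lin_span {f. AP f}" unfolding lin_span_def
      by (intro CollectI exI[of _ "1::nat"] exI[of _ "\<lambda>_. 1"] exI[of _ "\<lambda>_. f"]) auto
  qed
qed

abbreviation Z :: "('a \<Rightarrow> real) set" where "Z \<equiv> max_compact_ext M T Y"

lemma Z_eq: "Z = l2_closure M {f. AP f}"
  by (simp add: max_compact_ext_def lin_span_AP)

lemma factor_Z: "factor M T Z"
  unfolding Z_eq using AP_L2 AP_const AP_add AP_cmult AP_max AP_T
  by (intro l2_closure_factorI) auto

lemma system_factor_Z: "system_factor M T Z"
  by unfold_locales (rule factor_Z)

lemma AP_Z: "AP f \<Longrightarrow> f \<in> Z"
  unfolding Z_eq using l2_closure_superset[of "{f. AP f}"] AP_L2 by blast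

lemma truncate_tendsto:
  fixes t :: real
  shows "(\<lambda>n. max (min t (real n)) (- real n)) \<longlonglongrightarrow> t"
proof (rule tendsto_eventually)
  obtain N :: nat where N: "\<bar>t\<bar> \<le> real N" using real_arch_simple by blast
  have "max (min t (real n)) (- real n) = t" if "n \<ge> N" for n
  proof -
    have "\<bar>t\<bar> \<le> real n" using N that by linarith
    then show ?thesis by (auto simp: max_def min_def)
  qed
  then show "\<forall>\<^sub>F n in sequentially. max (min t (real n)) (- real n) = t"
    by (auto simp: eventually_sequentially)
qed

text \<open>Truncations of a function of \<open>Y\<close> are bounded functions of \<open>Y\<close>, hence almost periodic.\<close>

lemma factor_subset_Z: "Y \<subseteq> Z"
proof
  fix h assume h: "h \<in> Y"
  have hF: "h \<in> borel_measurable \<F>" "h \<in> L2 M" using h factor_iff by auto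
  show "h \<in> Z"
  proof (rule factor_dominated_limit[OF finite_M factor_Z, where g = "\<lambda>n x. max (min (h x) (real n)) (- real n)" and w = "\<lambda>x. \<bar>h x\<bar>"])
    fix n
    have "(\<lambda>x. max (min (h x) (real n)) (- real n)) \<in> L_infty M"
      by (rule L_inftyI[where C = "real n"]) (use L2_measurable[OF hF(2)] in \<open>auto simp: max_def min_def\<close>)
    moreover have "(\<lambda>x. max (min (h x) (real n)) (- real n)) \<in> borel_measurable \<F>"
      using hF by measurable
    ultimately show "(\<lambda>x. max (min (h x) (real n)) (- real n)) \<in> Z"
      using factor_iff L_infty_L2 by (intro AP_Z AP_of_factor) auto
    show "\<bar>max (min (h x) (real n)) (- real n)\<bar> \<le> \<bar>h x\<bar>" for x by (auto simp: max_def min_def)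
  qed (use hF truncate_tendsto in \<open>auto simp: L2_def\<close>)
qed

text \<open>An element of \<open>Z\<close> is a limit of bounded almost periodic functions: truncate.\<close>

lemma Z_orthogonal:
  assumes D: "D \<in> L_infty M"
    and orth: "\<And>\<psi>. AP \<psi> \<Longrightarrow> \<psi> \<in> L_infty M \<Longrightarrow> (\<integral>x. D x * \<psi> x \<partial>M) = 0"
    and h: "h \<in> Z"
  shows "(\<integral>x. D x * h x \<partial>M) = 0"
proof -
  note DL2 = L_infty_L2[OF D]
  have AP0: "(\<integral>x. D x * \<psi> x \<partial>M) = 0" if \<psi>: "AP \<psi>" for \<psi>
  proof -
    let ?t = "\<lambda>n x. max (min (\<psi> x) (real n)) (- real n)"
    note \<psi>L2 = AP_L2[OF \<psi>]
    have "(\<lambda>n. \<integral>x. D x * ?t n x \<partial>M) \<longlonglongrightarrow> (\<integral>x. D x * \<psi> x \<partial>M)"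
    proof (rule integral_dominated_convergence[where w = "\<lambda>x. \<bar>D x * \<psi> x\<bar>"])
      show "integrable M (\<lambda>x. \<bar>D x * \<psi> x\<bar>)" using L2_mult_integrable[OF DL2 \<psi>L2] by simp
      show "AE x in M. (\<lambda>n. D x * ?t n x) \<longlonglongrightarrow> D x * \<psi> x"
        by (intro AE_I2 tendsto_intros truncate_tendsto)
      show "AE x in M. norm (D x * ?t n x) \<le> \<bar>D x * \<psi> x\<bar>" for n
      proof (rule AE_I2)
        fix x
        have "\<bar>?t n x\<bar> \<le> \<bar>\<psi> x\<bar>" by (auto simp: max_def min_def)
        then show "norm (D x * ?t n x) \<le> \<bar>D x * \<psi> x\<bar>" by (simp add: abs_mult mult_left_mono)
      qed
    qed (use L2_measurable[OF DL2] L2_measurable[OF \<psi>L2] in measurable)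
    moreover have "(\<integral>x. D x * ?t n x \<partial>M) = 0" for n
      by (rule orth[OF AP_truncate[OF \<psi>]])
        (use L2_measurable[OF \<psi>L2] in \<open>auto intro!: L_inftyI[where C = "real n"]\<close>)
    ultimately show ?thesis by (simp add: LIMSEQ_const_iff)
  qed
  have "(\<integral>x. D x * h x \<partial>M)\<^sup>2 \<le> 0 + e" if e: "e > 0" for e
  proof -
    let ?d = "\<integral>x. (D x)\<^sup>2 \<partial>M"
    have "?d \<ge> 0" by simp
    then have d: "?d + 1 > 0" by linarith
    obtain \<psi> where \<psi>: "AP \<psi>" "(\<integral>x. (h x - \<psi> x)\<^sup>2 \<partial>M) < e / (?d + 1)"
      using h[unfolded Z_eq l2_closure_iff, THEN conjunct2, rule_format, of "e / (?d + 1)"] e d by auto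
    note L2 = AP_L2[OF \<psi>(1)]
    have hL2: "h \<in> L2 M" using h by (simp add: Z_eq l2_closure_def)
    have "(\<integral>x. D x * h x \<partial>M) = (\<integral>x. D x * (h x - \<psi> x) \<partial>M) + (\<integral>x. D x * \<psi> x \<partial>M)"
      using L2_mult_integrable[OF DL2 L2] L2_mult_integrable[OF DL2 hL2] by (simp add: right_diff_distrib)
    then have "(\<integral>x. D x * h x \<partial>M)\<^sup>2 = (\<integral>x. D x * (h x - \<psi> x) \<partial>M)\<^sup>2" using AP0[OF \<psi>(1)] by simp
    also have "\<dots> \<le> ?d * (\<integral>x. (h x - \<psi> x)\<^sup>2 \<partial>M)"
      by (rule L2_cauchy_schwarz[OF DL2 L2_diff[OF hL2 L2]])
    also have "\<dots> \<le> (?d + 1) * (\<integral>x. (h x - \<psi> x)\<^sup>2 \<partial>M)" by (intro mult_right_mono) auto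
    also have "\<dots> \<le> e" using \<psi>(2) d by (simp add: pos_less_divide_eq mult.commute)
    finally show ?thesis by simp
  qed
  then have "(\<integral>x. D x * h x \<partial>M)\<^sup>2 \<le> 0" by (rule field_le_epsilon)
  then show ?thesis by simp
qed

end


section \<open>Equivariant factors and relative recurrence\<close>

text \<open>A factor on which \<open>T\<close> acts invertibly has this property, an arbitrary one need not: for a two-sided
Bernoulli shift and the factor of the nonnegative coordinates, the coordinate function at \<open>-1\<close> has
constant conditional expectation but composed with \<open>T\<close> it lies in the factor.\<close>

definition (in measure_preserving_system) equivariant :: "('a \<Rightarrow> real) set \<Rightarrow> bool" where
  "equivariant Y \<longleftrightarrow> (\<forall>F\<in>L_infty M. AE x in M. cond_exp M Y (\<lambda>x. F (T x)) x = cond_exp M Y F (T x))"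

context measure_preserving_system
begin

text \<open>Both sides are constants, and they have the same integral.\<close>

lemma equivariant_trivial: "equivariant (trivial_factor M)"
  unfolding equivariant_def
proof
  interpret system_factor M T "trivial_factor M" by unfold_locales (rule trivial_factor_factor)
  fix F assume F: "F \<in> L_infty M"
  note FT = L_infty_T[OF F]
  obtain c where c: "AE x in M. E F x = c"
    using E_factor[OF L_infty_L2[OF F]] by (auto simp: trivial_factor_def)
  obtain d where d: "AE x in M. E (\<lambda>x. F (T x)) x = d"
    using E_factor[OF L_infty_L2[OF FT]] by (auto simp: trivial_factor_def)
  have "(\<integral>x. F (T x) \<partial>M) = (\<integral>x. F x \<partial>M)" using integral_Tn[of F 1] L_infty_measurable[OF F] by simp
  then have "(\<integral>x. E (\<lambda>x. F (T x)) x \<partial>M) = (\<integral>x. E F x \<partial>M)"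
    using E_integral[OF L_infty_integrable[OF F]] E_integral[OF L_infty_integrable[OF FT]] by simp
  moreover have "(\<integral>x. E (\<lambda>x. F (T x)) x \<partial>M) = (\<integral>x. d \<partial>M)"
    by (rule integral_cong_AE) (use d in auto)
  moreover have "(\<integral>x. E F x \<partial>M) = (\<integral>x. c \<partial>M)"
    by (rule integral_cong_AE) (use c in auto)
  ultimately have cd: "d * measure M (space M) = c * measure M (space M)" by (simp add: mult.commute)
  have cT: "AE x in M. E F (T x) = c" using c by (rule AE_T)
  show "AE x in M. E (\<lambda>x. F (T x)) x = E F (T x)"
  proof (cases "measure M (space M) = 0")
    case True
    then have "emeasure M (space M) = 0" by (simp add: emeasure_eq_measure)
    then show ?thesis by (intro AE_I[where N = "space M"]) auto
  next
    case False
    then have "c = d" using cd by simp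
    show ?thesis using d cT by eventually_elim (simp add: \<open>c = d\<close>)
  qed
qed

end

context system_factor
begin

lemma equivariant_Tn:
  assumes "equivariant Y" "F \<in> L_infty M"
  shows "AE x in M. E (\<lambda>x. F ((T ^^ n) x)) x = E F ((T ^^ n) x)"
  using assms(2)
proof (induction n arbitrary: F)
  case (Suc n)
  have "AE x in M. E (\<lambda>x. F (T x)) x = E F (T x)" using assms(1) Suc.prems by (auto simp: equivariant_def)
  from Suc.IH[OF L_infty_T[OF Suc.prems]] AE_Tn[OF this, of n]
  show ?case by eventually_elim simp
qed simp

text \<open>Of the functions \<open>\<psi> \<circ> T\<^sup>n\<close>, \<open>n \<le> N\<close>, two that lie near the same
  \<open>g \<in> G\<close> on the fibre over \<open>y\<close> are close to each other there, and equivariance moves this to the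
  fibre over \<open>T\<^sup>n y\<close>, where it says that \<open>\<psi>\<close> is close to some \<open>\<psi> \<circ> T\<^sup>d\<close>. So an orbit
  visits the remaining points at most \<open>card G\<close> times.\<close>

lemma relative_recurrence:
  assumes eqv: "equivariant Y" and \<psi>: "\<psi> \<in> L_infty M"
    and G: "finite G" "G \<subseteq> L2 M"
    and approx: "\<And>n. AE y in M. \<exists>g\<in>G. E (\<lambda>x. (\<psi> ((T ^^ n) x) - g x)\<^sup>2) y < \<delta>"
  shows "real (Suc N) * measure M {x \<in> space M. \<forall>d\<in>{1..N}. 4 * \<delta> \<le> E (\<lambda>x. (\<psi> x - \<psi> ((T ^^ d) x))\<^sup>2) x}
      \<le> real (card G) * measure M (space M)"
proof -
  define V where "V d = E (\<lambda>x. (\<psi> x - \<psi> ((T ^^ d) x))\<^sup>2)" for d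
  define B where "B = {x \<in> space M. \<forall>d\<in>{1..N}. 4 * \<delta> \<le> V d x}"
  have [measurable]: "V d \<in> borel_measurable M" for d by (simp add: V_def)
  have [measurable]: "B \<in> sets M" unfolding B_def by measurable
  have L2n: "(\<lambda>x. \<psi> ((T ^^ n) x)) \<in> L2 M" for n by (intro L_infty_L2 L_infty_Tn \<psi>)
  have ap: "AE y in M. \<forall>n\<in>{..N}. \<exists>g\<in>G. E (\<lambda>x. (\<psi> ((T ^^ n) x) - g x)\<^sup>2) y < \<delta>"
    by (intro AE_finite_allI approx) simp
  have tri: "AE y in M. \<forall>(n, n', g)\<in>{..N} \<times> {..N} \<times> G. E (\<lambda>x. (\<psi> ((T ^^ n) x) - \<psi> ((T ^^ n') x))\<^sup>2) y
      \<le> 2 * E (\<lambda>x. (\<psi> ((T ^^ n) x) - g x)\<^sup>2) y + 2 * E (\<lambda>x. (\<psi> ((T ^^ n') x) - g x)\<^sup>2) y"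
  proof (rule AE_finite_allI)
    show "finite ({..N} \<times> {..N} \<times> G)" using G by simp
    fix p assume "p \<in> {..N} \<times> {..N} \<times> G"
    then obtain n n' g where p: "p = (n, n', g)" "g \<in> G" by auto
    have "AE y in M. E (\<lambda>x. ((\<psi> ((T ^^ n) x) - g x) + (g x - \<psi> ((T ^^ n') x)))\<^sup>2) y
      \<le> 2 * E (\<lambda>x. (\<psi> ((T ^^ n) x) - g x)\<^sup>2) y + 2 * E (\<lambda>x. (g x - \<psi> ((T ^^ n') x))\<^sup>2) y"
      using p G by (intro E_square_add_le L2_diff L2n) auto
    then show "AE y in M. case p of (n, n', g) \<Rightarrow> E (\<lambda>x. (\<psi> ((T ^^ n) x) - \<psi> ((T ^^ n') x))\<^sup>2) y
      \<le> 2 * E (\<lambda>x. (\<psi> ((T ^^ n) x) - g x)\<^sup>2) y + 2 * E (\<lambda>x. (\<psi> ((T ^^ n') x) - g x)\<^sup>2) y"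
      by (simp add: p power2_commute[of "g _"])
  qed
  have eq: "AE y in M. \<forall>(n, d)\<in>{..N} \<times> {..N}.
      E (\<lambda>x. (\<psi> ((T ^^ n) x) - \<psi> ((T ^^ (d + n)) x))\<^sup>2) y = V d ((T ^^ n) y)"
  proof (rule AE_finite_allI)
    fix p assume "p \<in> {..N} \<times> {..N}"
    then obtain n d where p: "p = (n, d)" by auto
    have "AE y in M. E (\<lambda>x. (\<lambda>x. (\<psi> x - \<psi> ((T ^^ d) x))\<^sup>2) ((T ^^ n) x)) y = V d ((T ^^ n) y)"
      unfolding V_def by (intro equivariant_Tn eqv L_infty_power2 L_infty_diff L_infty_Tn \<psi>)
    then show "AE y in M. case p of (n, d) \<Rightarrow> E (\<lambda>x. (\<psi> ((T ^^ n) x) - \<psi> ((T ^^ (d + n)) x))\<^sup>2) y = V d ((T ^^ n) y)"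
      by (simp add: p funpow_add)
  qed simp
  have count: "AE y in M. (\<Sum>n\<le>N. indicat_real B ((T ^^ n) y)) \<le> real (card G)"
    using ap tri eq
  proof eventually_elim
    case (elim y)
    let ?S = "{n. n \<le> N \<and> (T ^^ n) y \<in> B}"
    obtain lab where lab: "\<And>n. n \<le> N \<Longrightarrow> lab n \<in> G \<and> E (\<lambda>x. (\<psi> ((T ^^ n) x) - lab n x)\<^sup>2) y < \<delta>"
      using elim(1) by (metis atMost_iff)
    \<comment> \<open>Equal labels at times \<open>n < n'\<close> contradict \<open>T\<^sup>n y \<in> B\<close>, so \<open>lab\<close> is injective on these times.\<close>
    have sep: "lab n \<noteq> lab n'" if n: "n < n'" "n' \<le> N" "(T ^^ n) y \<in> B" for n n'
    proof
      assume l: "lab n = lab n'"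
      have "E (\<lambda>x. (\<psi> ((T ^^ n) x) - \<psi> ((T ^^ n') x))\<^sup>2) y
        \<le> 2 * E (\<lambda>x. (\<psi> ((T ^^ n) x) - lab n x)\<^sup>2) y + 2 * E (\<lambda>x. (\<psi> ((T ^^ n') x) - lab n x)\<^sup>2) y"
        using elim(2) n lab[of n] by auto
      then have "E (\<lambda>x. (\<psi> ((T ^^ n) x) - \<psi> ((T ^^ n') x))\<^sup>2) y < 4 * \<delta>"
        using lab[of n] lab[of n'] n l by simp
      moreover have "E (\<lambda>x. (\<psi> ((T ^^ n) x) - \<psi> ((T ^^ n') x))\<^sup>2) y = V (n' - n) ((T ^^ n) y)"
        using elim(3)[rule_format, of "(n, n' - n)"] n by simp
      moreover have "4 * \<delta> \<le> V (n' - n) ((T ^^ n) y)"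
      proof -
        have "n' - n \<in> {1..N}" using n by auto
        then show ?thesis using n(3) unfolding B_def by blast
      qed
      ultimately show False by simp
    qed
    have "inj_on lab ?S"
    proof (rule inj_onI)
      fix n n' assume "n \<in> ?S" "n' \<in> ?S" "lab n = lab n'"
      then show "n = n'" using sep[of n n'] sep[of n' n] by (metis (mono_tags, lifting) mem_Collect_eq linorder_less_linear)
    qed
    moreover have "lab ` ?S \<subseteq> G" using lab by auto
    ultimately have "card ?S \<le> card G" using G(1) by (intro card_inj_on_le)
    moreover have "(\<Sum>n\<le>N. indicat_real B ((T ^^ n) y)) = real (card ({..N} \<inter> {n. (T ^^ n) y \<in> B}))"
      using sum_indicator_eq_card[of "{..N}" "{n. (T ^^ n) y \<in> B}"] by (simp add: indicator_def)
    moreover have "{..N} \<inter> {n. (T ^^ n) y \<in> B} = ?S" by auto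
    ultimately show ?case by simp
  qed
  have iB: "integrable M (\<lambda>y. indicat_real B ((T ^^ n) y))" for n
    using \<open>B \<in> sets M\<close> by (intro L_infty_integrable L_infty_Tn L_infty_indicator)
  have "(\<integral>y. (\<Sum>n\<le>N. indicat_real B ((T ^^ n) y)) \<partial>M) \<le> (\<integral>y. real (card G) \<partial>M)"
    by (rule integral_mono_AE) (use iB count in auto)
  also have "(\<integral>y. (\<Sum>n\<le>N. indicat_real B ((T ^^ n) y)) \<partial>M) = (\<Sum>n\<le>N. \<integral>y. indicat_real B ((T ^^ n) y) \<partial>M)"
    using iB by simp
  also have "\<dots> = (\<Sum>n\<le>N. measure M B)"
    using \<open>B \<in> sets M\<close> by (intro sum.cong refl, subst integral_Tn) auto
  finally show ?thesis by (simp add: B_def V_def mult.commute)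
qed

text \<open>By relative recurrence a bounded almost periodic \<open>\<psi>\<close> is, up to small error, glued from its
  translates \<open>\<psi> \<circ> T\<^sup>d\<close>, \<open>d \<ge> 1\<close>, along sets of \<open>Y\<close>.\<close>

lemma AP_orthogonal_from_translates:
  assumes eqv: "equivariant Y" and \<psi>: "AP \<psi>" "\<psi> \<in> L_infty M" and D: "D \<in> L_infty M"
    and orth: "\<And>d A. A \<in> sets \<F> \<Longrightarrow> d \<ge> 1 \<Longrightarrow> (\<integral>x. indicat_real A x * (D x * \<psi> ((T ^^ d) x)) \<partial>M) = 0"
  shows "(\<integral>x. D x * \<psi> x \<partial>M) = 0"
proof -
  obtain C where C: "C > 0" "AE x in M. \<bar>D x\<bar> \<le> C" using D by (rule L_inftyE)
  obtain K where K: "K > 0" "AE x in M. \<bar>\<psi> x\<bar> \<le> K" using \<psi>(2) by (rule L_inftyE)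
  let ?\<mu> = "measure M (space M)"
  have main: "\<bar>\<integral>x. D x * \<psi> x \<partial>M\<bar> \<le> 5 * C * ?\<mu> * \<eta>" if \<eta>: "\<eta> > 0" for \<eta>
  proof -
    have "\<eta>\<^sup>2 > 0" using \<eta> by simp
    then obtain G where G: "finite G" "G \<subseteq> L2 M"
      "\<And>n. AE y in M. \<exists>g\<in>G. E (\<lambda>x. (\<psi> ((T ^^ n) x) - g x)\<^sup>2) y < \<eta>\<^sup>2"
      using AP_approx[OF \<psi>(1)] by blast
    have bound: "\<bar>\<integral>x. D x * \<psi> x \<partial>M\<bar> \<le> C * K * (real (card G) * ?\<mu>) / real (Suc N) + 5 * C * ?\<mu> * \<eta>" for N
    proof -
      define V where "V d = E (\<lambda>x. (\<psi> x - \<psi> ((T ^^ d) x))\<^sup>2)" for d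
      define A where "A d = {x \<in> space M. V d x < 4 * \<eta>\<^sup>2}" for d
      define A' where "A' d = A d - (\<Union>d'\<in>{1..<d}. A d')" for d
      define B where "B = {x \<in> space M. \<forall>d\<in>{1..N}. 4 * \<eta>\<^sup>2 \<le> V d x}"
      have A: "A d \<in> sets \<F>" for d
        unfolding A_def space_\<F>[symmetric] V_def by measurable
      have A': "A' d \<in> sets \<F>" for d using A by (auto simp: A'_def)
      have A'M: "A' d \<in> sets M" for d using A' sets_\<F>_M by blast
      have [measurable]: "V d \<in> borel_measurable M" for d by (simp add: V_def)
      have BM: "B \<in> sets M" unfolding B_def by measurable
      \<comment> \<open>\<open>A' d\<close> is where \<open>d\<close> is the first time at which \<open>\<psi>\<close> returns near itself; for \<open>d \<le> N\<close> these sets and \<open>B\<close> partition the space.\<close>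
      have part: "indicat_real B x + (\<Sum>d\<in>{1..N}. indicat_real (A' d) x) = 1" if x: "x \<in> space M" for x
      proof (cases "x \<in> B")
        case True
        then have "x \<notin> A' d" if "d \<in> {1..N}" for d using that by (force simp: A'_def A_def B_def)
        then show ?thesis using True by simp
      next
        case False
        then have ex: "\<exists>d. d \<in> {1..N} \<and> x \<in> A d" using x by (force simp: B_def A_def)
        define e where "e = (LEAST d. d \<in> {1..N} \<and> x \<in> A d)"
        have e: "e \<in> {1..N}" "x \<in> A e" using LeastI_ex[OF ex] by (auto simp: e_def)
        have least: "d \<ge> e" if "d \<in> {1..N}" "x \<in> A d" for d
          unfolding e_def using that by (intro Least_le) auto
        have "x \<in> A' d \<longleftrightarrow> d = e" if d: "d \<in> {1..N}" for d
        proof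
          assume "x \<in> A' d"
          then have "x \<in> A d" "\<not> (e < d)" using e by (auto simp: A'_def)
          then show "d = e" using least[OF d] by auto
        next
          assume "d = e"
          then show "x \<in> A' d" using e least by (fastforce simp: A'_def)
        qed
        then have "(\<Sum>d\<in>{1..N}. indicat_real (A' d) x) = (\<Sum>d\<in>{1..N}. if d = e then 1 else 0)"
          by (intro sum.cong) (auto simp: indicator_def)
        then show ?thesis using e False by simp
      qed
      let ?R = "\<lambda>x. indicat_real B x * (D x * \<psi> x)"
      let ?P = "\<lambda>d x. indicat_real (A' d) x * (D x * (\<psi> x - \<psi> ((T ^^ d) x)))"
      let ?O = "\<lambda>d x. indicat_real (A' d) x * (D x * \<psi> ((T ^^ d) x))"
      have iR: "integrable M ?R" using BM by (intro L_infty_integrable L_infty_intros D \<psi>)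
      have iP: "integrable M (?P d)" for d
        using A'M by (intro L_infty_integrable L_infty_intros L_infty_Tn D \<psi>)
      have iO: "integrable M (?O d)" for d
        using A'M by (intro L_infty_integrable L_infty_intros L_infty_Tn D \<psi>)
      have "(\<integral>x. D x * \<psi> x \<partial>M) = (\<integral>x. ?R x + (\<Sum>d\<in>{1..N}. ?P d x + ?O d x) \<partial>M)"
      proof (rule Bochner_Integration.integral_cong[OF refl])
        fix x assume "x \<in> space M"
        have "?R x + (\<Sum>d\<in>{1..N}. ?P d x + ?O d x)
            = ?R x + (\<Sum>d\<in>{1..N}. indicat_real (A' d) x * (D x * \<psi> x))"
          by (simp add: algebra_simps)
        also have "\<dots> = (indicat_real B x + (\<Sum>d\<in>{1..N}. indicat_real (A' d) x)) * (D x * \<psi> x)"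
          by (simp add: sum_distrib_right distrib_right)
        finally show "D x * \<psi> x = ?R x + (\<Sum>d\<in>{1..N}. ?P d x + ?O d x)" using part[OF \<open>x \<in> space M\<close>] by simp
      qed
      also have "\<dots> = (\<integral>x. ?R x \<partial>M) + (\<Sum>d\<in>{1..N}. (\<integral>x. ?P d x \<partial>M) + (\<integral>x. ?O d x \<partial>M))"
        using iR iP iO by (simp add: Bochner_Integration.integral_add Bochner_Integration.integral_sum)
      also have "\<dots> = (\<integral>x. ?R x \<partial>M) + (\<Sum>d\<in>{1..N}. \<integral>x. ?P d x \<partial>M)"
        using orth[OF A'] by simp
      finally have split: "\<bar>\<integral>x. D x * \<psi> x \<partial>M\<bar> \<le> \<bar>\<integral>x. ?R x \<partial>M\<bar> + (\<Sum>d\<in>{1..N}. \<bar>\<integral>x. ?P d x \<partial>M\<bar>)"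
        using sum_abs[of "\<lambda>d. \<integral>x. ?P d x \<partial>M" "{1..N}"] by linarith
      have "\<bar>\<integral>x. ?R x \<partial>M\<bar> \<le> (\<integral>x. \<bar>?R x\<bar> \<partial>M)" by (rule integral_abs_bound)
      also have "\<dots> \<le> (\<integral>x. C * K * indicat_real B x \<partial>M)"
      proof (rule integral_mono_AE)
        show "AE x in M. \<bar>?R x\<bar> \<le> C * K * indicat_real B x"
          using C(2) K(2)
        proof eventually_elim
          case (elim x)
          have "\<bar>D x\<bar> * \<bar>\<psi> x\<bar> \<le> C * K" using elim C(1) by (intro mult_mono) auto
          then show ?case by (auto simp: indicator_def abs_mult)
        qed
      qed (use iR BM in \<open>auto intro!: L_infty_integrable L_infty_intros\<close>)
      also have "\<dots> = C * K * measure M B" using BM by simp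
      also have "\<dots> \<le> C * K * ((real (card G) * ?\<mu>) / real (Suc N))"
      proof (rule mult_left_mono)
        have "real (Suc N) * measure M B \<le> real (card G) * ?\<mu>"
          unfolding B_def V_def by (rule relative_recurrence[OF eqv \<psi>(2) G])
        then show "measure M B \<le> (real (card G) * ?\<mu>) / real (Suc N)"
          by (simp add: pos_le_divide_eq mult.commute del: of_nat_Suc)
      qed (use C K in simp)
      finally have R: "\<bar>\<integral>x. ?R x \<partial>M\<bar> \<le> C * K * (real (card G) * ?\<mu>) / real (Suc N)" by simp
      have P: "\<bar>\<integral>x. ?P d x \<partial>M\<bar> \<le> 5 * C * \<eta> * measure M (A' d)" for d
      proof -
        let ?s = "\<lambda>x. (\<psi> x - \<psi> ((T ^^ d) x))\<^sup>2"
        have s: "?s \<in> L_infty M" by (intro L_infty_intros L_infty_Tn \<psi>)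
        have i1: "integrable M (\<lambda>x. indicat_real (A' d) x * ?s x)" using A'M by (intro L_infty_integrable L_infty_intros s)
        have i2: "integrable M (indicat_real (A' d))" using A'M by (intro L_infty_integrable L_infty_intros)
        have "\<bar>\<integral>x. ?P d x \<partial>M\<bar> \<le> (\<integral>x. \<bar>?P d x\<bar> \<partial>M)" by (rule integral_abs_bound)
        also have "\<dots> \<le> (\<integral>x. C * \<eta> * indicat_real (A' d) x + C / \<eta> * (indicat_real (A' d) x * ?s x) \<partial>M)"
        proof (rule integral_mono_AE)
          show "AE x in M. \<bar>?P d x\<bar> \<le> C * \<eta> * indicat_real (A' d) x + C / \<eta> * (indicat_real (A' d) x * ?s x)"
            using C(2)
          proof eventually_elim
            case (elim x)
            have "\<bar>D x\<bar> * \<bar>\<psi> x - \<psi> ((T ^^ d) x)\<bar> \<le> C * (\<eta> + ?s x / \<eta>)"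
              using elim C(1) abs_le_weighted_square[OF \<eta>] by (intro mult_mono) auto
            then show ?case by (auto simp: indicator_def abs_mult distrib_left)
          qed
          show "integrable M (\<lambda>x. \<bar>?P d x\<bar>)" using iP by (intro integrable_abs)
          show "integrable M (\<lambda>x. C * \<eta> * indicat_real (A' d) x + C / \<eta> * (indicat_real (A' d) x * ?s x))"
            using i1 i2 by (intro Bochner_Integration.integrable_add integrable_mult_right) auto
        qed
        also have "\<dots> = C * \<eta> * measure M (A' d) + C / \<eta> * (\<integral>x. indicat_real (A' d) x * ?s x \<partial>M)"
          using i1 i2 A'M by simp
        also have "(\<integral>x. indicat_real (A' d) x * ?s x \<partial>M) = (\<integral>x. indicat_real (A' d) x * V d x \<partial>M)"
          unfolding V_def by (rule E_intg[symmetric]) (use A' i1 L_infty_measurable[OF s] in auto)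
        also have "\<dots> \<le> (\<integral>x. 4 * \<eta>\<^sup>2 * indicat_real (A' d) x \<partial>M)"
        proof (rule integral_mono)
          show "integrable M (\<lambda>x. indicat_real (A' d) x * V d x)"
            unfolding V_def using A'M by (intro L_infty_integrable L_infty_mult L_infty_indicator E_L_infty s)
          show "indicat_real (A' d) x * V d x \<le> 4 * \<eta>\<^sup>2 * indicat_real (A' d) x" for x
            by (auto simp: indicator_def A'_def A_def)
        qed (use i2 in simp)
        also have "\<dots> = 4 * \<eta>\<^sup>2 * measure M (A' d)" using A'M by simp
        finally have "\<bar>\<integral>x. ?P d x \<partial>M\<bar> \<le> C * \<eta> * measure M (A' d) + C / \<eta> * (4 * \<eta>\<^sup>2 * measure M (A' d))"
          using C(1) \<eta> by (smt (verit) divide_nonneg_pos mult_left_mono)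
        also have "\<dots> = 5 * C * \<eta> * measure M (A' d)" using \<eta> by (simp add: power2_eq_square field_simps)
        finally show ?thesis .
      qed
      have "(\<Sum>d\<in>{1..N}. measure M (A' d)) = (\<integral>x. (\<Sum>d\<in>{1..N}. indicat_real (A' d) x) \<partial>M)"
        using A'M by (subst Bochner_Integration.integral_sum) (auto intro!: L_infty_integrable L_infty_intros)
      also have "\<dots> \<le> (\<integral>x. 1 \<partial>M)"
      proof (rule integral_mono)
        show "integrable M (\<lambda>x. \<Sum>d\<in>{1..N}. indicat_real (A' d) x)"
          using A'M by (intro L_infty_integrable L_infty_intros)
        show "(\<Sum>d\<in>{1..N}. indicat_real (A' d) x) \<le> 1" if "x \<in> space M" for x
          using part[OF that] indicator_pos_le[of B x, where 'a = real] by linarith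
      qed simp
      finally have total: "(\<Sum>d\<in>{1..N}. measure M (A' d)) \<le> ?\<mu>" by simp
      have "(\<Sum>d\<in>{1..N}. \<bar>\<integral>x. ?P d x \<partial>M\<bar>) \<le> (\<Sum>d\<in>{1..N}. 5 * C * \<eta> * measure M (A' d))"
        by (intro sum_mono P)
      also have "\<dots> = 5 * C * \<eta> * (\<Sum>d\<in>{1..N}. measure M (A' d))" by (simp add: sum_distrib_left)
      also have "\<dots> \<le> 5 * C * \<eta> * ?\<mu>" using total C(1) \<eta> by (intro mult_left_mono) auto
      finally show ?thesis using split R by (simp add: mult_ac)
    qed
    show ?thesis
    proof (rule LIMSEQ_le_const)
      have "(\<lambda>N. C * K * (real (card G) * ?\<mu>) / real (Suc N) + 5 * C * ?\<mu> * \<eta>) \<longlonglongrightarrow> 0 + 5 * C * ?\<mu> * \<eta>"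
        by (intro tendsto_add tendsto_const LIMSEQ_Suc[OF lim_const_over_n])
      then show "(\<lambda>N. C * K * (real (card G) * ?\<mu>) / real (Suc N) + 5 * C * ?\<mu> * \<eta>) \<longlonglongrightarrow> 5 * C * ?\<mu> * \<eta>" by simp
    qed (use bound in blast)
  qed
  have "\<bar>\<integral>x. D x * \<psi> x \<partial>M\<bar> \<le> 0 + e" if e: "e > 0" for e
  proof -
    have p: "5 * C * ?\<mu> + 1 > 0" using C(1) by (simp add: add_nonneg_pos)
    then have "\<bar>\<integral>x. D x * \<psi> x \<partial>M\<bar> \<le> 5 * C * ?\<mu> * (e / (5 * C * ?\<mu> + 1))" using e by (intro main) simp
    also have "\<dots> \<le> (5 * C * ?\<mu> + 1) * (e / (5 * C * ?\<mu> + 1))"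
      using e p by (intro mult_right_mono) auto
    also have "\<dots> = e" using p by simp
    finally show ?thesis by simp
  qed
  then have "\<bar>\<integral>x. D x * \<psi> x \<partial>M\<bar> \<le> 0" by (rule field_le_epsilon)
  then show ?thesis by simp
qed

text \<open>The difference \<open>D = F \<circ> T - E(F | Z) \<circ> T\<close> must be shown to be orthogonal to every almost periodic \<open>\<psi>\<close>.
By the preceding lemma \<open>\<psi>\<close> may be replaced by \<open>\<psi> \<circ> T\<^sup>d\<close> with \<open>d \<ge> 1\<close>, and \<open>D * (\<psi> \<circ> T\<^sup>d) = W \<circ> T\<close>
for a function \<open>W\<close> with \<open>E(W | Y) = 0\<close>, to which the equivariance of \<open>Y\<close> applies.\<close>

lemma equivariant_Z:
  assumes eqv: "equivariant Y"
  shows "equivariant Z"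
  unfolding equivariant_def
proof
  interpret Z: system_factor M T Z by (rule system_factor_Z)
  fix F assume F: "F \<in> L_infty M"
  define e where "e = Z.E F"
  have e: "e \<in> L_infty M" unfolding e_def by (rule Z.E_L_infty[OF F])
  define D where "D x = F (T x) - e (T x)" for x
  have D: "D \<in> L_infty M" unfolding D_def by (intro L_infty_diff L_infty_T F e)
  have Fe: "(\<integral>x. (F x - e x) * h x \<partial>M) = 0" if h: "h \<in> Z" for h
    unfolding e_def by (rule cond_exp_projection(2)[OF finite_M factor_Z L_infty_L2[OF F] h])
  have D0: "(\<integral>x. D x * h x \<partial>M) = 0" if h: "h \<in> Z" for h
  proof (rule Z_orthogonal[OF D _ h], rule AP_orthogonal_from_translates[OF eqv _ _ D])
    fix \<psi> and d :: nat and A assume \<psi>: "AP \<psi>" "\<psi> \<in> L_infty M" and A: "A \<in> sets \<F>" and d: "d \<ge> 1"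
    define W where "W x = (F x - e x) * \<psi> ((T ^^ (d - 1)) x)" for x
    have W: "W \<in> L_infty M" unfolding W_def by (intro L_infty_intros L_infty_Tn F e \<psi>)
    have "AE x in M. E W x = 0"
    proof (rule E_unique)
      fix A assume A: "A \<in> sets \<F>"
      have "indicat_real A \<in> Z" using factor_subset_Z indicator_factor[OF A] by blast
      then have m1: "indicat_real A \<in> borel_measurable Z.\<F>" using Z.factor_iff by blast
      have "\<psi> \<in> borel_measurable Z.\<F>" using AP_Z[OF \<psi>(1)] Z.factor_iff by blast
      then have m2: "(\<lambda>x. \<psi> ((T ^^ (d - 1)) x)) \<in> borel_measurable Z.\<F>"
        by (rule measurable_compose[OF Z.Tn_\<F>])
      have "(\<lambda>x. indicat_real A x * \<psi> ((T ^^ (d - 1)) x)) \<in> Z"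
        unfolding Z.factor_iff
        by (intro conjI borel_measurable_times m1 m2 L_infty_L2 L_infty_mult L_infty_Tn \<psi> L_infty_indicator sets_\<F>_M A)
      from Fe[OF this] show "(\<integral>x. indicat_real A x * W x \<partial>M) = (\<integral>x. indicat_real A x * 0 \<partial>M)"
        by (simp add: W_def mult_ac)
    qed (auto intro: L_infty_integrable W)
    moreover have "AE x in M. E (\<lambda>x. W (T x)) x = E W (T x)" using eqv W by (auto simp: equivariant_def)
    ultimately have "AE x in M. E (\<lambda>x. W (T x)) x = 0"
      using AE_T[of "\<lambda>x. E W x = 0"] by auto
    moreover have "W (T x) = D x * \<psi> ((T ^^ d) x)" for x
      using d funpow_swap1[of T "d - 1" x] by (cases d) (auto simp: W_def D_def)
    ultimately have z: "AE x in M. E (\<lambda>x. D x * \<psi> ((T ^^ d) x)) x = 0" by simp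
    have Dp: "(\<lambda>x. D x * \<psi> ((T ^^ d) x)) \<in> L_infty M" by (intro L_infty_intros L_infty_Tn D \<psi>)
    have "(\<integral>x. indicat_real A x * (D x * \<psi> ((T ^^ d) x)) \<partial>M)
        = (\<integral>x. indicat_real A x * E (\<lambda>x. D x * \<psi> ((T ^^ d) x)) x \<partial>M)"
      by (rule E_intg[symmetric])
        (use A sets_\<F>_M[OF A] L_infty_measurable[OF Dp] in
          \<open>auto intro!: L_infty_integrable L_infty_mult L_infty_indicator Dp\<close>)
    also have "\<dots> = (\<integral>x. 0 \<partial>M)"
      using z sets_\<F>_M[OF A] by (intro integral_cong_AE) (auto elim: eventually_mono)
    finally show "(\<integral>x. indicat_real A x * (D x * \<psi> ((T ^^ d) x)) \<partial>M) = 0" by simp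
  qed
  have "AE x in M. Z.E (\<lambda>x. F (T x)) x = e (T x)"
  proof (rule Z.E_unique)
    show "(\<lambda>x. e (T x)) \<in> borel_measurable Z.\<F>"
      unfolding e_def by (rule measurable_compose[OF Z.T_\<F>]) simp
    show i: "integrable M (\<lambda>x. F (T x))" "integrable M (\<lambda>x. e (T x))"
      by (intro L_infty_integrable L_infty_T F e)+
    fix A assume A: "A \<in> sets Z.\<F>"
    note AM = Z.sets_\<F>_M[OF A]
    have "integrable M (\<lambda>x. indicat_real A x * F (T x))" "integrable M (\<lambda>x. indicat_real A x * e (T x))"
      by (intro L_infty_integrable L_infty_mult L_infty_T F e L_infty_indicator AM)+
    then have "(\<integral>x. indicat_real A x * F (T x) \<partial>M) - (\<integral>x. indicat_real A x * e (T x) \<partial>M)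
       = (\<integral>x. D x * indicat_real A x \<partial>M)"
      by (simp add: D_def algebra_simps flip: Bochner_Integration.integral_diff)
    also have "\<dots> = 0" by (rule D0[OF Z.indicator_factor[OF A]])
    finally show "(\<integral>x. indicat_real A x * F (T x) \<partial>M) = (\<integral>x. indicat_real A x * e (T x) \<partial>M)" by simp
  qed
  then show "AE x in M. Z.E (\<lambda>x. F (T x)) x = Z.E F (T x)" by (simp add: e_def)
qed

end


section \<open>Positive semidefinite forms on finitely supported vectors\<close>

text \<open>Vectors are coefficient functions of finite support instead of tuples of a fixed length, so that vectors of
different lengths, differences and shifts need no reindexing.\<close>

definition fsupp :: "(nat \<Rightarrow> real) \<Rightarrow> bool" where
  "fsupp p \<longleftrightarrow> finite {r. p r \<noteq> 0}"

definition lin_comb :: "(nat \<Rightarrow> real) \<Rightarrow> (nat \<Rightarrow> real) \<Rightarrow> real" where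
  "lin_comb p A = (\<Sum>r | p r \<noteq> 0. p r * A r)"

definition bform :: "(nat \<Rightarrow> nat \<Rightarrow> real) \<Rightarrow> (nat \<Rightarrow> real) \<Rightarrow> (nat \<Rightarrow> real) \<Rightarrow> real" where
  "bform A p q = lin_comb p (\<lambda>r. lin_comb q (A r))"

definition psd :: "(nat \<Rightarrow> nat \<Rightarrow> real) \<Rightarrow> bool" where
  "psd A \<longleftrightarrow> (\<forall>r s. A r s = A s r) \<and> (\<forall>p. fsupp p \<longrightarrow> 0 \<le> bform A p p)"

definition unit_vec :: "nat \<Rightarrow> nat \<Rightarrow> real" where
  "unit_vec n r = (if r = n then 1 else 0)"

definition shift :: "nat \<Rightarrow> (nat \<Rightarrow> real) \<Rightarrow> nat \<Rightarrow> real" where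
  "shift n p r = (if r < n then 0 else p (r - n))"

definition convex_weights :: "(nat \<Rightarrow> real) set" where
  "convex_weights = {p. fsupp p \<and> (\<forall>r. 0 \<le> p r) \<and> lin_comb p (\<lambda>_. 1) = 1}"

lemma lin_comb_eq: "finite I \<Longrightarrow> (\<And>r. r \<notin> I \<Longrightarrow> p r = 0) \<Longrightarrow> lin_comb p A = (\<Sum>r\<in>I. p r * A r)"
  unfolding lin_comb_def by (rule sum.mono_neutral_left) auto

lemma lin_comb_cong: "(\<And>r. p r \<noteq> 0 \<Longrightarrow> A r = B r) \<Longrightarrow> lin_comb p A = lin_comb p B"
  unfolding lin_comb_def by (intro sum.cong) auto

lemma fsupp_add: "fsupp p \<Longrightarrow> fsupp q \<Longrightarrow> fsupp (\<lambda>r. p r + q r)"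
  unfolding fsupp_def by (rule finite_subset[of _ "{r. p r \<noteq> 0} \<union> {r. q r \<noteq> 0}"]) auto

lemma fsupp_scale: "fsupp p \<Longrightarrow> fsupp (\<lambda>r. w r * p r)"
  unfolding fsupp_def by (rule finite_subset[of _ "{r. p r \<noteq> 0}"]) auto

lemma fsupp_diff: "fsupp p \<Longrightarrow> fsupp q \<Longrightarrow> fsupp (\<lambda>r. p r - q r)"
  using fsupp_add[of p "\<lambda>r. -1 * q r"] fsupp_scale[of q "\<lambda>_. -1"] by simp

lemma fsupp_unit_vec: "fsupp (unit_vec n)"
  unfolding fsupp_def by (rule finite_subset[of _ "{n}"]) (auto simp: unit_vec_def)

lemma fsupp_shift: "fsupp p \<Longrightarrow> fsupp (shift n p)"
  unfolding fsupp_def by (rule finite_subset[of _ "(\<lambda>r. r + n) ` {r. p r \<noteq> 0}"])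
    (auto simp: shift_def image_iff split: if_splits intro!: exI[of _ "_ - n"])

lemma lin_comb_add_left:
  assumes "fsupp p" "fsupp q"
  shows "lin_comb (\<lambda>r. p r + q r) A = lin_comb p A + lin_comb q A"
proof -
  let ?I = "{r. p r \<noteq> 0} \<union> {r. q r \<noteq> 0}"
  have I: "finite ?I" using assms by (auto simp: fsupp_def)
  show ?thesis
    by (subst (1 2 3) lin_comb_eq[OF I]) (auto simp: distrib_right sum.distrib)
qed

lemma lin_comb_mult_left:
  assumes "fsupp p"
  shows "lin_comb (\<lambda>r. w r * p r) A = lin_comb p (\<lambda>r. w r * A r)"
proof -
  have I: "finite {r. p r \<noteq> 0}" using assms by (auto simp: fsupp_def)
  show ?thesis by (subst (1 2) lin_comb_eq[OF I]) (auto intro: sum.cong simp: mult_ac)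
qed

lemma lin_comb_scale_right: "lin_comb p (\<lambda>r. c * A r) = c * lin_comb p A"
  unfolding lin_comb_def sum_distrib_left by (simp add: mult_ac)

lemma lin_comb_scale_left: "fsupp p \<Longrightarrow> lin_comb (\<lambda>r. c * p r) A = c * lin_comb p A"
  by (simp add: lin_comb_mult_left[of p "\<lambda>_. c"] lin_comb_scale_right)

lemma lin_comb_diff_left: "fsupp p \<Longrightarrow> fsupp q \<Longrightarrow> lin_comb (\<lambda>r. p r - q r) A = lin_comb p A - lin_comb q A"
  using lin_comb_add_left[of p "\<lambda>r. -1 * q r" A] fsupp_scale[of q "\<lambda>_. -1"] lin_comb_scale_left[of q "-1" A] by simp

lemma lin_comb_add_right: "lin_comb p (\<lambda>r. A r + B r) = lin_comb p A + lin_comb p B"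
  unfolding lin_comb_def by (simp add: distrib_left sum.distrib)

lemma lin_comb_diff_right: "lin_comb p (\<lambda>r. A r - B r) = lin_comb p A - lin_comb p B"
  unfolding lin_comb_def by (simp add: right_diff_distrib sum_subtractf)

lemma lin_comb_unit_vec: "lin_comb (unit_vec n) A = A n"
  by (subst lin_comb_eq[of "{n}"]) (auto simp: unit_vec_def)

lemma lin_comb_swap: "lin_comb p (\<lambda>r. lin_comb q (A r)) = lin_comb q (\<lambda>s. lin_comb p (\<lambda>r. A r s))"
  unfolding lin_comb_def sum_distrib_left
  by (subst sum.swap) (simp add: mult_ac)

lemma lin_comb_shift:
  assumes "fsupp p" shows "lin_comb (shift n p) A = lin_comb p (\<lambda>r. A (r + n))"
proof -
  have I: "finite {r. p r \<noteq> 0}" using assms by (auto simp: fsupp_def)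
  have "lin_comb (shift n p) A = (\<Sum>r\<in>(\<lambda>r. r + n) ` {r. p r \<noteq> 0}. shift n p r * A r)"
  proof (rule lin_comb_eq)
    fix r assume r: "r \<notin> (\<lambda>r. r + n) ` {r. p r \<noteq> 0}"
    show "shift n p r = 0"
    proof (rule ccontr)
      assume "shift n p r \<noteq> 0"
      then have "r = (r - n) + n" "p (r - n) \<noteq> 0" by (auto simp: shift_def split: if_splits)
      then show False using r by blast
    qed
  qed (use I in simp)
  also have "\<dots> = (\<Sum>r | p r \<noteq> 0. p r * A (r + n))"
    by (subst sum.reindex) (auto simp: shift_def inj_on_def)
  finally show ?thesis by (simp add: lin_comb_def)
qed

lemma lin_comb_mono: "(\<And>r. 0 \<le> p r) \<Longrightarrow> (\<And>r. p r \<noteq> 0 \<Longrightarrow> A r \<le> B r) \<Longrightarrow> lin_comb p A \<le> lin_comb p B"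
  unfolding lin_comb_def by (intro sum_mono mult_left_mono) auto

lemma lin_comb_const: "lin_comb p (\<lambda>_. c) = c * lin_comb p (\<lambda>_. 1)"
  using lin_comb_scale_right[of p c "\<lambda>_. 1"] by simp

lemma convex_weights_abs_le:
  assumes "p \<in> convex_weights" "\<And>r. p r \<noteq> 0 \<Longrightarrow> \<bar>A r\<bar> \<le> K"
  shows "\<bar>lin_comb p A\<bar> \<le> K"
proof -
  have p: "\<And>r. 0 \<le> p r" "lin_comb p (\<lambda>_. 1) = 1" using assms(1) by (auto simp: convex_weights_def)
  have "lin_comb p A \<le> lin_comb p (\<lambda>_. K)" "lin_comb p (\<lambda>_. - K) \<le> lin_comb p A"
    using assms(2) p(1) by (intro lin_comb_mono; force simp: abs_le_iff)+
  then show ?thesis using p(2) lin_comb_const[of p K] lin_comb_const[of p "-K"] by auto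
qed

lemma convex_weights_fsupp: "p \<in> convex_weights \<Longrightarrow> fsupp p"
  by (simp add: convex_weights_def)

lemma convex_weights_shift:
  assumes "p \<in> convex_weights" shows "shift n p \<in> convex_weights"
  using assms fsupp_shift[of p n] lin_comb_shift[of p n "\<lambda>_. 1"] by (auto simp: convex_weights_def shift_def)

lemma convex_weights_midpoint:
  assumes "p \<in> convex_weights" "q \<in> convex_weights"
  shows "(\<lambda>r. 1/2 * (p r + q r)) \<in> convex_weights"
proof -
  have f: "fsupp p" "fsupp q" using assms by (auto simp: convex_weights_def)
  then have "fsupp (\<lambda>r. p r + q r)" by (rule fsupp_add)
  then show ?thesis
    using assms lin_comb_scale_left[of "\<lambda>r. p r + q r" "1/2" "\<lambda>_. 1"] lin_comb_add_left[OF f, of "\<lambda>_. 1"]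
      fsupp_scale[of "\<lambda>r. p r + q r" "\<lambda>_. 1/2"]
    by (auto simp: convex_weights_def)
qed

lemma convex_weights_unit_vec: "unit_vec n \<in> convex_weights"
  using fsupp_unit_vec lin_comb_unit_vec[of n "\<lambda>_. 1"] by (auto simp: convex_weights_def unit_vec_def)

lemma bform_add_left: "fsupp p \<Longrightarrow> fsupp q \<Longrightarrow> bform A (\<lambda>r. p r + q r) w = bform A p w + bform A q w"
  by (simp add: bform_def lin_comb_add_left)

lemma bform_diff_left: "fsupp p \<Longrightarrow> fsupp q \<Longrightarrow> bform A (\<lambda>r. p r - q r) w = bform A p w - bform A q w"
  by (simp add: bform_def lin_comb_diff_left)

lemma bform_add_right: "fsupp p \<Longrightarrow> fsupp q \<Longrightarrow> bform A w (\<lambda>r. p r + q r) = bform A w p + bform A w q"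
  by (simp add: bform_def lin_comb_add_left lin_comb_add_right)

lemma bform_diff_right: "fsupp p \<Longrightarrow> fsupp q \<Longrightarrow> bform A w (\<lambda>r. p r - q r) = bform A w p - bform A w q"
  by (simp add: bform_def lin_comb_diff_left lin_comb_diff_right)

lemma bform_scale_left: "fsupp p \<Longrightarrow> bform A (\<lambda>r. c * p r) w = c * bform A p w"
  by (simp add: bform_def lin_comb_scale_left)

lemma bform_scale_right: "fsupp p \<Longrightarrow> bform A w (\<lambda>r. c * p r) = c * bform A w p"
  by (simp add: bform_def lin_comb_scale_left lin_comb_scale_right)

lemma bform_sym: "(\<And>r s. A r s = A s r) \<Longrightarrow> bform A p q = bform A q p"
  unfolding bform_def by (subst lin_comb_swap) simp

lemma bform_shift:
  "fsupp p \<Longrightarrow> fsupp q \<Longrightarrow> bform A (shift n p) (shift n q) = bform (\<lambda>r s. A (r + n) (s + n)) p q"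
  by (simp add: bform_def lin_comb_shift)

lemma bform_unit_vec_left: "bform A (unit_vec n) q = lin_comb q (A n)"
  by (simp add: bform_def lin_comb_unit_vec)

lemma psd_nonneg: "psd A \<Longrightarrow> fsupp p \<Longrightarrow> 0 \<le> bform A p p"
  by (simp add: psd_def)

lemma psd_sym: "psd A \<Longrightarrow> bform A p q = bform A q p"
  by (rule bform_sym) (simp add: psd_def)

text \<open>The form at \<open>p + t q\<close> is a nonnegative quadratic polynomial in \<open>t\<close>.\<close>

lemma psd_cauchy_schwarz:
  assumes A: "psd A" and p: "fsupp p" and q: "fsupp q"
  shows "(bform A p q)\<^sup>2 \<le> bform A p p * bform A q q"
proof (rule nonneg_quadratic_discriminant)
  fix t :: real
  have tq: "fsupp (\<lambda>r. t * q r)" using q by (rule fsupp_scale)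
  have "0 \<le> bform A (\<lambda>r. p r + t * q r) (\<lambda>r. p r + t * q r)"
    by (intro psd_nonneg[OF A] fsupp_add p tq)
  also have "\<dots> = bform A p p + 2 * t * bform A p q + t\<^sup>2 * bform A q q"
    using psd_sym[OF A, of q p] p q tq
    by (simp add: bform_add_left[OF p tq] bform_add_right[OF p tq] bform_scale_left bform_scale_right power2_eq_square)
  finally show "0 \<le> bform A p p + 2 * t * bform A p q + t\<^sup>2 * bform A q q" .
qed (use A q in \<open>simp add: psd_nonneg\<close>)

lemma psd_triangle:
  assumes A: "psd A" and p: "fsupp p" and q: "fsupp q"
  shows "sqrt (bform A (\<lambda>r. p r + q r) (\<lambda>r. p r + q r)) \<le> sqrt (bform A p p) + sqrt (bform A q q)"
proof (rule real_le_lsqrt)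
  have "\<bar>bform A p q\<bar> \<le> sqrt (bform A p p * bform A q q)"
    using psd_cauchy_schwarz[OF A p q] by (rule real_le_rsqrt[of "\<bar>_\<bar>", simplified])
  moreover have "bform A (\<lambda>r. p r + q r) (\<lambda>r. p r + q r) = bform A p p + 2 * bform A p q + bform A q q"
    using psd_sym[OF A, of q p] p q by (simp add: bform_add_left bform_add_right)
  ultimately show "bform A (\<lambda>r. p r + q r) (\<lambda>r. p r + q r) \<le> (sqrt (bform A p p) + sqrt (bform A q q))\<^sup>2"
    using psd_nonneg[OF A p] psd_nonneg[OF A q] by (simp add: power2_sum real_sqrt_mult)
qed (use psd_nonneg[OF A p] psd_nonneg[OF A q] in simp)

abbreviation qdist :: "(nat \<Rightarrow> nat \<Rightarrow> real) \<Rightarrow> (nat \<Rightarrow> real) \<Rightarrow> (nat \<Rightarrow> real) \<Rightarrow> real" where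
  "qdist A p q \<equiv> bform A (\<lambda>r. p r - q r) (\<lambda>r. p r - q r)"

lemma qdist_triangle:
  assumes A: "psd A" and "fsupp p" "fsupp q" "fsupp w"
  shows "sqrt (qdist A p w) \<le> sqrt (qdist A p q) + sqrt (qdist A q w)"
  using psd_triangle[OF A, of "\<lambda>r. p r - q r" "\<lambda>r. q r - w r"] assms by (simp add: fsupp_diff)

lemma qdist_chain:
  assumes A: "psd A" and P: "\<And>t. fsupp (P t)" and st: "s \<le> s'"
  shows "sqrt (qdist A (P s) (P s')) \<le> (\<Sum>t\<in>{s..<s'}. sqrt (qdist A (P t) (P (Suc t))))"
  using st
proof (induction s' rule: dec_induct)
  case base
  have "bform A (\<lambda>r. 0) (\<lambda>r. 0) = 0" by (simp add: bform_def lin_comb_def)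
  then show ?case by simp
next
  case (step s')
  have "sqrt (qdist A (P s) (P (Suc s'))) \<le> sqrt (qdist A (P s) (P s')) + sqrt (qdist A (P s') (P (Suc s')))"
    by (intro qdist_triangle A P)
  then show ?case using step by simp
qed

text \<open>By continuity it suffices to exclude null sets for the countably many rational vectors.\<close>

lemma AE_psd_nonneg:
  fixes A :: "'a \<Rightarrow> nat \<Rightarrow> nat \<Rightarrow> real"
  assumes "\<And>p. fsupp p \<Longrightarrow> AE x in M. 0 \<le> bform (A x) p p"
  shows "AE x in M. \<forall>p. fsupp p \<longrightarrow> 0 \<le> bform (A x) p p"
proof -
  define v where "v qs r = (if r < length qs then real_of_rat (qs ! r) else 0)" for qs :: "rat list" and r
  have fv: "fsupp (v qs)" for qs
    unfolding fsupp_def by (rule finite_subset[of _ "{..<length qs}"]) (auto simp: v_def split: if_splits)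
  have "AE x in M. \<forall>qs. 0 \<le> bform (A x) (v qs) (v qs)"
    using assms[OF fv] by (subst AE_all_countable) auto
  then show ?thesis
  proof eventually_elim
    case (elim x)
    show ?case
    proof (intro allI impI)
      fix p assume p: "fsupp p"
      then obtain N where "{r. p r \<noteq> 0} \<subseteq> {..<N}"
        unfolding fsupp_def using finite_nat_iff_bounded by blast
      then have N: "p r = 0" if "r \<notin> {..<N}" for r using that by auto
      have "\<exists>q. \<bar>real_of_rat q - p r\<bar> < 1 / real (Suc k)" for k r
      proof -
        obtain q where "p r < real_of_rat q" "real_of_rat q < p r + 1 / real (Suc k)"
          using of_rat_dense[of "p r" "p r + 1 / real (Suc k)"] by auto
        then show ?thesis by (intro exI[of _ q]) auto
      qed
      note ex = this
      define q where "q k r = (SOME q. \<bar>real_of_rat q - p r\<bar> < 1 / real (Suc k))" for k r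
      have q: "\<bar>real_of_rat (q k r) - p r\<bar> < 1 / real (Suc k)" for k r
        unfolding q_def by (rule someI_ex[OF ex])
      have lim: "(\<lambda>k. real_of_rat (q k r)) \<longlonglongrightarrow> p r" for r
      proof -
        have "(\<lambda>k. real_of_rat (q k r) - p r) \<longlonglongrightarrow> 0"
        proof (rule Lim_null_comparison[OF always_eventually LIMSEQ_inverse_real_of_nat], rule allI)
          show "norm (real_of_rat (q k r) - p r) \<le> inverse (real (Suc k))" for k
            using q[of k r] by (simp add: inverse_eq_divide)
        qed
        then show ?thesis by (simp add: LIM_zero_iff)
      qed
      define qs where "qs k = map (q k) [0..<N]" for k
      have vz: "v (qs k) r = 0" if "r \<notin> {..<N}" for k r using that by (simp add: v_def qs_def)
      have b: "bform (A x) w w = (\<Sum>r<N. w r * (\<Sum>s<N. w s * A x r s))"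
        if w: "\<And>r. r \<notin> {..<N} \<Longrightarrow> w r = 0" for w
      proof -
        have "lin_comb w B = (\<Sum>r<N. w r * B r)" for B by (rule lin_comb_eq) (use w in auto)
        then show ?thesis by (simp add: bform_def)
      qed
      have "(\<lambda>k. \<Sum>r<N. real_of_rat (q k r) * (\<Sum>s<N. real_of_rat (q k s) * A x r s))
        \<longlonglongrightarrow> (\<Sum>r<N. p r * (\<Sum>s<N. p s * A x r s))"
        by (intro tendsto_intros lim)
      moreover have "(\<Sum>r<N. real_of_rat (q k r) * (\<Sum>s<N. real_of_rat (q k s) * A x r s)) = bform (A x) (v (qs k)) (v (qs k))" for k
        by (subst b) (auto simp: vz v_def qs_def intro!: sum.cong)
      ultimately have "(\<lambda>k. bform (A x) (v (qs k)) (v (qs k))) \<longlonglongrightarrow> bform (A x) p p"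
        by (subst (2) b) (auto simp: N)
      then show "0 \<le> bform (A x) p p" using elim by (intro LIMSEQ_le_const) auto
    qed
  qed
qed

text \<open>The parallelogram law: near-minimisers of a quadratic form on a convex set are close.\<close>

lemma near_minimisers_close:
  assumes A: "psd A" and p: "p \<in> convex_weights" and q: "q \<in> convex_weights"
    and c: "\<And>w. w \<in> convex_weights \<Longrightarrow> c \<le> bform A w w"
  shows "qdist A p q \<le> 2 * (bform A p p - c) + 2 * (bform A q q - c)"
proof -
  have f: "fsupp p" "fsupp q" using p q by (auto simp: convex_weights_def)
  have "c \<le> bform A (\<lambda>r. 1/2 * (p r + q r)) (\<lambda>r. 1/2 * (p r + q r))"
    by (intro c convex_weights_midpoint p q)
  also have "\<dots> = 1/4 * bform A (\<lambda>r. p r + q r) (\<lambda>r. p r + q r)"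
    using fsupp_add[OF f] fsupp_scale[OF fsupp_add[OF f], of "\<lambda>_. 1/2"]
    by (simp add: bform_scale_left[of "\<lambda>r. p r + q r" _ "1/2"] bform_scale_right[of "\<lambda>r. p r + q r" _ _ "1/2"]
        del: times_divide_eq_left)
  also have "\<dots> = 1/4 * (2 * bform A p p + 2 * bform A q q - qdist A p q)"
    using f by (simp add: bform_add_left bform_add_right bform_diff_left bform_diff_right fsupp_add fsupp_diff)
  finally show ?thesis by simp
qed

lemma minimising_sequence:
  assumes A: "psd A" and e: "\<And>s. e s > 0"
  obtains c P where "\<And>w. w \<in> convex_weights \<Longrightarrow> c \<le> bform A w w"
    and "\<And>s::nat. P s \<in> convex_weights" and "\<And>s. bform A (P s) (P s) < c + e s"
proof -
  let ?S = "(\<lambda>w. bform A w w) ` convex_weights"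
  have ne: "?S \<noteq> {}" using convex_weights_unit_vec by blast
  have bdd: "bdd_below ?S"
    by (rule bdd_belowI[of _ 0]) (auto intro!: psd_nonneg[OF A] convex_weights_fsupp)
  have "\<exists>w. w \<in> convex_weights \<and> bform A w w < Inf ?S + e s" for s
    using cInf_lessD[OF ne, of "Inf ?S + e s"] e[of s] by auto
  then obtain P where "\<And>s. P s \<in> convex_weights \<and> bform A (P s) (P s) < Inf ?S + e s" by metis
  moreover have "Inf ?S \<le> bform A w w" if "w \<in> convex_weights" for w
    using that by (intro cInf_lower bdd) auto
  ultimately show ?thesis using that by blast
qed

text \<open>Here \<open>A\<close> is the Gram matrix of a stationary family and \<open>c\<close> a lower bound for the form on its convex
  hull. A shifted near-minimiser is again one and therefore close to the original. So a minimising
  sequence that is in the limit orthogonal to the first vector is orthogonal to every vector of the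
  family, hence to itself.\<close>

lemma stationary_minimum_le_zero:
  assumes A: "psd A" and stat: "\<And>r s n. A (r + n) (s + n) = A r s"
    and c: "\<And>w. w \<in> convex_weights \<Longrightarrow> c \<le> bform A w w"
    and P: "\<And>s::nat. P s \<in> convex_weights" and Pe: "\<And>s. bform A (P s) (P s) < c + e s"
    and e: "e \<longlonglongrightarrow> 0"
    and orth: "(\<lambda>s. bform A (unit_vec 0) (P s)) \<longlonglongrightarrow> 0"
  shows "c \<le> 0"
proof -
  note f = convex_weights_fsupp[OF P]
  have inv: "bform A (shift n p) (shift n q) = bform A p q" if "fsupp p" "fsupp q" for n p q
    using bform_shift[OF that] stat by simp
  have close: "qdist A (P s) (shift n (P s)) \<le> 4 * e s" for s n
    using near_minimisers_close[OF A P convex_weights_shift[OF P] c, of s n s] Pe[of s] inv[OF f f, of n s s]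
    by simp
  have u: "(\<lambda>s. bform A (unit_vec n) (P s)) \<longlonglongrightarrow> 0" for n
  proof -
    have sv: "shift n (unit_vec 0) = unit_vec n" by (auto simp: fun_eq_iff shift_def unit_vec_def)
    have "\<bar>bform A (unit_vec n) (P s)\<bar> \<le> \<bar>bform A (unit_vec 0) (P s)\<bar> + sqrt (bform A (unit_vec n) (unit_vec n) * (4 * e s))" for s
    proof -
      have "bform A (unit_vec n) (shift n (P s)) = bform A (unit_vec 0) (P s)"
        using inv[OF fsupp_unit_vec f, of n 0 s] by (simp add: sv)
      moreover have "(bform A (unit_vec n) (\<lambda>r. P s r - shift n (P s) r))\<^sup>2
          \<le> bform A (unit_vec n) (unit_vec n) * (4 * e s)"
        by (rule order_trans[OF psd_cauchy_schwarz[OF A fsupp_unit_vec fsupp_diff[OF f fsupp_shift[OF f]]]])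
          (intro mult_left_mono close psd_nonneg[OF A] fsupp_unit_vec)
      then have "\<bar>bform A (unit_vec n) (\<lambda>r. P s r - shift n (P s) r)\<bar> \<le> sqrt (bform A (unit_vec n) (unit_vec n) * (4 * e s))"
        by (rule real_le_rsqrt[of "\<bar>_\<bar>", simplified])
      ultimately show ?thesis
        by (simp add: bform_diff_right[OF f fsupp_shift[OF f]])
    qed
    from this have ub: "norm (bform A (unit_vec n) (P s)) \<le> \<bar>bform A (unit_vec 0) (P s)\<bar> + sqrt (bform A (unit_vec n) (unit_vec n) * (4 * e s))" for s by simp
    have "(\<lambda>s. \<bar>bform A (unit_vec 0) (P s)\<bar> + sqrt (bform A (unit_vec n) (unit_vec n) * (4 * e s))) \<longlonglongrightarrow> \<bar>0\<bar> + sqrt (bform A (unit_vec n) (unit_vec n) * (4 * 0))"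
      by (intro tendsto_intros orth e)
    then have "(\<lambda>s. \<bar>bform A (unit_vec 0) (P s)\<bar> + sqrt (bform A (unit_vec n) (unit_vec n) * (4 * e s))) \<longlonglongrightarrow> 0"
      by simp
    from Lim_null_comparison[OF always_eventually[OF allI[OF ub]] this] show ?thesis .
  qed
  have lim: "(\<lambda>s. bform A (P S) (P s)) \<longlonglongrightarrow> 0" for S
  proof -
    have "(\<lambda>s. \<Sum>r | P S r \<noteq> 0. P S r * bform A (unit_vec r) (P s)) \<longlonglongrightarrow> (\<Sum>r | P S r \<noteq> 0. P S r * 0)"
      by (intro tendsto_sum tendsto_mult tendsto_const u)
    moreover have "(\<Sum>r | P S r \<noteq> 0. P S r * bform A (unit_vec r) (P s)) = bform A (P S) (P s)" for s
      unfolding bform_unit_vec_left by (simp add: bform_def lin_comb_def[of "P S"])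
    ultimately show ?thesis by simp
  qed
  have "bform A (P S) (P S) \<le> 2 * e S" for S
  proof (rule LIMSEQ_le_const[of "\<lambda>s. 2 * e S + 2 * e s + 2 * bform A (P S) (P s)"])
    have "(\<lambda>s. 2 * e S + 2 * e s + 2 * bform A (P S) (P s)) \<longlonglongrightarrow> 2 * e S + 2 * 0 + 2 * 0"
      by (intro tendsto_intros lim e)
    then show "(\<lambda>s. 2 * e S + 2 * e s + 2 * bform A (P S) (P s)) \<longlonglongrightarrow> 2 * e S" by simp
    have "bform A (P S) (P S) \<le> 2 * e S + 2 * e s + 2 * bform A (P S) (P s)" for s
    proof -
      have "qdist A (P S) (P s) = bform A (P S) (P S) + bform A (P s) (P s) - 2 * bform A (P S) (P s)"
        using psd_sym[OF A, of "P s" "P S"] f by (simp add: bform_diff_left bform_diff_right fsupp_diff)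
      moreover have "qdist A (P S) (P s) \<le> 2 * e S + 2 * e s"
        using near_minimisers_close[OF A P P c, of S s] Pe[of S] Pe[of s] by simp
      moreover have "0 \<le> bform A (P s) (P s)" by (rule psd_nonneg[OF A f])
      ultimately show ?thesis by simp
    qed
    then show "\<exists>N. \<forall>s\<ge>N. bform A (P S) (P S) \<le> 2 * e S + 2 * e s + 2 * bform A (P S) (P s)" by blast
  qed
  then have "c \<le> 2 * e S" for S using c[OF P, of S] order_trans by blast
  moreover have "(\<lambda>S. 2 * e S) \<longlonglongrightarrow> 2 * 0" by (intro tendsto_intros e)
  ultimately show ?thesis by (intro LIMSEQ_le_const[of "\<lambda>S. 2 * e S"]) auto
qed

text \<open>Average the shifts of a short convex combination \<open>w\<close>: by Cauchy-Schwarz each of them is almost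
  orthogonal to the first vector, and their average differs little from the uniform average.\<close>

lemma stationary_averages_tendsto_zero:
  assumes A: "psd A" and stat: "\<And>r s n. A (r + n) (s + n) = A r s"
    and bd: "\<And>r. \<bar>A 0 r\<bar> \<le> K"
    and small: "\<And>e. e > 0 \<Longrightarrow> \<exists>w\<in>convex_weights. bform A w w < e"
  shows "(\<lambda>m. (\<Sum>i<m. A 0 i) / real m) \<longlonglongrightarrow> 0"
proof (rule LIMSEQ_I)
  fix \<epsilon> :: real assume \<epsilon>: "\<epsilon> > 0"
  have K: "K \<ge> 0" using bd[of 0] by linarith
  have A00: "0 \<le> A 0 0" using psd_nonneg[OF A fsupp_unit_vec[of 0]] by (simp add: bform_unit_vec_left lin_comb_unit_vec)
  have "\<epsilon>\<^sup>2 / (4 * (A 0 0 + 1)) > 0" using \<epsilon> A00 by simp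
  then obtain w where w: "w \<in> convex_weights" "bform A w w < \<epsilon>\<^sup>2 / (4 * (A 0 0 + 1))" using small by blast
  have fw: "fsupp w" using w(1) by (rule convex_weights_fsupp)
  obtain N where N: "{r. w r \<noteq> 0} \<subseteq> {..<N}"
    using fw unfolding fsupp_def using finite_nat_iff_bounded by blast
  have wi: "\<bar>lin_comb w (\<lambda>s. A 0 (s + i))\<bar> \<le> \<epsilon> / 2" for i
  proof -
    have "bform A (shift i w) (shift i w) = bform A w w" using bform_shift[OF fw fw] stat by simp
    then have "(lin_comb (shift i w) (A 0))\<^sup>2 \<le> A 0 0 * bform A w w"
      using psd_cauchy_schwarz[OF A fsupp_unit_vec[of 0] fsupp_shift[OF fw, of i]]
      by (simp add: bform_unit_vec_left lin_comb_unit_vec)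
    also have "\<dots> \<le> (A 0 0 + 1) * bform A w w"
      using psd_nonneg[OF A fw] by (intro mult_right_mono) auto
    also have "\<dots> \<le> (A 0 0 + 1) * (\<epsilon>\<^sup>2 / (4 * (A 0 0 + 1)))"
      using w(2) A00 by (intro mult_left_mono) auto
    also have "\<dots> = (\<epsilon> / 2)\<^sup>2" using A00 by (simp add: field_simps power2_eq_square)
    finally have "\<bar>lin_comb (shift i w) (A 0)\<bar> \<le> \<epsilon> / 2" using \<epsilon> abs_le_square_iff[of "lin_comb (shift i w) (A 0)" "\<epsilon> / 2"] by simp
    then show ?thesis by (simp add: lin_comb_shift[OF fw])
  qed
  have sh: "\<bar>(\<Sum>i<m. A 0 (s + i)) - (\<Sum>i<m. A 0 i)\<bar> \<le> 2 * real s * K" for s m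
  proof (induction s)
    case (Suc s)
    have "(\<Sum>i<m. A 0 (Suc s + i)) - (\<Sum>i<m. A 0 (s + i)) = A 0 (s + m) - A 0 s"
      using sum_lessThan_telescope[of "\<lambda>i. A 0 (s + i)" m] by (simp add: sum_subtractf)
    then have "\<bar>(\<Sum>i<m. A 0 (Suc s + i)) - (\<Sum>i<m. A 0 (s + i))\<bar> \<le> 2 * K"
      using bd[of "s + m"] bd[of s] by linarith
    then show ?case using Suc by (simp add: algebra_simps)
  qed simp
  have main: "\<bar>\<Sum>i<m. A 0 i\<bar> \<le> real m * (\<epsilon> / 2) + 2 * real N * K" for m
  proof -
    have "lin_comb w (\<lambda>s. \<Sum>i<m. A 0 (s + i)) = (\<Sum>i<m. lin_comb w (\<lambda>s. A 0 (s + i)))"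
      unfolding lin_comb_def sum_distrib_left by (rule sum.swap)
    also have "\<bar>\<dots>\<bar> \<le> (\<Sum>i<m. \<epsilon> / 2)" by (rule order_trans[OF sum_abs]) (intro sum_mono wi)
    finally have 1: "\<bar>lin_comb w (\<lambda>s. \<Sum>i<m. A 0 (s + i))\<bar> \<le> real m * (\<epsilon> / 2)" by simp
    have "\<bar>lin_comb w (\<lambda>s. (\<Sum>i<m. A 0 (s + i)) - (\<Sum>i<m. A 0 i))\<bar> \<le> 2 * real N * K"
    proof (rule convex_weights_abs_le[OF w(1)])
      fix s assume "w s \<noteq> 0"
      then have "real s \<le> real N" using N by auto
      then have "2 * real s * K \<le> 2 * real N * K" using K by (intro mult_right_mono) auto
      then show "\<bar>(\<Sum>i<m. A 0 (s + i)) - (\<Sum>i<m. A 0 i)\<bar> \<le> 2 * real N * K" using sh[of s m] by linarith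
    qed
    moreover have "lin_comb w (\<lambda>s. (\<Sum>i<m. A 0 (s + i)) - (\<Sum>i<m. A 0 i)) = lin_comb w (\<lambda>s. \<Sum>i<m. A 0 (s + i)) - (\<Sum>i<m. A 0 i)"
      using w(1) by (simp add: lin_comb_diff_right lin_comb_const[of w "\<Sum>i<m. A 0 i"] convex_weights_def)
    ultimately show ?thesis using 1 by linarith
  qed
  obtain m0 :: nat where m0: "4 * real N * K / \<epsilon> < real m0" using reals_Archimedean2 by blast
  show "\<exists>no. \<forall>m\<ge>no. norm ((\<Sum>i<m. A 0 i) / real m - 0) < \<epsilon>"
  proof (intro exI allI impI)
    fix m assume m: "m \<ge> Suc m0"
    then have "real m > 0" "4 * real N * K / \<epsilon> < real m" using m0 by auto
    then have "2 * real N * K < real m * (\<epsilon> / 2)" using \<epsilon> by (simp add: pos_divide_less_eq)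
    then have "\<bar>\<Sum>i<m. A 0 i\<bar> < real m * \<epsilon>" using main[of m] by simp
    then show "norm ((\<Sum>i<m. A 0 i) / real m - 0) < \<epsilon>"
      using \<open>real m > 0\<close> by (simp add: pos_divide_less_eq mult.commute)
  qed
qed


section \<open>Conditional Gram matrices of an orbit\<close>

lemma square_lin_comb: "(lin_comb p A)\<^sup>2 = bform (\<lambda>r s. A r * A s) p p"
proof -
  have "bform (\<lambda>r s. A r * A s) p p = lin_comb p (\<lambda>r. lin_comb p A * A r)"
    unfolding bform_def by (simp add: lin_comb_scale_right mult.commute)
  also have "\<dots> = (lin_comb p A)\<^sup>2" by (simp add: lin_comb_scale_right power2_eq_square)
  finally show ?thesis by simp
qed

lemma bform_weighted:
  assumes "fsupp p"
  shows "bform A (\<lambda>r. w r * p r) (\<lambda>r. w r * p r) = bform (\<lambda>r s. w r * w s * A r s) p p"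
  unfolding bform_def using assms by (simp add: lin_comb_mult_left lin_comb_scale_right mult.assoc)

lemma borel_measurable_lin_comb [measurable (raw)]:
  "(\<And>r. (\<lambda>x. A x r) \<in> borel_measurable N) \<Longrightarrow> (\<lambda>x. lin_comb p (A x)) \<in> borel_measurable N"
  unfolding lin_comb_def by (intro borel_measurable_sum borel_measurable_times) auto

lemma borel_measurable_bform [measurable (raw)]:
  "(\<And>r s. (\<lambda>x. A x r s) \<in> borel_measurable N) \<Longrightarrow> (\<lambda>x. bform (A x) p q) \<in> borel_measurable N"
  unfolding bform_def by (intro borel_measurable_lin_comb)

lemma integral_lin_comb:
  "(\<And>r. integrable M (\<lambda>x. A x r)) \<Longrightarrow> (\<integral>x. lin_comb p (A x) \<partial>M) = lin_comb p (\<lambda>r. \<integral>x. A x r \<partial>M)"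
  unfolding lin_comb_def by simp

lemma integrable_lin_comb:
  "(\<And>r. integrable M (\<lambda>x. A x r)) \<Longrightarrow> integrable M (\<lambda>x. lin_comb p (A x))"
  unfolding lin_comb_def by simp

lemma integral_bform:
  "(\<And>r s. integrable M (\<lambda>x. A x r s)) \<Longrightarrow>
    (\<integral>x. bform (A x) p q \<partial>M) = bform (\<lambda>r s. \<integral>x. A x r s \<partial>M) p q"
  unfolding bform_def by (simp add: integral_lin_comb integrable_lin_comb)

context finite_measure
begin

lemma L_infty_lin_comb: "(\<And>r. (\<lambda>x. A x r) \<in> L_infty M) \<Longrightarrow> (\<lambda>x. lin_comb p (A x)) \<in> L_infty M"
  unfolding lin_comb_def by (intro L_infty_sum L_infty_mult L_infty_const)

lemma L_infty_bform: "(\<And>r s. (\<lambda>x. A x r s) \<in> L_infty M) \<Longrightarrow> (\<lambda>x. bform (A x) p q) \<in> L_infty M"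
  unfolding bform_def by (intro L_infty_lin_comb)

end

context system_factor
begin

lemma E_lin_comb:
  assumes p: "fsupp p" and A: "\<And>r. (\<lambda>x. A x r) \<in> L_infty M"
  shows "AE x in M. E (\<lambda>x. lin_comb p (A x)) x = lin_comb p (\<lambda>r. E (\<lambda>x. A x r) x)"
proof -
  have I: "finite {r. p r \<noteq> 0}" using p by (simp add: fsupp_def)
  have "AE x in M. E (\<lambda>x. \<Sum>r | p r \<noteq> 0. p r * A x r) x = (\<Sum>r | p r \<noteq> 0. E (\<lambda>x. p r * A x r) x)"
    by (intro E_sum I L_infty_integrable L_infty_mult L_infty_const A)
  moreover have "AE x in M. \<forall>r. E (\<lambda>x. p r * A x r) x = p r * E (\<lambda>x. A x r) x"
    by (subst AE_all_countable) (intro allI E_cmult L_infty_integrable A)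
  ultimately show ?thesis unfolding lin_comb_def by eventually_elim simp
qed

lemma E_bform:
  assumes p: "fsupp p" and q: "fsupp q" and A: "\<And>r s. (\<lambda>x. A x r s) \<in> L_infty M"
  shows "AE x in M. E (\<lambda>x. bform (A x) p q) x = bform (\<lambda>r s. E (\<lambda>x. A x r s) x) p q"
proof -
  have "AE x in M. E (\<lambda>x. lin_comb p (\<lambda>r. lin_comb q (A x r))) x = lin_comb p (\<lambda>r. E (\<lambda>x. lin_comb q (A x r)) x)"
    by (intro E_lin_comb p L_infty_lin_comb A)
  moreover have "AE x in M. \<forall>r. E (\<lambda>x. lin_comb q (A x r)) x = lin_comb q (\<lambda>s. E (\<lambda>x. A x r s) x)"
    by (subst AE_all_countable) (intro allI E_lin_comb q A)
  ultimately show ?thesis unfolding bform_def by eventually_elim simp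
qed

end

locale orbit_gram = system_factor +
  fixes f :: "'a \<Rightarrow> real" and C :: real
  assumes eqv: "equivariant Y"
    and f_measurable: "f \<in> borel_measurable M"
    and f_bound: "AE x in M. \<bar>f x\<bar> \<le> C"
    and C_pos: "C > 0"
begin

text \<open>Every coefficient vector \<open>p\<close> stands for the kernel \<open>K\<^sub>p = (\<Sum>r. p r * (fT r \<otimes> fT r))\<close> over \<open>Y\<close>. The matrix
\<open>G\<close> is the conditional Gram matrix of the orbit of \<open>f\<close>, \<open>\<Theta> n p\<close> is the function obtained by applying \<open>K\<^sub>p\<close>
to \<open>fT n\<close>, the form \<open>bform (S x) p p\<close> is the squared Hilbert-Schmidt norm of \<open>K\<^sub>p\<close> on the fibre over \<open>x\<close>,
and \<open>\<Gamma>\<close> is its integral.\<close>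

definition fT :: "nat \<Rightarrow> 'a \<Rightarrow> real" where "fT r x = f ((T ^^ r) x)"

definition G :: "nat \<Rightarrow> nat \<Rightarrow> 'a \<Rightarrow> real" where "G r s = E (\<lambda>x. fT r x * fT s x)"

definition \<Theta> :: "nat \<Rightarrow> (nat \<Rightarrow> real) \<Rightarrow> 'a \<Rightarrow> real" where
  "\<Theta> n p x = lin_comb p (\<lambda>r. G n r x * fT r x)"

definition \<Gamma> :: "nat \<Rightarrow> nat \<Rightarrow> real" where "\<Gamma> r s = (\<integral>x. (G r s x)\<^sup>2 \<partial>M)"

abbreviation S :: "'a \<Rightarrow> nat \<Rightarrow> nat \<Rightarrow> real" where "S x \<equiv> (\<lambda>r s. (G r s x)\<^sup>2)"

lemma f_L_infty: "f \<in> L_infty M"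
  using f_measurable f_bound by (rule L_inftyI)

lemma fT_L_infty: "fT r \<in> L_infty M"
  unfolding fT_def by (intro L_infty_Tn f_L_infty)

lemma fT_bound: "AE x in M. \<forall>r. \<bar>fT r x\<bar> \<le> C"
  unfolding fT_def by (subst AE_all_countable) (intro allI AE_Tn f_bound)

lemma G_measurable [measurable]: "G r s \<in> borel_measurable \<F>" "G r s \<in> borel_measurable M"
  by (auto simp: G_def)

lemma G_L_infty: "G r s \<in> L_infty M"
  unfolding G_def by (intro E_L_infty L_infty_mult fT_L_infty)

lemma G_bound: "AE x in M. \<forall>r s. \<bar>G r s x\<bar> \<le> C\<^sup>2"
proof -
  have "AE x in M. \<bar>G r s x\<bar> \<le> C\<^sup>2" for r s
    unfolding G_def
  proof (rule E_bound)
    show "AE x in M. \<bar>fT r x * fT s x\<bar> \<le> C\<^sup>2"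
      using fT_bound
    proof eventually_elim
      case (elim x)
      have "\<bar>fT r x\<bar> * \<bar>fT s x\<bar> \<le> C * C" using elim C_pos by (intro mult_mono) auto
      then show ?case by (simp add: abs_mult power2_eq_square)
    qed
  qed (intro L_infty_mult fT_L_infty)
  then show ?thesis by (simp add: AE_all_countable)
qed

lemma G_sym: "G r s x = G s r x"
  by (simp add: G_def mult.commute)

lemma G_shift: "AE x in M. \<forall>r s n. G (r + n) (s + n) x = G r s ((T ^^ n) x)"
proof -
  have "AE x in M. G (r + n) (s + n) x = G r s ((T ^^ n) x)" for r s n
    using equivariant_Tn[OF eqv L_infty_mult[OF fT_L_infty[of r] fT_L_infty[of s]], of n]
    by (simp add: G_def fT_def funpow_add)
  then show ?thesis by (simp add: AE_all_countable)
qed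

text \<open>The form at \<open>p\<close> is the conditional expectation of the square of \<open>(\<Sum>r. p r * fT r)\<close>.\<close>

lemma G_psd: "AE x in M. psd (\<lambda>r s. G r s x)"
proof -
  have "AE x in M. \<forall>p. fsupp p \<longrightarrow> 0 \<le> bform (\<lambda>r s. G r s x) p p"
  proof (rule AE_psd_nonneg)
    fix p assume p: "fsupp p"
    have "AE x in M. E (\<lambda>x. bform (\<lambda>r s. fT r x * fT s x) p p) x = bform (\<lambda>r s. G r s x) p p"
      unfolding G_def by (intro E_bform p L_infty_mult fT_L_infty)
    moreover have "AE x in M. 0 \<le> E (\<lambda>x. bform (\<lambda>r s. fT r x * fT s x) p p) x"
      by (intro E_nonneg L_infty_measurable L_infty_bform L_infty_mult fT_L_infty) (simp flip: square_lin_comb)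
    ultimately show "AE x in M. 0 \<le> bform (\<lambda>r s. G r s x) p p" by eventually_elim simp
  qed
  then show ?thesis
    by eventually_elim (auto simp: psd_def G_sym)
qed

lemma S_L_infty: "(\<lambda>x. S x r s) \<in> L_infty M"
  by (intro L_infty_power2 G_L_infty)

text \<open>Let \<open>k\<^sub>x = (\<Sum>r. p r * fT r x * fT r)\<close> be the slice of \<open>K\<^sub>p\<close> at \<open>x\<close>. The function under the conditional
  expectation is \<open>x \<mapsto> E(k\<^sub>x\<^sup>2)(x)\<close>, so that this is Fubini's theorem for the Hilbert-Schmidt norm on a
  fibre. It also shows that the norm is nonnegative, which for the entrywise square of a positive
  semidefinite matrix is Schur's product theorem.\<close>

lemma E_weighted_G:
  assumes p: "fsupp p"
  shows "AE x in M. E (\<lambda>x. bform (\<lambda>r s. fT r x * fT s x * G r s x) p p) x = bform (S x) p p"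
proof -
  have "AE x in M. E (\<lambda>x. bform (\<lambda>r s. fT r x * fT s x * G r s x) p p) x
      = bform (\<lambda>r s. E (\<lambda>x. fT r x * fT s x * G r s x) x) p p"
    by (intro E_bform p L_infty_mult fT_L_infty G_L_infty)
  moreover have "AE x in M. \<forall>r s. E (\<lambda>x. fT r x * fT s x * G r s x) x = (G r s x)\<^sup>2"
  proof -
    have "AE x in M. E (\<lambda>x. fT r x * fT s x * G r s x) x = (G r s x)\<^sup>2" for r s
    proof -
      have "AE x in M. E (\<lambda>x. G r s x * (fT r x * fT s x)) x = G r s x * E (\<lambda>x. fT r x * fT s x) x"
        by (intro E_mult L_infty_integrable L_infty_mult G_L_infty fT_L_infty L_infty_measurable) simp
      then show ?thesis by (simp add: mult.commute power2_eq_square flip: G_def)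
    qed
    then show ?thesis by (simp add: AE_all_countable)
  qed
  ultimately show ?thesis by eventually_elim simp
qed

lemma S_psd: "AE x in M. psd (S x)"
proof -
  have "AE x in M. \<forall>p. fsupp p \<longrightarrow> 0 \<le> bform (S x) p p"
  proof (rule AE_psd_nonneg)
    fix p assume p: "fsupp p"
    have "AE x in M. 0 \<le> bform (\<lambda>r s. fT r x * fT s x * G r s x) p p"
      using G_psd by eventually_elim (simp add: psd_nonneg fsupp_scale p flip: bform_weighted[OF p])
    then have "AE x in M. 0 \<le> E (\<lambda>x. bform (\<lambda>r s. fT r x * fT s x * G r s x) p p) x"
      by (intro E_nonneg L_infty_measurable L_infty_bform L_infty_mult fT_L_infty G_L_infty)
    with E_weighted_G[OF p] show "AE x in M. 0 \<le> bform (S x) p p" by eventually_elim simp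
  qed
  then show ?thesis
    by eventually_elim (simp add: psd_def, metis G_sym)
qed

lemma \<Theta>_L_infty: "\<Theta> n p \<in> L_infty M"
  unfolding \<Theta>_def by (intro L_infty_lin_comb L_infty_mult G_L_infty fT_L_infty)

lemma \<Theta>_diff: "fsupp p \<Longrightarrow> fsupp q \<Longrightarrow> \<Theta> n p x - \<Theta> n q x = \<Theta> n (\<lambda>r. p r - q r) x"
  by (simp add: \<Theta>_def lin_comb_diff_left)

lemma \<Theta>_shift:
  assumes "fsupp p"
  shows "AE x in M. \<Theta> 0 p ((T ^^ n) x) = \<Theta> n (shift n p) x"
  using G_shift
proof eventually_elim
  case (elim x)
  have "G n (r + n) x = G 0 r ((T ^^ n) x)" for r using elim[rule_format, of 0 n r] by simp
  then show ?case using assms by (simp add: \<Theta>_def lin_comb_shift fT_def funpow_add)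
qed

text \<open>The operator norm is at most the Hilbert-Schmidt norm. At \<open>x\<close> one has
  \<open>\<Theta> n p x = E(fT n * k\<^sub>x)(x)\<close>; apply Cauchy-Schwarz on the fibre, then average over \<open>x\<close>.\<close>

lemma E_\<Theta>_square_le:
  assumes p: "fsupp p"
  shows "AE x in M. E (\<lambda>x. (\<Theta> n p x)\<^sup>2) x \<le> C\<^sup>2 * bform (S x) p p"
proof -
  let ?Q = "\<lambda>x. bform (\<lambda>r s. fT r x * fT s x * G r s x) p p"
  have Q: "?Q \<in> L_infty M" by (intro L_infty_bform L_infty_mult fT_L_infty G_L_infty)
  have le: "AE x in M. (\<Theta> n p x)\<^sup>2 \<le> C\<^sup>2 * ?Q x"
    using G_psd G_bound
  proof eventually_elim
    case (elim x)
    \<comment> \<open>The coefficients of the slice \<open>k\<^sub>x\<close>; they vary with \<open>x\<close> within a fibre, hence the need for positivity at all real vectors simultaneously.\<close>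
    let ?c = "\<lambda>r. fT r x * p r"
    have c: "fsupp ?c" using p by (rule fsupp_scale)
    have "\<Theta> n p x = bform (\<lambda>r s. G r s x) (unit_vec n) ?c"
      unfolding bform_unit_vec_left lin_comb_mult_left[OF p] by (simp add: \<Theta>_def mult.commute)
    then have "(\<Theta> n p x)\<^sup>2 \<le> G n n x * bform (\<lambda>r s. G r s x) ?c ?c"
      using psd_cauchy_schwarz[OF elim(1) fsupp_unit_vec[of n] c] by (simp add: bform_unit_vec_left lin_comb_unit_vec)
    also have "\<dots> \<le> C\<^sup>2 * bform (\<lambda>r s. G r s x) ?c ?c"
      using elim(2)[rule_format, of n n] psd_nonneg[OF elim(1) c] by (intro mult_right_mono) auto
    finally show ?case by (simp add: bform_weighted[OF p])
  qed
  have "AE x in M. E (\<lambda>x. (\<Theta> n p x)\<^sup>2) x \<le> E (\<lambda>x. C\<^sup>2 * ?Q x) x"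
    by (intro E_mono le L_infty_integrable L_infty_power2 \<Theta>_L_infty L_infty_cmult Q)
  with E_cmult[OF L_infty_integrable[OF Q], of "C\<^sup>2"] E_weighted_G[OF p] show ?thesis
    by eventually_elim simp
qed

lemma \<Gamma>_bform: "bform \<Gamma> p q = (\<integral>x. bform (S x) p q \<partial>M)"
  unfolding \<Gamma>_def by (rule integral_bform[symmetric]) (intro L_infty_integrable S_L_infty)

lemma \<Gamma>_psd: "psd \<Gamma>"
  unfolding psd_def
proof (intro conjI allI impI)
  show "\<Gamma> r s = \<Gamma> s r" for r s by (simp add: \<Gamma>_def G_sym[of r s])
  fix p assume p: "fsupp p"
  have "AE x in M. 0 \<le> bform (S x) p p" using S_psd by eventually_elim (simp add: psd_nonneg p)
  then show "0 \<le> bform \<Gamma> p p" unfolding \<Gamma>_bform by (rule integral_nonneg_AE)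
qed

lemma \<Gamma>_stationary: "\<Gamma> (r + n) (s + n) = \<Gamma> r s"
proof -
  have "\<Gamma> (r + n) (s + n) = (\<integral>x. (G r s ((T ^^ n) x))\<^sup>2 \<partial>M)"
    unfolding \<Gamma>_def by (rule integral_cong_AE) (use G_shift in \<open>auto elim: eventually_mono\<close>)
  also have "\<dots> = \<Gamma> r s" unfolding \<Gamma>_def
    by (rule integral_Tn[of "\<lambda>x. (G r s x)\<^sup>2"]) simp
  finally show ?thesis .
qed

lemma \<Gamma>_bound: "\<bar>\<Gamma> r s\<bar> \<le> C ^ 4 * measure M (space M)"
proof -
  have "\<Gamma> r s \<le> (\<integral>x. C ^ 4 \<partial>M)"
    unfolding \<Gamma>_def
  proof (rule integral_mono_AE)
    show "AE x in M. (G r s x)\<^sup>2 \<le> C ^ 4" using G_bound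
    proof eventually_elim
      case (elim x)
      have "\<bar>G r s x\<bar>\<^sup>2 \<le> (C\<^sup>2)\<^sup>2" using elim by (intro power_mono) auto
      then show ?case by (simp flip: power_mult)
    qed
  qed (auto intro: L_infty_integrable S_L_infty)
  moreover have "0 \<le> \<Gamma> r s" by (simp add: \<Gamma>_def)
  ultimately show ?thesis by (simp add: mult.commute)
qed

end


section \<open>Cutting off and finite nets\<close>

text \<open>By monotone convergence the sum of the series has finite integral.\<close>

lemma AE_summable_of_integrals:
  fixes h :: "nat \<Rightarrow> 'a \<Rightarrow> real"
  assumes h: "\<And>t. integrable M (h t)" "\<And>t. AE x in M. 0 \<le> h t x"
    and a: "\<And>t. (\<integral>x. h t x \<partial>M) \<le> a t" "summable a"
  shows "AE x in M. summable (\<lambda>t. h t x)"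
proof -
  note [measurable] = borel_measurable_integrable[OF h(1)]
  have a0: "0 \<le> a t" for t using integral_nonneg_AE[OF h(2)[of t]] a(1)[of t] by linarith
  have "(\<integral>\<^sup>+ x. (\<Sum>t. ennreal (h t x)) \<partial>M) = (\<Sum>t. \<integral>\<^sup>+ x. ennreal (h t x) \<partial>M)"
    by (rule nn_integral_suminf) measurable
  also have "\<dots> = (\<Sum>t. ennreal (\<integral>x. h t x \<partial>M))"
    by (intro suminf_cong nn_integral_eq_integral h)
  also have "\<dots> \<le> (\<Sum>t. ennreal (a t))"
    by (intro suminf_le ennreal_leI a) auto
  also have "\<dots> < \<infinity>" using a(2) a0 by (simp add: suminf_ennreal2 flip: top.not_eq_extremum)
  finally have "(\<integral>\<^sup>+ x. (\<Sum>t. ennreal (h t x)) \<partial>M) \<noteq> \<infinity>" by simp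
  then have "AE x in M. (\<Sum>t. ennreal (h t x)) \<noteq> \<infinity>" by (intro nn_integral_PInf_AE) measurable
  moreover have "AE x in M. \<forall>t. 0 \<le> h t x" using h(2) by (simp add: AE_all_countable)
  ultimately show ?thesis by eventually_elim (auto intro!: summable_suminf_not_top)
qed

context system_factor
begin

text \<open>Approximability need only be known on a set \<open>B\<close> of \<open>Y\<close> if the function is cut off outside \<open>B\<close>.
  If the orbit of \<open>y\<close> first enters \<open>B\<close> at time \<open>m\<close>, then the cut-off function vanishes along the
  orbit before \<open>m\<close>, and from then on the fibre over \<open>y\<close> looks like the fibre over \<open>T\<^sup>m y \<in> B\<close>.\<close>

lemma AP_cutoff:
  assumes eqv: "equivariant Y" and B: "B \<in> sets \<F>" and \<theta>: "\<theta> \<in> L_infty M"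
    and approx: "\<And>\<delta>. \<delta> > 0 \<Longrightarrow> \<exists>G. finite G \<and> G \<subseteq> L_infty M \<and>
      (\<forall>n. AE x in M. x \<in> B \<longrightarrow> (\<exists>g\<in>G. E (\<lambda>x. (\<theta> ((T ^^ n) x) - g x)\<^sup>2) x < \<delta>))"
  shows "AP (\<lambda>x. indicat_real B x * \<theta> x)"
  unfolding almost_periodic_iff
proof (intro conjI allI impI)
  define \<psi> where "\<psi> x = indicat_real B x * \<theta> x" for x
  note BM = sets_\<F>_M[OF B]
  have \<psi>: "\<psi> \<in> L_infty M" unfolding \<psi>_def by (intro L_infty_mult L_infty_indicator BM \<theta>)
  then show "(\<lambda>x. indicat_real B x * \<theta> x) \<in> L2 M" by (simp add: L_infty_L2 \<psi>_def[abs_def])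
  fix \<delta> :: real assume \<delta>: "\<delta> > 0"
  then obtain G where G: "finite G" "G \<subseteq> L_infty M"
    and Gapp: "\<And>n. AE x in M. x \<in> B \<longrightarrow> (\<exists>g\<in>G. E (\<lambda>x. (\<theta> ((T ^^ n) x) - g x)\<^sup>2) x < \<delta>)"
    using approx by blast
  define \<tau> where "\<tau> x = (LEAST m. (T ^^ m) x \<in> B)" for x
  define g' where "g' g x = (if \<exists>m. (T ^^ m) x \<in> B then g ((T ^^ \<tau> x) x) else 0)" for g :: "'a \<Rightarrow> real" and x
  have pred: "Measurable.pred M (\<lambda>x. (T ^^ m) x \<in> B)" for m using BM by measurable
  have g': "g' g \<in> L_infty M" if g: "g \<in> G" for g
  proof -
    have gL: "g \<in> L_infty M" using g G by auto
    obtain K where K: "K > 0" "AE x in M. \<bar>g x\<bar> \<le> K" using gL by (rule L_inftyE)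
    have [measurable]: "\<tau> \<in> M \<rightarrow>\<^sub>M count_space UNIV"
      unfolding \<tau>_def by (rule measurable_Least) (rule pred)
    have m: "(\<lambda>x. g ((T ^^ m) x)) \<in> borel_measurable M" for m
      using gL by (intro L_infty_measurable L_infty_Tn)
    have m2: "(\<lambda>x. g ((T ^^ \<tau> x) x)) \<in> borel_measurable M"
      by (rule measurable_compose_countable[where f = "\<lambda>m x. g ((T ^^ m) x)", OF m]) measurable
    have "g' g \<in> borel_measurable M"
      unfolding g'_def using m2 pred by measurable
    moreover have "AE x in M. \<bar>g' g x\<bar> \<le> K"
    proof -
      have "AE x in M. \<forall>m. \<bar>g ((T ^^ m) x)\<bar> \<le> K"
        by (subst AE_all_countable) (intro allI AE_Tn K(2))
      then show ?thesis by eventually_elim (use K(1) in \<open>auto simp: g'_def\<close>)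
    qed
    ultimately show ?thesis by (rule L_inftyI)
  qed
  let ?H = "insert (\<lambda>_. 0) (g' ` G)"
  have "AE x in M. \<exists>h\<in>?H. E (\<lambda>x. (\<psi> ((T ^^ n) x) - h x)\<^sup>2) x < \<delta>" for n
  proof -
    define F where "F m = {x \<in> space M. (T ^^ m) x \<in> B \<and> (\<forall>m'\<in>{..<m}. (T ^^ m') x \<notin> B) \<and> (T ^^ n) x \<in> B}" for m
    define O' where "O' = {x \<in> space M. (T ^^ n) x \<notin> B}"
    have pF: "Measurable.pred \<F> (\<lambda>x. (T ^^ m) x \<in> B)" for m using B by measurable
    have F: "F m \<in> sets \<F>" for m
      unfolding F_def space_\<F>[symmetric] using pF by measurable
    have O': "O' \<in> sets \<F>"
      unfolding O'_def space_\<F>[symmetric] using pF by measurable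
    have \<psi>n: "(\<lambda>x. \<psi> ((T ^^ n) x)) \<in> L_infty M" by (intro L_infty_Tn \<psi>)
    have zero: "AE x in M. x \<in> O' \<longrightarrow> E (\<lambda>x. (\<psi> ((T ^^ n) x) - 0)\<^sup>2) x = E (\<lambda>_. 0) x"
      by (rule E_local[OF O']) (auto simp: O'_def \<psi>_def intro!: L_infty_integrable L_infty_power2 L_infty_diff L_infty_const \<psi>n[unfolded \<psi>_def])
    have tr: "AE x in M. \<forall>m\<in>{..n}. \<forall>g\<in>G. x \<in> F m \<longrightarrow> E (\<lambda>x. (\<psi> ((T ^^ n) x) - g' g x)\<^sup>2) x
        = E (\<lambda>x. (\<theta> ((T ^^ (n - m)) x) - g x)\<^sup>2) ((T ^^ m) x)"
    proof (intro AE_finite_allI G(1) finite_atMost)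
      fix m g assume m: "m \<in> {..n}" and g: "g \<in> G"
      have gL: "g \<in> L_infty M" using g G by auto
      let ?s = "\<lambda>x. (\<theta> ((T ^^ (n - m)) x) - g x)\<^sup>2"
      have s: "?s \<in> L_infty M" by (intro L_infty_power2 L_infty_diff L_infty_Tn \<theta> gL)
      have eq: "(\<psi> ((T ^^ n) x) - g' g x)\<^sup>2 = ?s ((T ^^ m) x)" if x: "x \<in> F m" for x
      proof -
        have e: "\<exists>m. (T ^^ m) x \<in> B" using x by (auto simp: F_def)
        have "\<tau> x = m" unfolding \<tau>_def
          using x by (intro Least_equality) (auto simp: F_def not_less[symmetric])
        then have "g' g x = g ((T ^^ m) x)" using e by (simp add: g'_def)
        moreover have "(T ^^ n) x = (T ^^ (n - m)) ((T ^^ m) x)"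
          using m funpow_add[of "n - m" m T] by simp
        ultimately show ?thesis using x by (simp add: F_def \<psi>_def)
      qed
      have "AE x in M. x \<in> F m \<longrightarrow> E (\<lambda>x. (\<psi> ((T ^^ n) x) - g' g x)\<^sup>2) x = E (\<lambda>x. ?s ((T ^^ m) x)) x"
        by (rule E_local[OF F _ _ eq]) (intro L_infty_integrable L_infty_power2 L_infty_diff g' g \<psi>n L_infty_Tn[OF s])+
      with equivariant_Tn[OF eqv s, of m]
      show "AE x in M. x \<in> F m \<longrightarrow> E (\<lambda>x. (\<psi> ((T ^^ n) x) - g' g x)\<^sup>2) x = E ?s ((T ^^ m) x)"
        by eventually_elim simp
    qed
    have app: "AE x in M. \<forall>m\<in>{..n}. (T ^^ m) x \<in> B \<longrightarrow> (\<exists>g\<in>G. E (\<lambda>x. (\<theta> ((T ^^ (n - m)) x) - g x)\<^sup>2) ((T ^^ m) x) < \<delta>)"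
      by (intro AE_finite_allI finite_atMost AE_Tn[OF Gapp])
    show ?thesis
      using zero E_const[of 0] tr app AE_space
    proof eventually_elim
      case (elim x)
      show ?case
      proof (cases "(T ^^ n) x \<in> B")
        case False
        then have "E (\<lambda>x. (\<psi> ((T ^^ n) x) - 0)\<^sup>2) x < \<delta>" using elim \<delta> by (simp add: O'_def)
        then show ?thesis by (intro bexI[of _ "\<lambda>_. 0"]) auto
      next
        case True
        define m where "m = \<tau> x"
        have m: "(T ^^ m) x \<in> B" "m \<le> n" unfolding m_def \<tau>_def using True by (auto intro: LeastI Least_le)
        have xF: "x \<in> F m" using m True elim not_less_Least[of _ "\<lambda>m. (T ^^ m) x \<in> B"]
          by (auto simp: F_def m_def \<tau>_def)
        obtain g where g: "g \<in> G" "E (\<lambda>x. (\<theta> ((T ^^ (n - m)) x) - g x)\<^sup>2) ((T ^^ m) x) < \<delta>"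
          using elim(4)[rule_format, of m] m by auto
        have "E (\<lambda>x. (\<psi> ((T ^^ n) x) - g' g x)\<^sup>2) x < \<delta>"
          using elim(3)[rule_format, OF _ g(1) xF] m(2) g(2) by simp
        then show ?thesis using g(1) by (intro bexI[of _ "g' g"]) auto
      qed
    qed
  qed
  moreover have "finite ?H" "?H \<subseteq> L2 M" using G(1) g' by (auto intro: L_infty_L2 L_infty_const)
  ultimately show "\<exists>H. finite H \<and> H \<subseteq> L2 M \<and>
     (\<forall>n. AE x in M. \<exists>h\<in>H. E (\<lambda>x. (indicat_real B ((T ^^ n) x) * \<theta> ((T ^^ n) x) - h x)\<^sup>2) x < \<delta>)"
    unfolding \<psi>_def by (intro exI[of _ ?H]) auto
qed

end

context orbit_gram
begin

text \<open>The functions \<open>\<Theta> n p\<close>, \<open>n \<in> \<nat>\<close>, are combinations of the finitely many \<open>fT r\<close> in the support of \<open>p\<close>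
  with bounded coefficients that are constant on fibres: discretise the coefficients.\<close>

lemma \<Theta>_finite_net:
  assumes p: "p \<in> convex_weights" and \<kappa>: "\<kappa> > 0"
  shows "\<exists>H. finite H \<and> H \<subseteq> L_infty M \<and> (\<forall>n. AE x in M. \<exists>h\<in>H. E (\<lambda>x. (\<Theta> n p x - h x)\<^sup>2) x \<le> \<kappa>)"
proof -
  let ?I = "{r. p r \<noteq> 0}"
  have fp: "fsupp p" using p by (rule convex_weights_fsupp)
  then have I: "finite ?I" by (simp add: fsupp_def)
  define \<eta> where "\<eta> = sqrt \<kappa> / C"
  have \<eta>: "\<eta> > 0" "(\<eta> * C)\<^sup>2 = \<kappa>" using \<kappa> C_pos by (auto simp: \<eta>_def)
  obtain grid where grid: "finite grid" "\<And>t. \<bar>t\<bar> \<le> C\<^sup>2 \<Longrightarrow> \<exists>v\<in>grid. \<bar>t - v\<bar> < \<eta>"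
    using finite_grid[OF \<eta>(1)] by blast
  define \<C> where "\<C> = (\<Pi>\<^sub>E r\<in>?I. grid)"
  define h where "h a x = lin_comb p (\<lambda>r. a r * fT r x)" for a x
  have hL: "h a \<in> L_infty M" for a
    unfolding h_def by (intro L_infty_lin_comb L_infty_cmult fT_L_infty)
  have \<C>: "finite \<C>" unfolding \<C>_def by (intro finite_PiE I grid)
  have "AE x in M. \<exists>u\<in>h ` \<C>. E (\<lambda>x. (\<Theta> n p x - u x)\<^sup>2) x \<le> \<kappa>" for n
  proof -
    define A where "A a = {x \<in> space M. \<forall>r\<in>?I. \<bar>G n r x - a r\<bar> \<le> \<eta>}" for a
    have A: "A a \<in> sets \<F>" for a
    proof -
      have "{x \<in> space \<F>. \<forall>r\<in>?I. \<bar>G n r x - a r\<bar> \<le> \<eta>} \<in> sets \<F>"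
        by (rule sets.sets_Collect_finite_All[OF _ I]) measurable
      then show ?thesis unfolding A_def space_\<F> .
    qed
    have "AE x in M. \<forall>a\<in>\<C>. x \<in> A a \<longrightarrow> E (\<lambda>x. (\<Theta> n p x - h a x)\<^sup>2) x \<le> \<kappa>"
    proof (rule AE_finite_allI[OF \<C>])
      fix a
      let ?s = "\<lambda>x. (\<Theta> n p x - h a x)\<^sup>2"
      have s: "?s \<in> L_infty M" by (intro L_infty_power2 L_infty_diff \<Theta>_L_infty hL)
      have ind: "indicat_real (A a) \<in> L_infty M" by (intro L_infty_indicator sets_\<F>_M A)
      have "AE x in M. indicat_real (A a) x * ?s x \<le> \<kappa>"
        using fT_bound
      proof eventually_elim
        case (elim x)
        show ?case
        proof (cases "x \<in> A a")
          case True
          have "\<bar>lin_comb p (\<lambda>r. (G n r x - a r) * fT r x)\<bar> \<le> \<eta> * C"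
          proof (rule convex_weights_abs_le[OF p])
            fix r assume "p r \<noteq> 0"
            then show "\<bar>(G n r x - a r) * fT r x\<bar> \<le> \<eta> * C"
              using True elim \<eta> unfolding abs_mult by (intro mult_mono) (auto simp: A_def)
          qed
          moreover have "\<Theta> n p x - h a x = lin_comb p (\<lambda>r. (G n r x - a r) * fT r x)"
            by (simp add: \<Theta>_def h_def left_diff_distrib lin_comb_diff_right)
          ultimately have "\<bar>\<Theta> n p x - h a x\<bar>\<^sup>2 \<le> (\<eta> * C)\<^sup>2" by (intro power_mono) auto
          then show ?thesis using True \<eta> by simp
        qed (use \<kappa> in simp)
      qed
      then have "AE x in M. E (\<lambda>x. indicat_real (A a) x * ?s x) x \<le> E (\<lambda>_. \<kappa>) x"
        by (intro E_mono L_infty_integrable L_infty_mult ind s L_infty_const)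
      moreover have "AE x in M. E (\<lambda>x. indicat_real (A a) x * ?s x) x = indicat_real (A a) x * E ?s x"
        using A by (intro E_mult L_infty_integrable L_infty_mult ind s L_infty_measurable) auto
      ultimately show "AE x in M. x \<in> A a \<longrightarrow> E ?s x \<le> \<kappa>"
        using E_const[of \<kappa>] by eventually_elim auto
    qed
    then show ?thesis using G_bound AE_space
    proof eventually_elim
      case (elim x)
      have "\<exists>v. v \<in> grid \<and> \<bar>G n r x - v\<bar> \<le> \<eta>" for r
        using grid(2)[of "G n r x"] elim(2) less_imp_le by blast
      then obtain a where a: "\<And>r. a r \<in> grid \<and> \<bar>G n r x - a r\<bar> \<le> \<eta>" by metis
      have "restrict a ?I \<in> \<C>" using a by (auto simp: \<C>_def)
      moreover have "x \<in> A (restrict a ?I)" using a elim by (auto simp: A_def)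
      ultimately show ?case using elim(1) by blast
    qed
  qed
  then show ?thesis using \<C> hL by (intro exI[of _ "h ` \<C>"]) auto
qed

end


section \<open>Invariant kernels and correlations\<close>

lemma convergent_of_square_steps:
  fixes u :: "nat \<Rightarrow> real"
  assumes "(\<lambda>t. 16 ^ t * (u (Suc t) - u t)\<^sup>2) \<longlonglongrightarrow> 0"
  shows "convergent u"
proof -
  have "eventually (\<lambda>t. 16 ^ t * (u (Suc t) - u t)\<^sup>2 < 1) sequentially"
    by (rule order_tendstoD(2)[OF assms]) simp
  then obtain N where N: "\<And>t. t \<ge> N \<Longrightarrow> 16 ^ t * (u (Suc t) - u t)\<^sup>2 < 1"
    by (auto simp: eventually_sequentially)
  have "\<bar>u (Suc t) - u t\<bar> \<le> (1 / 4) ^ t" if "t \<ge> N" for t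
  proof -
    have "(u (Suc t) - u t)\<^sup>2 \<le> ((1 / 4) ^ t)\<^sup>2"
      using N[OF that] by (simp add: power_divide field_simps flip: power_mult power_mult_distrib)
        (simp add: power_mult power2_eq_square flip: power_mult_distrib)
    then show ?thesis using abs_le_square_iff[of "u (Suc t) - u t" "(1 / 4) ^ t"] by simp
  qed
  then have "summable (\<lambda>t. u (Suc t) - u t)"
    by (intro summable_comparison_test'[OF summable_geometric, of "1 / 4" N]) auto
  then have "convergent (\<lambda>n. \<Sum>t<n. u (Suc t) - u t)"
    by (simp add: summable_iff_convergent)
  then have "convergent (\<lambda>n. u 0 + (\<Sum>t<n. u (Suc t) - u t))"
    by (intro convergent_add convergent_const)
  then show ?thesis by (simp add: sum_lessThan_telescope)
qed

lemma geometric_tail_sum_le: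
  assumes "s \<le> s'" shows "(\<Sum>t\<in>{s..<s'}. (1 / 4) ^ t) \<le> 2 * (1 / 4 :: real) ^ s"
proof -
  have "(\<Sum>t\<in>{s..<s'}. q ^ t) * (1 - q) = q ^ s - q ^ s'" for q :: real
    using assms
  proof (induction s' rule: dec_induct)
    case (step n)
    have "(\<Sum>t\<in>{s..<Suc n}. q ^ t) * (1 - q) = (\<Sum>t\<in>{s..<n}. q ^ t) * (1 - q) + q ^ n * (1 - q)"
      using step by (simp add: distrib_right)
    also have "\<dots> = q ^ s - q ^ Suc n" unfolding step.IH by (simp add: algebra_simps)
    finally show ?case .
  qed simp
  from this[of "1 / 4"]
  have "(\<Sum>t\<in>{s..<s'}. (1 / 4) ^ t) = (4 / 3) * ((1 / 4) ^ s - (1 / 4 :: real) ^ s')"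
    by (simp add: algebra_simps)
  also have "\<dots> \<le> (4 / 3) * (1 / 4) ^ s" by simp
  also have "\<dots> \<le> 2 * (1 / 4) ^ s" by (intro mult_right_mono) auto
  finally show ?thesis .
qed

text \<open>The sequence \<open>P\<close> approaches the infimum so fast that consecutive kernels differ by a summable amount, even
after multiplication of the squared distances by \<open>16\<^sup>t\<close>.\<close>

locale minimising_orbit = orbit_gram +
  fixes c :: real and P :: "nat \<Rightarrow> nat \<Rightarrow> real"
  assumes c_le: "\<And>w. w \<in> convex_weights \<Longrightarrow> c \<le> bform \<Gamma> w w"
    and P: "\<And>s. P s \<in> convex_weights"
    and P_near: "\<And>s. bform \<Gamma> (P s) (P s) < c + (1 / 64) ^ s"
begin

lemma fsupp_P: "fsupp (P s)"
  by (rule convex_weights_fsupp[OF P])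

definition d :: "nat \<Rightarrow> 'a \<Rightarrow> real" where "d t x = qdist (S x) (P t) (P (Suc t))"

definition \<theta> :: "'a \<Rightarrow> real" where "\<theta> x = lim (\<lambda>s. \<Theta> 0 (P s) x)"

text \<open>The bound is imposed on all later steps at once, so that one set serves every precision \<open>\<delta>\<close> in the
definition of almost periodicity. Almost every point lies in \<open>good s\<close> for large \<open>s\<close>.\<close>

definition good :: "nat \<Rightarrow> 'a set" where
  "good s0 = {x \<in> space M. \<forall>t\<ge>s0. d t x \<le> (1 / 16) ^ t}"

lemma P_close: "qdist \<Gamma> (P s) (P t) \<le> 2 * (1 / 64) ^ s + 2 * (1 / 64) ^ t"
  using near_minimisers_close[OF \<Gamma>_psd P P c_le, of s t] P_near[of s] P_near[of t] by simp

lemma P_shift_close: "qdist \<Gamma> (shift n (P s)) (P s) \<le> 4 * (1 / 64) ^ s"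
proof -
  have "bform \<Gamma> (shift n (P s)) (shift n (P s)) = bform \<Gamma> (P s) (P s)"
    using bform_shift[OF fsupp_P fsupp_P] \<Gamma>_stationary by simp
  then show ?thesis
    using near_minimisers_close[OF \<Gamma>_psd convex_weights_shift[OF P] P c_le, of n s s] P_near[of s] by simp
qed

lemma qdist_integrable: "integrable M (\<lambda>x. qdist (S x) p q)"
  by (intro L_infty_integrable L_infty_bform S_L_infty)

lemma qdist_nonneg: "fsupp p \<Longrightarrow> fsupp q \<Longrightarrow> AE x in M. 0 \<le> qdist (S x) p q"
  using S_psd by eventually_elim (simp add: psd_nonneg fsupp_diff)

lemma d_le: "(\<integral>x. d t x \<partial>M) \<le> 4 * (1 / 64) ^ t"
proof -
  have "(\<integral>x. d t x \<partial>M) = qdist \<Gamma> (P t) (P (Suc t))" by (simp add: d_def \<Gamma>_bform)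
  also have "\<dots> \<le> 2 * (1 / 64) ^ t + 2 * (1 / 64) ^ Suc t" by (rule P_close)
  also have "\<dots> \<le> 4 * (1 / 64) ^ t" by simp
  finally show ?thesis .
qed

lemma scaled_geometric: "16 ^ t * (K * (1 / 64) ^ t) = K * (1 / 4 :: real) ^ t"
  by (simp add: power_divide field_simps flip: power_mult_distrib)

lemma d_tendsto: "AE x in M. (\<lambda>t. 16 ^ t * d t x) \<longlonglongrightarrow> 0"
proof -
  have "AE x in M. summable (\<lambda>t. 16 ^ t * d t x)"
  proof (rule AE_summable_of_integrals)
    show "integrable M (\<lambda>x. 16 ^ t * d t x)" for t
      unfolding d_def by (intro integrable_mult_right qdist_integrable)
    show "AE x in M. 0 \<le> 16 ^ t * d t x" for t
      using qdist_nonneg[OF fsupp_P fsupp_P, of t "Suc t"] unfolding d_def by eventually_elim simp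
    show "(\<integral>x. 16 ^ t * d t x \<partial>M) \<le> 4 * (1 / 4) ^ t" for t
      using mult_left_mono[OF d_le[of t], of "16 ^ t"] scaled_geometric[of t 4] by simp
  qed (intro summable_mult summable_geometric, simp)
  then show ?thesis by eventually_elim (rule summable_LIMSEQ_zero)
qed

lemma shift_tendsto: "AE x in M. \<forall>n. (\<lambda>s. qdist (S x) (shift n (P s)) (P s)) \<longlonglongrightarrow> 0"
proof -
  have "AE x in M. summable (\<lambda>s. qdist (S x) (shift n (P s)) (P s))" for n
  proof (rule AE_summable_of_integrals)
    show "(\<integral>x. qdist (S x) (shift n (P s)) (P s) \<partial>M) \<le> 4 * (1 / 64) ^ s" for s
      using P_shift_close by (simp add: \<Gamma>_bform)
  qed (intro qdist_integrable qdist_nonneg fsupp_shift fsupp_P summable_mult summable_geometric; simp)+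
  then have "AE x in M. \<forall>n. summable (\<lambda>s. qdist (S x) (shift n (P s)) (P s))"
    by (simp add: AE_all_countable)
  then show ?thesis by eventually_elim (blast intro: summable_LIMSEQ_zero)
qed

text \<open>The operator norm is at most the Hilbert-Schmidt norm, for which \<open>P\<close> is a Cauchy sequence.\<close>

lemma \<Theta>_P_close: "(\<integral>x. (\<Theta> 0 (P s) x - \<Theta> 0 (P t) x)\<^sup>2 \<partial>M) \<le> C\<^sup>2 * (2 * (1 / 64) ^ s + 2 * (1 / 64) ^ t)"
proof -
  let ?p = "\<lambda>r. P s r - P t r"
  have fp: "fsupp ?p" by (intro fsupp_diff fsupp_P)
  have i: "integrable M (\<lambda>x. (\<Theta> 0 ?p x)\<^sup>2)" by (intro L_infty_integrable L_infty_power2 \<Theta>_L_infty)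
  have "(\<integral>x. (\<Theta> 0 (P s) x - \<Theta> 0 (P t) x)\<^sup>2 \<partial>M) = (\<integral>x. E (\<lambda>x. (\<Theta> 0 ?p x)\<^sup>2) x \<partial>M)"
    using E_integral[OF i] by (simp add: \<Theta>_diff fsupp_P)
  also have "\<dots> \<le> (\<integral>x. C\<^sup>2 * bform (S x) ?p ?p \<partial>M)"
    by (intro integral_mono_AE E_integrable i E_\<Theta>_square_le fp integrable_mult_right qdist_integrable)
  also have "\<dots> = C\<^sup>2 * qdist \<Gamma> (P s) (P t)" by (simp add: \<Gamma>_bform)
  also have "\<dots> \<le> C\<^sup>2 * (2 * (1 / 64) ^ s + 2 * (1 / 64) ^ t)" by (intro mult_left_mono P_close) simp
  finally show ?thesis .
qed

lemma \<theta>_lim: "AE x in M. (\<lambda>s. \<Theta> 0 (P s) x) \<longlonglongrightarrow> \<theta> x"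
proof -
  have "AE x in M. summable (\<lambda>t. 16 ^ t * (\<Theta> 0 (P (Suc t)) x - \<Theta> 0 (P t) x)\<^sup>2)"
  proof (rule AE_summable_of_integrals)
    show "integrable M (\<lambda>x. 16 ^ t * (\<Theta> 0 (P (Suc t)) x - \<Theta> 0 (P t) x)\<^sup>2)" for t
      by (intro L_infty_integrable L_infty_cmult L_infty_power2 L_infty_diff \<Theta>_L_infty)
    show "(\<integral>x. 16 ^ t * (\<Theta> 0 (P (Suc t)) x - \<Theta> 0 (P t) x)\<^sup>2 \<partial>M) \<le> 4 * C\<^sup>2 * (1 / 4) ^ t" for t
    proof -
      have "(\<integral>x. 16 ^ t * (\<Theta> 0 (P (Suc t)) x - \<Theta> 0 (P t) x)\<^sup>2 \<partial>M)
          \<le> 16 ^ t * (C\<^sup>2 * (2 * (1 / 64) ^ Suc t + 2 * (1 / 64) ^ t))"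
        using \<Theta>_P_close[of "Suc t" t] by simp
      also have "\<dots> \<le> 16 ^ t * (C\<^sup>2 * (4 * (1 / 64) ^ t))"
        by (intro mult_left_mono) auto
      also have "\<dots> = 4 * C\<^sup>2 * (1 / 4) ^ t" using scaled_geometric[of t "4 * C\<^sup>2"] by (simp add: mult_ac)
      finally show ?thesis .
    qed
  qed (auto intro: summable_mult summable_geometric)
  then show ?thesis
  proof eventually_elim
    case (elim x)
    then have "convergent (\<lambda>s. \<Theta> 0 (P s) x)"
      by (intro convergent_of_square_steps summable_LIMSEQ_zero)
    then show ?case by (simp add: \<theta>_def convergent_LIMSEQ_iff)
  qed
qed

lemma \<Theta>_bounded: "AE x in M. \<forall>s. \<bar>\<Theta> 0 (P s) x\<bar> \<le> C ^ 3"
  using G_bound fT_bound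
proof eventually_elim
  case (elim x)
  show ?case
  proof
    fix s
    show "\<bar>\<Theta> 0 (P s) x\<bar> \<le> C ^ 3" unfolding \<Theta>_def
    proof (rule convex_weights_abs_le[OF P])
      fix r
      have "\<bar>G 0 r x\<bar> * \<bar>fT r x\<bar> \<le> C\<^sup>2 * C" using elim C_pos by (intro mult_mono) auto
      then show "\<bar>G 0 r x * fT r x\<bar> \<le> C ^ 3" by (simp add: abs_mult power2_eq_square power3_eq_cube)
    qed
  qed
qed

lemma \<theta>_measurable [measurable]: "\<theta> \<in> borel_measurable M"
  unfolding \<theta>_def by (rule borel_measurable_lim_metric) (rule L_infty_measurable[OF \<Theta>_L_infty])

lemma \<theta>_bounded: "AE x in M. \<bar>\<theta> x\<bar> \<le> C ^ 3"
  using \<Theta>_bounded \<theta>_lim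
proof eventually_elim
  case (elim x)
  show ?case by (rule LIMSEQ_le_const2[OF tendsto_rabs[OF elim(2)]]) (use elim(1) in auto)
qed

lemma \<theta>_L_infty: "\<theta> \<in> L_infty M"
  by (rule L_inftyI[OF \<theta>_measurable \<theta>_bounded])

text \<open>Pass to the limit \<open>t \<rightarrow> \<infinity>\<close> in the estimate for \<open>\<Theta> 0 (P t) - \<Theta> 0 (P s)\<close>.\<close>

lemma \<theta>_close: "(\<integral>x. (\<theta> x - \<Theta> 0 (P s) x)\<^sup>2 \<partial>M) \<le> 4 * C\<^sup>2 * (1 / 64) ^ s"
proof (rule LIMSEQ_le_const2)
  show "(\<lambda>t. \<integral>x. (\<Theta> 0 (P t) x - \<Theta> 0 (P s) x)\<^sup>2 \<partial>M) \<longlonglongrightarrow> (\<integral>x. (\<theta> x - \<Theta> 0 (P s) x)\<^sup>2 \<partial>M)"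
  proof (rule integral_dominated_convergence[where w = "\<lambda>_. (2 * C ^ 3)\<^sup>2"])
    show "AE x in M. (\<lambda>t. (\<Theta> 0 (P t) x - \<Theta> 0 (P s) x)\<^sup>2) \<longlonglongrightarrow> (\<theta> x - \<Theta> 0 (P s) x)\<^sup>2"
      using \<theta>_lim by eventually_elim (intro tendsto_intros)
    show "AE x in M. norm ((\<Theta> 0 (P t) x - \<Theta> 0 (P s) x)\<^sup>2) \<le> (2 * C ^ 3)\<^sup>2" for t
      using \<Theta>_bounded
    proof eventually_elim
      case (elim x)
      have "\<bar>\<Theta> 0 (P t) x - \<Theta> 0 (P s) x\<bar> \<le> 2 * C ^ 3" using elim[rule_format, of s] elim[rule_format, of t] by linarith
      then have "\<bar>\<Theta> 0 (P t) x - \<Theta> 0 (P s) x\<bar>\<^sup>2 \<le> (2 * C ^ 3)\<^sup>2" by (intro power_mono) auto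
      then show ?case by simp
    qed
  qed (use L_infty_measurable[OF \<Theta>_L_infty] in auto)
  show "\<exists>N. \<forall>t\<ge>N. (\<integral>x. (\<Theta> 0 (P t) x - \<Theta> 0 (P s) x)\<^sup>2 \<partial>M) \<le> 4 * C\<^sup>2 * (1 / 64) ^ s"
  proof (intro exI allI impI)
    fix t assume "t \<ge> s"
    then have "(1 / 64 :: real) ^ t \<le> (1 / 64) ^ s" by (intro power_decreasing) auto
    then have "C\<^sup>2 * (2 * (1 / 64) ^ t + 2 * (1 / 64) ^ s) \<le> C\<^sup>2 * (4 * (1 / 64) ^ s)"
      by (intro mult_left_mono) auto
    then show "(\<integral>x. (\<Theta> 0 (P t) x - \<Theta> 0 (P s) x)\<^sup>2 \<partial>M) \<le> 4 * C\<^sup>2 * (1 / 64) ^ s"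
      using \<Theta>_P_close[of t s] by simp
  qed
qed

lemma E_\<theta>_tendsto: "AE x in M. (\<lambda>s. E (\<lambda>x. (\<theta> x - \<Theta> 0 (P s) x)\<^sup>2) x) \<longlonglongrightarrow> 0"
proof -
  have i: "integrable M (\<lambda>x. (\<theta> x - \<Theta> 0 (P s) x)\<^sup>2)" for s
    by (intro L_infty_integrable L_infty_power2 L_infty_diff \<theta>_L_infty \<Theta>_L_infty)
  have "AE x in M. summable (\<lambda>s. E (\<lambda>x. (\<theta> x - \<Theta> 0 (P s) x)\<^sup>2) x)"
  proof (rule AE_summable_of_integrals)
    show "integrable M (E (\<lambda>x. (\<theta> x - \<Theta> 0 (P s) x)\<^sup>2))" for s using i by (rule E_integrable)
    show "AE x in M. 0 \<le> E (\<lambda>x. (\<theta> x - \<Theta> 0 (P s) x)\<^sup>2) x" for s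
      using i by (intro E_nonneg) auto
    show "(\<integral>x. E (\<lambda>x. (\<theta> x - \<Theta> 0 (P s) x)\<^sup>2) x \<partial>M) \<le> 4 * C\<^sup>2 * (1 / 64) ^ s" for s
      using \<theta>_close E_integral[OF i] by simp
  qed (intro summable_mult summable_geometric, simp)
  then show ?thesis by eventually_elim (rule summable_LIMSEQ_zero)
qed

lemma good_sets: "good s0 \<in> sets \<F>"
proof -
  have m: "d t \<in> borel_measurable \<F>" for t
    unfolding d_def by (intro borel_measurable_bform) measurable
  have "{x \<in> space \<F>. \<forall>t. t \<ge> s0 \<longrightarrow> d t x \<le> (1 / 16) ^ t} \<in> sets \<F>"
    using m by measurable
  then show ?thesis unfolding good_def space_\<F> .
qed

text \<open>On a good fibre the kernels of \<open>P s\<close> converge geometrically in Hilbert-Schmidt norm to a kernel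
  that is invariant under \<open>T\<close>, so \<open>\<theta> \<circ> T\<^sup>n\<close> is near \<open>\<Theta> n (P s)\<close> for all \<open>n\<close> at once.\<close>

lemma good_approx:
  assumes s: "s0 \<le> s"
  shows "AE x in M. x \<in> good s0 \<longrightarrow> E (\<lambda>x. (\<theta> ((T ^^ n) x) - \<Theta> n (P s) x)\<^sup>2) x \<le> 8 * C\<^sup>2 * (1 / 16) ^ s"
proof -
  have L: "(\<lambda>x. \<theta> ((T ^^ n) x)) \<in> L2 M" "(\<lambda>x. \<Theta> 0 (P t) ((T ^^ n) x)) \<in> L2 M" "\<Theta> n p \<in> L2 M" for t p
    by (intro L_infty_L2 L_infty_Tn \<theta>_L_infty \<Theta>_L_infty)+
  have 1: "AE x in M. \<forall>t. E (\<lambda>x. (\<theta> ((T ^^ n) x) - \<Theta> n (P s) x)\<^sup>2) x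
      \<le> 2 * E (\<lambda>x. (\<theta> ((T ^^ n) x) - \<Theta> 0 (P t) ((T ^^ n) x))\<^sup>2) x
        + 2 * E (\<lambda>x. (\<Theta> 0 (P t) ((T ^^ n) x) - \<Theta> n (P s) x)\<^sup>2) x"
  proof (subst AE_all_countable, rule allI)
    fix t
    have "AE x in M. E (\<lambda>x. (\<theta> ((T ^^ n) x) - \<Theta> 0 (P t) ((T ^^ n) x) + (\<Theta> 0 (P t) ((T ^^ n) x) - \<Theta> n (P s) x))\<^sup>2) x
      \<le> 2 * E (\<lambda>x. (\<theta> ((T ^^ n) x) - \<Theta> 0 (P t) ((T ^^ n) x))\<^sup>2) x
        + 2 * E (\<lambda>x. (\<Theta> 0 (P t) ((T ^^ n) x) - \<Theta> n (P s) x)\<^sup>2) x"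
      by (intro E_square_add_le L2_diff L)
    then show "AE x in M. E (\<lambda>x. (\<theta> ((T ^^ n) x) - \<Theta> n (P s) x)\<^sup>2) x
      \<le> 2 * E (\<lambda>x. (\<theta> ((T ^^ n) x) - \<Theta> 0 (P t) ((T ^^ n) x))\<^sup>2) x
        + 2 * E (\<lambda>x. (\<Theta> 0 (P t) ((T ^^ n) x) - \<Theta> n (P s) x)\<^sup>2) x" by simp
  qed
  have 2: "AE x in M. \<forall>t. E (\<lambda>x. (\<theta> ((T ^^ n) x) - \<Theta> 0 (P t) ((T ^^ n) x))\<^sup>2) x
      = E (\<lambda>x. (\<theta> x - \<Theta> 0 (P t) x)\<^sup>2) ((T ^^ n) x)"
    by (subst AE_all_countable)
      (intro allI equivariant_Tn[where F = "\<lambda>x. (\<theta> x - \<Theta> 0 (P _) x)\<^sup>2"] eqv L_infty_power2 L_infty_diff \<theta>_L_infty \<Theta>_L_infty)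
  have 3: "AE x in M. \<forall>t. E (\<lambda>x. (\<Theta> 0 (P t) ((T ^^ n) x) - \<Theta> n (P s) x)\<^sup>2) x
      \<le> C\<^sup>2 * qdist (S x) (shift n (P t)) (P s)"
  proof (subst AE_all_countable, rule allI)
    fix t
    let ?p = "\<lambda>r. shift n (P t) r - P s r"
    have "AE x in M. (\<Theta> 0 (P t) ((T ^^ n) x) - \<Theta> n (P s) x)\<^sup>2 = (\<Theta> n ?p x)\<^sup>2"
      using \<Theta>_shift[OF fsupp_P, of t n] by eventually_elim (simp add: \<Theta>_diff fsupp_shift fsupp_P)
    then have "AE x in M. E (\<lambda>x. (\<Theta> 0 (P t) ((T ^^ n) x) - \<Theta> n (P s) x)\<^sup>2) x = E (\<lambda>x. (\<Theta> n ?p x)\<^sup>2) x"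
      by (intro E_cong L_infty_measurable L_infty_power2 L_infty_diff \<Theta>_L_infty L_infty_Tn)
    with E_\<Theta>_square_le[OF fsupp_diff[OF fsupp_shift[OF fsupp_P] fsupp_P], of n n t s]
    show "AE x in M. E (\<lambda>x. (\<Theta> 0 (P t) ((T ^^ n) x) - \<Theta> n (P s) x)\<^sup>2) x
      \<le> C\<^sup>2 * qdist (S x) (shift n (P t)) (P s)"
      by eventually_elim simp
  qed
  show ?thesis
    using 1 2 3 AE_Tn[OF E_\<theta>_tendsto, of n] shift_tendsto S_psd
  proof eventually_elim
    case (elim x)
    show ?case
    proof
      assume x: "x \<in> good s0"
      define a where "a t = E (\<lambda>x. (\<theta> x - \<Theta> 0 (P t) x)\<^sup>2) ((T ^^ n) x)" for t
      define b where "b t = sqrt (qdist (S x) (shift n (P t)) (P t))" for t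
      \<comment> \<open>\<open>a t\<close> accounts for \<open>\<theta>\<close> not being \<open>\<Theta> 0 (P t)\<close>, \<open>b t\<close> for \<open>P t\<close> not being invariant; both vanish in the limit.\<close>
      have bound: "E (\<lambda>x. (\<theta> ((T ^^ n) x) - \<Theta> n (P s) x)\<^sup>2) x \<le> 2 * a t + 2 * (C\<^sup>2 * (b t + 2 * (1 / 4) ^ s)\<^sup>2)"
        if t: "t \<ge> s" for t
      proof -
        have "sqrt (qdist (S x) (P s) (P t)) \<le> (\<Sum>u\<in>{s..<t}. sqrt (d u x))"
          unfolding d_def by (rule qdist_chain[OF elim(6) fsupp_P t])
        also have "\<dots> \<le> (\<Sum>u\<in>{s..<t}. (1 / 4) ^ u)"
        proof (rule sum_mono)
          fix u assume "u \<in> {s..<t}"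
          then have "d u x \<le> (1 / 16) ^ u" using x s by (auto simp: good_def)
          also have "(1 / 16 :: real) ^ u = ((1 / 4) ^ u)\<^sup>2"
            by (simp add: power2_eq_square flip: power_mult_distrib)
          finally show "sqrt (d u x) \<le> (1 / 4) ^ u" by (intro real_le_lsqrt) auto
        qed
        also have "\<dots> \<le> 2 * (1 / 4) ^ s" by (rule geometric_tail_sum_le[OF t])
        finally have 4: "sqrt (qdist (S x) (P s) (P t)) \<le> 2 * (1 / 4) ^ s" .
        have "qdist (S x) (P t) (P s) = qdist (S x) (P s) (P t)"
        proof -
          have f: "fsupp (\<lambda>r. P s r - P t r)" by (intro fsupp_diff fsupp_P)
          have "(\<lambda>r. P t r - P s r) = (\<lambda>r. -1 * (P s r - P t r))" by auto
          then show ?thesis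
            using f fsupp_scale[OF f, of "\<lambda>_. -1"]
            by (simp only: bform_scale_left bform_scale_right)
        qed
        then have "sqrt (qdist (S x) (shift n (P t)) (P s)) \<le> b t + 2 * (1 / 4) ^ s"
          using qdist_triangle[OF elim(6) fsupp_shift[OF fsupp_P[of t]] fsupp_P[of t] fsupp_P[of s], of n] 4 by (simp add: b_def)
        moreover have nn: "0 \<le> qdist (S x) (shift n (P t)) (P s)"
          by (intro psd_nonneg elim(6) fsupp_diff fsupp_shift fsupp_P)
        ultimately have "(sqrt (qdist (S x) (shift n (P t)) (P s)))\<^sup>2 \<le> (b t + 2 * (1 / 4) ^ s)\<^sup>2"
          by (intro power_mono) auto
        then have "C\<^sup>2 * qdist (S x) (shift n (P t)) (P s) \<le> C\<^sup>2 * (b t + 2 * (1 / 4) ^ s)\<^sup>2"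
          using nn by (intro mult_left_mono) auto
        then show ?thesis
          using elim(1)[rule_format, of t] elim(2)[rule_format, of t] elim(3)[rule_format, of t]
          unfolding a_def by linarith
      qed
      have "(\<lambda>t. 2 * a t + 2 * (C\<^sup>2 * (b t + 2 * (1 / 4) ^ s)\<^sup>2)) \<longlonglongrightarrow> 2 * 0 + 2 * (C\<^sup>2 * (sqrt 0 + 2 * (1 / 4) ^ s)\<^sup>2)"
        unfolding a_def b_def by (intro tendsto_intros elim(4) elim(5)[rule_format])
      also have "2 * 0 + 2 * (C\<^sup>2 * (sqrt 0 + 2 * (1 / 4) ^ s)\<^sup>2) = 8 * C\<^sup>2 * (1 / 16) ^ s"
        by (simp add: power2_eq_square flip: power_mult_distrib)
      finally have lim: "(\<lambda>t. 2 * a t + 2 * (C\<^sup>2 * (b t + 2 * (1 / 4) ^ s)\<^sup>2)) \<longlonglongrightarrow> 8 * C\<^sup>2 * (1 / 16) ^ s" .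
      show "E (\<lambda>x. (\<theta> ((T ^^ n) x) - \<Theta> n (P s) x)\<^sup>2) x \<le> 8 * C\<^sup>2 * (1 / 16) ^ s"
        using bound by (intro LIMSEQ_le_const[OF lim]) auto
    qed
  qed
qed

text \<open>Combine \<open>good_approx\<close>, which is uniform in \<open>n\<close>, with a finite net for the functions \<open>\<Theta> n (P s)\<close>.\<close>

lemma AP_good: "AP (\<lambda>x. indicat_real (good s0) x * \<theta> x)"
proof (rule AP_cutoff[OF eqv good_sets \<theta>_L_infty])
  fix \<delta> :: real assume \<delta>: "\<delta> > 0"
  have "(\<lambda>s. 8 * C\<^sup>2 * (1 / 16) ^ s) \<longlonglongrightarrow> 8 * C\<^sup>2 * 0"
    by (intro tendsto_intros LIMSEQ_realpow_zero) auto
  then have "eventually (\<lambda>s. 8 * C\<^sup>2 * (1 / 16) ^ s < \<delta> / 4) sequentially"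
    using \<delta> by (intro order_tendstoD(2)) auto
  then obtain s1 where s1: "\<And>s. s \<ge> s1 \<Longrightarrow> 8 * C\<^sup>2 * (1 / 16) ^ s < \<delta> / 4"
    by (auto simp: eventually_sequentially)
  define s where "s = max s0 s1"
  have s: "s0 \<le> s" "8 * C\<^sup>2 * (1 / 16) ^ s < \<delta> / 4" using s1[of s] by (auto simp: s_def)
  have "\<delta> / 8 > 0" using \<delta> by simp
  then obtain H where H: "finite H" "H \<subseteq> L_infty M"
    "\<And>n. AE x in M. \<exists>h\<in>H. E (\<lambda>x. (\<Theta> n (P s) x - h x)\<^sup>2) x \<le> \<delta> / 8"
    using \<Theta>_finite_net[OF P, of "\<delta> / 8" s] by blast
  have "AE x in M. x \<in> good s0 \<longrightarrow> (\<exists>g\<in>H. E (\<lambda>x. (\<theta> ((T ^^ n) x) - g x)\<^sup>2) x < \<delta>)" for n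
  proof -
    have "AE x in M. \<forall>h\<in>H. E (\<lambda>x. (\<theta> ((T ^^ n) x) - \<Theta> n (P s) x + (\<Theta> n (P s) x - h x))\<^sup>2) x
        \<le> 2 * E (\<lambda>x. (\<theta> ((T ^^ n) x) - \<Theta> n (P s) x)\<^sup>2) x + 2 * E (\<lambda>x. (\<Theta> n (P s) x - h x)\<^sup>2) x"
      using H(2) by (intro AE_finite_allI H(1) E_square_add_le L2_diff L_infty_L2 L_infty_Tn \<theta>_L_infty \<Theta>_L_infty) auto
    then show ?thesis using H(3)[of n] good_approx[OF s(1), of n]
    proof eventually_elim
      case (elim x)
      show ?case
      proof
        assume "x \<in> good s0"
        then have 1: "E (\<lambda>x. (\<theta> ((T ^^ n) x) - \<Theta> n (P s) x)\<^sup>2) x < \<delta> / 4" using elim(3) s(2) by auto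
        obtain h where h: "h \<in> H" "E (\<lambda>x. (\<Theta> n (P s) x - h x)\<^sup>2) x \<le> \<delta> / 8" using elim(2) by blast
        have "E (\<lambda>x. (\<theta> ((T ^^ n) x) - h x)\<^sup>2) x < \<delta>" using elim(1)[rule_format, OF h(1)] h(2) 1 \<delta> by simp
        then show "\<exists>g\<in>H. E (\<lambda>x. (\<theta> ((T ^^ n) x) - g x)\<^sup>2) x < \<delta>" using h(1) by blast
      qed
    qed
  qed
  then show "\<exists>G. finite G \<and> G \<subseteq> L_infty M \<and>
      (\<forall>n. AE x in M. x \<in> good s0 \<longrightarrow> (\<exists>g\<in>G. E (\<lambda>x. (\<theta> ((T ^^ n) x) - g x)\<^sup>2) x < \<delta>))"
    using H(1,2) by blast
qed

lemma integral_f_\<Theta>: "fsupp p \<Longrightarrow> (\<integral>x. f x * \<Theta> 0 p x \<partial>M) = bform \<Gamma> (unit_vec 0) p"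
proof -
  assume p: "fsupp p"
  have "(\<integral>x. f x * \<Theta> 0 p x \<partial>M) = (\<integral>x. lin_comb p (\<lambda>r. G 0 r x * (fT 0 x * fT r x)) \<partial>M)"
    by (simp add: \<Theta>_def fT_def mult_ac flip: lin_comb_scale_right)
  also have "\<dots> = lin_comb p (\<lambda>r. \<integral>x. G 0 r x * (fT 0 x * fT r x) \<partial>M)"
    by (rule integral_lin_comb) (intro L_infty_integrable L_infty_mult G_L_infty fT_L_infty)
  also have "\<dots> = lin_comb p (\<Gamma> 0)"
  proof (rule lin_comb_cong)
    fix r
    have "(\<integral>x. G 0 r x * E (\<lambda>x. fT 0 x * fT r x) x \<partial>M) = (\<integral>x. G 0 r x * (fT 0 x * fT r x) \<partial>M)"
      by (intro E_intg L_infty_integrable L_infty_measurable L_infty_mult G_L_infty fT_L_infty) simp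
    then show "(\<integral>x. G 0 r x * (fT 0 x * fT r x) \<partial>M) = \<Gamma> 0 r"
      by (simp add: \<Gamma>_def power2_eq_square flip: G_def)
  qed
  finally show ?thesis by (simp add: bform_unit_vec_left)
qed

text \<open>By \<open>integral_f_\<Theta>\<close>, orthogonality of \<open>f\<close> to \<open>\<theta>\<close> says that the limit kernel is orthogonal to \<open>f \<otimes> f\<close>.\<close>

lemma minimum_le_zero:
  assumes orth: "\<And>\<psi>. AP \<psi> \<Longrightarrow> \<psi> \<in> L_infty M \<Longrightarrow> (\<integral>x. f x * \<psi> x \<partial>M) = 0"
  shows "c \<le> 0"
proof -
  have good1: "AE x in M. (\<lambda>s. indicat_real (good s) x) \<longlonglongrightarrow> 1"
    using d_tendsto AE_space
  proof eventually_elim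
    case (elim x)
    have "eventually (\<lambda>t. 16 ^ t * d t x < 1) sequentially" by (rule order_tendstoD(2)[OF elim(1)]) simp
    then obtain N where N: "\<And>t. t \<ge> N \<Longrightarrow> 16 ^ t * d t x < 1" by (auto simp: eventually_sequentially)
    have "x \<in> good s" if "s \<ge> N" for s
      unfolding good_def using elim(2) N that
      by (auto simp: power_divide pos_le_divide_eq mult.commute intro!: less_imp_le)
    then have "\<forall>s\<ge>N. indicat_real (good s) x = 1" by simp
    then show ?case by (intro tendsto_eventually) (auto simp: eventually_sequentially)
  qed
  have bd: "AE x in M. \<bar>f x * \<theta> x\<bar> \<le> C * C ^ 3"
    using f_bound \<theta>_bounded by eventually_elim (auto simp: abs_mult intro!: mult_mono order_trans[OF abs_ge_zero])
  have gm: "good s \<in> sets M" for s by (rule sets_\<F>_M[OF good_sets])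
  have "(\<lambda>s. \<integral>x. f x * (indicat_real (good s) x * \<theta> x) \<partial>M) \<longlonglongrightarrow> (\<integral>x. f x * (1 * \<theta> x) \<partial>M)"
  proof (rule integral_dominated_convergence[where w = "\<lambda>_. C * C ^ 3"])
    show "AE x in M. (\<lambda>s. f x * (indicat_real (good s) x * \<theta> x)) \<longlonglongrightarrow> f x * (1 * \<theta> x)"
      using good1 by eventually_elim (intro tendsto_intros)
    show "AE x in M. norm (f x * (indicat_real (good s) x * \<theta> x)) \<le> C * C ^ 3" for s
      using bd by eventually_elim (use C_pos in \<open>auto simp: indicator_def\<close>)
    show "(\<lambda>x. f x * (indicat_real (good s) x * \<theta> x)) \<in> borel_measurable M" for s
      using f_measurable gm[of s] by measurable
  qed (use f_measurable in auto)
  moreover have "(\<integral>x. f x * (indicat_real (good s) x * \<theta> x) \<partial>M) = 0" for s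
    by (intro orth AP_good L_infty_mult L_infty_indicator gm \<theta>_L_infty)
  ultimately have f\<theta>: "(\<integral>x. f x * \<theta> x \<partial>M) = 0" by (simp add: LIMSEQ_const_iff)
  have "(\<lambda>s. \<integral>x. f x * \<Theta> 0 (P s) x \<partial>M) \<longlonglongrightarrow> (\<integral>x. f x * \<theta> x \<partial>M)"
  proof (rule integral_dominated_convergence[where w = "\<lambda>_. C * C ^ 3"])
    show "AE x in M. (\<lambda>s. f x * \<Theta> 0 (P s) x) \<longlonglongrightarrow> f x * \<theta> x"
      using \<theta>_lim by eventually_elim (intro tendsto_intros)
    show "AE x in M. norm (f x * \<Theta> 0 (P s) x) \<le> C * C ^ 3" for s
      using f_bound \<Theta>_bounded by eventually_elim (auto simp: abs_mult intro!: mult_mono order_trans[OF abs_ge_zero])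
  qed (use f_measurable L_infty_measurable[OF \<Theta>_L_infty] in auto)
  then have "(\<lambda>s. bform \<Gamma> (unit_vec 0) (P s)) \<longlonglongrightarrow> 0"
    using f\<theta> by (simp add: integral_f_\<Theta> fsupp_P)
  moreover have "(\<lambda>s. (1 / 64 :: real) ^ s) \<longlonglongrightarrow> 0" by (intro LIMSEQ_realpow_zero) auto
  ultimately show ?thesis
    by (intro stationary_minimum_le_zero[OF \<Gamma>_psd \<Gamma>_stationary c_le P P_near])
qed

end

context system_factor
begin

text \<open>The correlations are the entries \<open>\<Gamma> 0 i\<close>, and by \<open>minimum_le_zero\<close> zero is in the closed convex hull of the
kernels \<open>fT r \<otimes> fT r\<close>.\<close>

lemma correlation_averages_tendsto_zero:
  assumes eqv: "equivariant Y" and f: "f \<in> L_infty M"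
    and orth: "\<And>\<psi>. AP \<psi> \<Longrightarrow> \<psi> \<in> L_infty M \<Longrightarrow> (\<integral>x. f x * \<psi> x \<partial>M) = 0"
  shows "(\<lambda>m. (\<Sum>i<m. \<integral>x. (E (\<lambda>x. f x * f ((T ^^ i) x)) x)\<^sup>2 \<partial>M) / real m) \<longlonglongrightarrow> 0"
proof -
  obtain C where C: "C > 0" "AE x in M. \<bar>f x\<bar> \<le> C" using f by (rule L_inftyE)
  interpret orbit_gram M T Y f C
    by unfold_locales (use C eqv L_infty_measurable[OF f] in auto)
  obtain c P where cP: "\<And>w. w \<in> convex_weights \<Longrightarrow> c \<le> bform \<Gamma> w w" "\<And>s::nat. P s \<in> convex_weights"
    "\<And>s. bform \<Gamma> (P s) (P s) < c + (1 / 64) ^ s"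
    using minimising_sequence[OF \<Gamma>_psd, of "\<lambda>s. (1 / 64) ^ s"] by auto
  interpret minimising_orbit M T Y f C c P
    by unfold_locales (use cP in auto)
  have c0: "c \<le> 0" by (rule minimum_le_zero[OF orth])
  have "(\<lambda>m. (\<Sum>i<m. \<Gamma> 0 i) / real m) \<longlonglongrightarrow> 0"
  proof (rule stationary_averages_tendsto_zero[OF \<Gamma>_psd \<Gamma>_stationary \<Gamma>_bound])
    fix e :: real assume e: "e > 0"
    have "(\<lambda>s. (1 / 64 :: real) ^ s) \<longlonglongrightarrow> 0" by (intro LIMSEQ_realpow_zero) auto
    then have "eventually (\<lambda>s. (1 / 64 :: real) ^ s < e) sequentially" using e by (rule order_tendstoD(2))
    then obtain s where "(1 / 64 :: real) ^ s < e" by (auto simp: eventually_sequentially)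
    then have "bform \<Gamma> (P s) (P s) < e" using P_near[of s] c0 by linarith
    then show "\<exists>w\<in>convex_weights. bform \<Gamma> w w < e" using P by blast
  qed
  then show ?thesis by (simp add: \<Gamma>_def G_def fT_def)
qed

end


section \<open>Averages and van der Corput's inequality\<close>

definition null_average :: "(nat \<Rightarrow> real) \<Rightarrow> bool" where
  "null_average a \<longleftrightarrow> (\<lambda>m. (\<Sum>i<m. a i) / real m) \<longlonglongrightarrow> 0"

lemma null_average_add: "null_average a \<Longrightarrow> null_average b \<Longrightarrow> null_average (\<lambda>i. a i + b i)"
  unfolding null_average_def using tendsto_add[of "\<lambda>m. (\<Sum>i<m. a i) / real m" 0 sequentially "\<lambda>m. (\<Sum>i<m. b i) / real m" 0]
  by (simp add: sum.distrib add_divide_distrib)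

lemma null_average_cmult: "null_average a \<Longrightarrow> null_average (\<lambda>i. c * a i)"
  unfolding null_average_def using tendsto_mult_right_zero[of "\<lambda>m. (\<Sum>i<m. a i) / real m" sequentially c]
  by (simp add: sum_distrib_left)

lemma null_average_zero: "null_average (\<lambda>_. 0)"
  by (simp add: null_average_def)

lemma null_average_sum: "(\<And>j. j \<in> J \<Longrightarrow> null_average (a j)) \<Longrightarrow> null_average (\<lambda>i. \<Sum>j\<in>J. a j i)"
  by (induction J rule: infinite_finite_induct) (auto intro: null_average_zero null_average_add)

lemma null_average_dilate:
  assumes a: "null_average a" "\<And>i. 0 \<le> a i" and D: "D \<ge> 1"
  shows "null_average (\<lambda>i. a (D * i))"
  unfolding null_average_def
proof (rule Lim_null_comparison)
  have "filterlim (\<lambda>m. D * m) at_top sequentially"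
    using D by (intro filterlim_subseq strict_monoI) auto
  then have "(\<lambda>m. (\<Sum>i<D * m. a i) / real (D * m)) \<longlonglongrightarrow> 0"
    using a(1) unfolding null_average_def by (rule filterlim_compose[rotated])
  then have "(\<lambda>m. real D * ((\<Sum>i<D * m. a i) / real (D * m))) \<longlonglongrightarrow> 0"
    by (rule tendsto_mult_right_zero)
  then show "(\<lambda>m. (\<Sum>i<D * m. a i) / real m) \<longlonglongrightarrow> 0" using D by simp
  show "\<forall>\<^sub>F m in sequentially. norm ((\<Sum>i<m. a (D * i)) / real m) \<le> (\<Sum>i<D * m. a i) / real m"
  proof (intro always_eventually allI)
    fix m
    have "(\<Sum>i<m. a (D * i)) = sum a ((\<lambda>i. D * i) ` {..<m})"
      using D by (subst sum.reindex) (auto simp: inj_on_def)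
    also have "\<dots> \<le> (\<Sum>i<D * m. a i)" using D a(2) by (intro sum_mono2) auto
    finally have "(\<Sum>i<m. a (D * i)) \<le> (\<Sum>i<D * m. a i)" .
    moreover have "0 \<le> (\<Sum>i<m. a (D * i))" by (intro sum_nonneg a)
    ultimately show "norm ((\<Sum>i<m. a (D * i)) / real m) \<le> (\<Sum>i<D * m. a i) / real m"
      by (auto intro!: divide_right_mono)
  qed
qed

text \<open>By Cauchy-Schwarz the average of the square roots is at most the square root of the average.\<close>

lemma null_average_sqrt:
  assumes a: "null_average a" "\<And>i. 0 \<le> a i"
  shows "null_average (\<lambda>i. sqrt (a i))"
  unfolding null_average_def
proof (rule Lim_null_comparison)
  have "(\<lambda>m. sqrt ((\<Sum>i<m. a i) / real m)) \<longlonglongrightarrow> sqrt 0"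
    using a(1) unfolding null_average_def by (rule tendsto_real_sqrt)
  then show "(\<lambda>m. sqrt ((\<Sum>i<m. a i) / real m)) \<longlonglongrightarrow> 0" by simp
  show "\<forall>\<^sub>F m in sequentially. norm ((\<Sum>i<m. sqrt (a i)) / real m) \<le> sqrt ((\<Sum>i<m. a i) / real m)"
  proof (intro always_eventually allI)
    fix m :: nat
    have "(\<Sum>i<m. sqrt (a i))\<^sup>2 \<le> (\<Sum>i<m. (sqrt (a i))\<^sup>2) * real m"
      using sum_squared_le_sum_of_squares[of "\<lambda>i. sqrt (a i)" "{..<m}"] by simp
    then have "((\<Sum>i<m. sqrt (a i)) / real m)\<^sup>2 \<le> (\<Sum>i<m. a i) / real m"
      using a(2) by (cases "m = 0") (auto simp: power_divide power2_eq_square divide_simps)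
    then have "(\<Sum>i<m. sqrt (a i)) / real m \<le> sqrt ((\<Sum>i<m. a i) / real m)" by (rule real_le_rsqrt)
    moreover have "0 \<le> (\<Sum>i<m. sqrt (a i)) / real m" using a(2) by (intro divide_nonneg_nonneg sum_nonneg) auto
    ultimately show "norm ((\<Sum>i<m. sqrt (a i)) / real m) \<le> sqrt ((\<Sum>i<m. a i) / real m)" by simp
  qed
qed

lemma sum_rotate:
  "(\<Sum>i\<in>A. \<Sum>r\<in>B. \<Sum>s\<in>C. h i r s) = (\<Sum>r\<in>B. \<Sum>s\<in>C. \<Sum>i\<in>A. h i r s)"
proof -
  have "(\<Sum>i\<in>A. \<Sum>r\<in>B. \<Sum>s\<in>C. h i r s) = (\<Sum>r\<in>B. \<Sum>i\<in>A. \<Sum>s\<in>C. h i r s)"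
    by (rule sum.swap)
  also have "\<dots> = (\<Sum>r\<in>B. \<Sum>s\<in>C. \<Sum>i\<in>A. h i r s)"
    by (rule sum.cong[OF refl], rule sum.swap)
  finally show ?thesis .
qed

abbreviation gap :: "nat \<Rightarrow> nat \<Rightarrow> nat" where "gap r r' \<equiv> (r - r') + (r' - r)"

text \<open>Each value \<open>d < R\<close> occurs at most twice as a distance \<open>gap r r'\<close> from \<open>r\<close>.\<close>

lemma sum_gap_le:
  fixes \<rho> :: "nat \<Rightarrow> real"
  assumes "\<And>d. 0 \<le> \<rho> d" "r < R"
  shows "(\<Sum>r'<R. \<rho> (gap r r')) \<le> 2 * (\<Sum>d<R. \<rho> d)"
proof -
  have "(\<Sum>r'<R. \<rho> (gap r r')) = (\<Sum>r'\<in>{..r}. \<rho> (gap r r')) + (\<Sum>r'\<in>{r<..<R}. \<rho> (gap r r'))"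
    using assms(2) by (subst sum.union_disjoint[symmetric]) (auto intro: sum.cong)
  also have "(\<Sum>r'\<in>{..r}. \<rho> (gap r r')) = sum \<rho> ((\<lambda>r'. r - r') ` {..r})"
    by (subst sum.reindex) (auto simp: inj_on_def)
  also have "\<dots> \<le> (\<Sum>d<R. \<rho> d)" using assms by (intro sum_mono2) auto
  also have "(\<Sum>r'\<in>{r<..<R}. \<rho> (gap r r')) = sum \<rho> ((\<lambda>r'. r' - r) ` {r<..<R})"
    by (subst sum.reindex) (auto simp: inj_on_def)
  also have "\<dots> \<le> (\<Sum>d<R. \<rho> d)" using assms by (intro sum_mono2) auto
  finally show ?thesis by simp
qed

lemma window_sum:
  fixes g :: "nat \<Rightarrow> real"
  assumes "r \<le> R"
  shows "(\<Sum>i<m + R. if r \<le> i \<and> i - r < m then g (i - r) else 0) = (\<Sum>i<m. g i)"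
proof -
  have "(\<Sum>i<m + R. if r \<le> i \<and> i - r < m then g (i - r) else 0) = (\<Sum>i\<in>{r..<m + r}. g (i - r))"
    using assms by (intro sum.mono_neutral_cong_right) auto
  also have "\<dots> = (\<Sum>i<m. g i)"
    using sum.shift_bounds_nat_ivl[of "\<lambda>i. g (i - r)" 0 r m] by (simp add: atLeast0LessThan add.commute)
  finally show ?thesis .
qed

text \<open>Van der Corput's inequality. Replace the sum by its average over \<open>R\<close> shifts (with the family
  continued by zero) before applying Cauchy-Schwarz.\<close>

lemma (in finite_measure) van_der_Corput:
  fixes u :: "nat \<Rightarrow> 'a \<Rightarrow> real"
  assumes u: "\<And>i. u i \<in> L_infty M" and \<kappa>: "\<And>d i. 0 \<le> \<kappa> d i"
    and corr: "\<And>i d. i + d < m \<Longrightarrow> (\<integral>x. u i x * u (i + d) x \<partial>M) \<le> \<kappa> d i"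
  shows "(real R)\<^sup>2 * (\<integral>x. (\<Sum>i<m. u i x)\<^sup>2 \<partial>M)
    \<le> real (m + R) * (\<Sum>r<R. \<Sum>r'<R. \<Sum>i<m. \<kappa> (gap r r') i)"
proof -
  define w where "w i r x = (if r \<le> i \<and> i - r < m then u (i - r) x else 0)" for i r x
  have w: "w i r \<in> L_infty M" for i r
    unfolding w_def by (cases "r \<le> i \<and> i - r < m") (auto intro: u L_infty_const)
  have pw: "(real R)\<^sup>2 * (\<Sum>i<m. u i x)\<^sup>2 \<le> real (m + R) * (\<Sum>i<m + R. \<Sum>r<R. \<Sum>r'<R. w i r x * w i r' x)" for x
  proof -
    have "real R * (\<Sum>i<m. u i x) = (\<Sum>r<R. \<Sum>i<m + R. w i r x)"
      unfolding w_def using window_sum[of _ R m "\<lambda>i. u i x"] by simp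
    also have "\<dots> = (\<Sum>i<m + R. \<Sum>r<R. w i r x)" by (rule sum.swap)
    finally have "(real R)\<^sup>2 * (\<Sum>i<m. u i x)\<^sup>2 = (\<Sum>i<m + R. \<Sum>r<R. w i r x)\<^sup>2"
      by (simp flip: power_mult_distrib)
    also have "\<dots> \<le> (\<Sum>i<m + R. (\<Sum>r<R. w i r x)\<^sup>2) * real (m + R)"
      using sum_squared_le_sum_of_squares[of "\<lambda>i. \<Sum>r<R. w i r x" "{..<m + R}"] by simp
    also have "(\<Sum>i<m + R. (\<Sum>r<R. w i r x)\<^sup>2) = (\<Sum>i<m + R. \<Sum>r<R. \<Sum>r'<R. w i r x * w i r' x)"
      by (simp add: power2_eq_square sum_product)
    finally show ?thesis by (simp add: mult.commute)
  qed
  have ww: "integrable M (\<lambda>x. w i r x * w i r' x)" for i r r' by (intro L_infty_integrable L_infty_mult w)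
  have summand: "(\<integral>x. w i r x * w i r' x \<partial>M)
      \<le> (if max r r' \<le> i \<and> i - max r r' < m then \<kappa> (gap r r') (i - max r r') else 0)" for i r r'
  proof (cases "(r \<le> i \<and> i - r < m) \<and> (r' \<le> i \<and> i - r' < m)")
    case True
    define j where "j = i - max r r'"
    have j: "max r r' \<le> i" "i - max r r' < m" "j + gap r r' < m" using True by (auto simp: j_def)
    have "(\<integral>x. w i r x * w i r' x \<partial>M) = (\<integral>x. u j x * u (j + gap r r') x \<partial>M)"
    proof (cases "r \<le> r'")
      case True
      then have "i - r' = j" "i - r = j + gap r r'" using j by (auto simp: j_def)
      then show ?thesis using \<open>(r \<le> i \<and> i - r < m) \<and> (r' \<le> i \<and> i - r' < m)\<close> by (simp add: w_def mult.commute)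
    next
      case False
      then have "i - r = j" "i - r' = j + gap r r'" using j by (auto simp: j_def)
      then show ?thesis using \<open>(r \<le> i \<and> i - r < m) \<and> (r' \<le> i \<and> i - r' < m)\<close> by (simp add: w_def)
    qed
    also have "\<dots> \<le> \<kappa> (gap r r') j" by (rule corr[OF j(3)])
    finally show ?thesis using j by (simp add: j_def)
  next
    case False
    then have "(\<lambda>x. w i r x * w i r' x) = (\<lambda>_. 0)" by (auto simp: w_def)
    then show ?thesis using \<kappa> by simp
  qed
  have "(real R)\<^sup>2 * (\<integral>x. (\<Sum>i<m. u i x)\<^sup>2 \<partial>M) = (\<integral>x. (real R)\<^sup>2 * (\<Sum>i<m. u i x)\<^sup>2 \<partial>M)" by simp
  also have "\<dots> \<le> (\<integral>x. real (m + R) * (\<Sum>i<m + R. \<Sum>r<R. \<Sum>r'<R. w i r x * w i r' x) \<partial>M)"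
    by (intro integral_mono pw L_infty_integrable L_infty_mult L_infty_power2 L_infty_sum L_infty_const u w)
  also have "\<dots> = real (m + R) * (\<Sum>i<m + R. \<Sum>r<R. \<Sum>r'<R. \<integral>x. w i r x * w i r' x \<partial>M)"
    using ww by simp
  also have "\<dots> \<le> real (m + R) * (\<Sum>i<m + R. \<Sum>r<R. \<Sum>r'<R.
      if max r r' \<le> i \<and> i - max r r' < m then \<kappa> (gap r r') (i - max r r') else 0)"
    by (intro mult_left_mono sum_mono summand) simp
  also have "(\<Sum>i<m + R. \<Sum>r<R. \<Sum>r'<R. if max r r' \<le> i \<and> i - max r r' < m then \<kappa> (gap r r') (i - max r r') else 0)
     = (\<Sum>r<R. \<Sum>r'<R. \<Sum>i<m + R. if max r r' \<le> i \<and> i - max r r' < m then \<kappa> (gap r r') (i - max r r') else 0)"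
    by (rule sum_rotate)
  also have "\<dots> = (\<Sum>r<R. \<Sum>r'<R. \<Sum>i<m. \<kappa> (gap r r') i)"
    by (intro sum.cong refl window_sum) auto
  finally show ?thesis .
qed

text \<open>First choose \<open>R\<close> so large that the average of \<open>\<rho> (gap r r')\<close> over \<open>r, r' < R\<close> is small, then let \<open>m\<close> tend
to infinity with \<open>R\<close> fixed to dispose of the finitely many \<open>\<xi> (gap r r')\<close>.\<close>

lemma null_average_by_van_der_Corput:
  fixes a :: "nat \<Rightarrow> real"
  assumes a: "\<And>i. 0 \<le> a i" and K: "K \<ge> 0"
    and vdc: "\<And>m R. (real R)\<^sup>2 * (\<Sum>i<m. a i)\<^sup>2 \<le> K * (real (m + R) * (\<Sum>r<R. \<Sum>r'<R. \<Sum>i<m. \<kappa> (gap r r') i))"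
    and \<kappa>: "\<And>d i. \<kappa> d i \<le> \<rho> d + \<xi> d i"
    and \<rho>: "\<And>d. 0 \<le> \<rho> d" "null_average \<rho>" and \<xi>: "\<And>d i. 0 \<le> \<xi> d i" "\<And>d. null_average (\<xi> d)"
  shows "null_average a"
  unfolding null_average_def
proof (rule LIMSEQ_I)
  fix e :: real assume e: "e > 0"
  define \<delta> where "\<delta> = e\<^sup>2 / (4 * (K + 1))"
  have \<delta>: "\<delta> > 0" using e K by (simp add: \<delta>_def)
  have "eventually (\<lambda>R. (\<Sum>d<R. \<rho> d) / real R < \<delta> / 4) sequentially"
    using \<rho>(2) \<delta> unfolding null_average_def by (intro order_tendstoD(2)) auto
  then obtain R0 where R0: "\<And>R. R \<ge> R0 \<Longrightarrow> (\<Sum>d<R. \<rho> d) / real R < \<delta> / 4" by (auto simp: eventually_sequentially)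
  define R where "R = Suc R0"
  have Rp: "real R > 0" by (simp add: R_def)
  have "(\<Sum>d<R. \<rho> d) / real R < \<delta> / 4" using R0[of R] by (simp add: R_def)
  then have R: "(\<Sum>d<R. \<rho> d) < \<delta> / 4 * real R" using Rp by (simp only: pos_divide_less_eq)
  define \<Xi> where "\<Xi> m = (\<Sum>r<R. \<Sum>r'<R. \<Sum>i<m. \<xi> (gap r r') i)" for m
  have "null_average (\<lambda>i. \<Sum>r<R. \<Sum>r'<R. \<xi> (gap r r') i)" by (intro null_average_sum \<xi>)
  moreover have "(\<Sum>i<m. \<Sum>r<R. \<Sum>r'<R. \<xi> (gap r r') i) = \<Xi> m" for m
    unfolding \<Xi>_def by (rule sum_rotate)
  ultimately have "(\<lambda>m. \<Xi> m / real m) \<longlonglongrightarrow> 0" by (simp add: null_average_def)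
  then have "eventually (\<lambda>m. \<Xi> m / real m < \<delta> / 2 * (real R)\<^sup>2) sequentially"
    using \<delta> Rp by (intro order_tendstoD(2)) auto
  then obtain m0 where m0: "\<And>m. m \<ge> m0 \<Longrightarrow> \<Xi> m / real m < \<delta> / 2 * (real R)\<^sup>2" by (auto simp: eventually_sequentially)
  have "norm ((\<Sum>i<m. a i) / real m - 0) < e" if m: "m \<ge> max m0 R" for m
  proof -
    have mp: "real m > 0" using m by (simp add: R_def)
    have "\<Xi> m / real m < \<delta> / 2 * (real R)\<^sup>2" using m0 m by simp
    then have \<Xi>: "\<Xi> m < \<delta> / 2 * (real R)\<^sup>2 * real m" using mp by (simp only: pos_divide_less_eq)
    have "(\<Sum>r<R. \<Sum>r'<R. \<Sum>i<m. \<kappa> (gap r r') i) \<le> (\<Sum>r<R. \<Sum>r'<R. \<Sum>i<m. \<rho> (gap r r') + \<xi> (gap r r') i)"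
      by (intro sum_mono \<kappa>)
    also have "\<dots> = real m * (\<Sum>r<R. \<Sum>r'<R. \<rho> (gap r r')) + \<Xi> m"
      by (simp add: \<Xi>_def sum.distrib sum_distrib_left)
    also have "(\<Sum>r<R. \<Sum>r'<R. \<rho> (gap r r')) \<le> (\<Sum>r<R. 2 * (\<Sum>d<R. \<rho> d))"
      by (intro sum_mono sum_gap_le \<rho>) simp
    also have "(\<Sum>r<R. 2 * (\<Sum>d<R. \<rho> d)) = 2 * real R * (\<Sum>d<R. \<rho> d)" by simp
    also have "\<dots> \<le> 2 * real R * (\<delta> / 4 * real R)" using R Rp by (intro mult_left_mono) auto
    also have "\<dots> = \<delta> / 2 * (real R)\<^sup>2" by (simp add: power2_eq_square)
    finally have "(\<Sum>r<R. \<Sum>r'<R. \<Sum>i<m. \<kappa> (gap r r') i) \<le> real m * (\<delta> / 2 * (real R)\<^sup>2) + \<Xi> m"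
      using mp by (simp add: mult_left_mono)
    then have tot: "(\<Sum>r<R. \<Sum>r'<R. \<Sum>i<m. \<kappa> (gap r r') i) \<le> \<delta> * (real R)\<^sup>2 * real m" using \<Xi> by (simp add: algebra_simps)
    have "(real R)\<^sup>2 * (\<Sum>i<m. a i)\<^sup>2 \<le> K * (real (m + R) * (\<Sum>r<R. \<Sum>r'<R. \<Sum>i<m. \<kappa> (gap r r') i))" by (rule vdc)
    also have "\<dots> \<le> K * (real (m + R) * (\<delta> * (real R)\<^sup>2 * real m))" using tot K by (intro mult_left_mono) auto
    also have "\<dots> \<le> K * ((2 * real m) * (\<delta> * (real R)\<^sup>2 * real m))"
      using m \<delta> K by (intro mult_left_mono mult_right_mono) auto
    also have "\<dots> \<le> (K + 1) * ((2 * real m) * (\<delta> * (real R)\<^sup>2 * real m))"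
      using \<delta> by (intro mult_right_mono) auto
    also have "\<dots> = (real R)\<^sup>2 * ((real m)\<^sup>2 * (e\<^sup>2 / 2))"
      using K by (simp add: \<delta>_def power2_eq_square field_simps)
    finally have "(\<Sum>i<m. a i)\<^sup>2 \<le> (real m)\<^sup>2 * (e\<^sup>2 / 2)" using Rp by simp
    also have "\<dots> < (real m * e)\<^sup>2" using mp e by (simp add: power_mult_distrib)
    finally have "(\<Sum>i<m. a i) < real m * e" by (rule power_less_imp_less_base) (use mp e in simp)
    moreover have "0 \<le> (\<Sum>i<m. a i)" by (intro sum_nonneg a)
    ultimately show ?thesis using mp by (simp add: pos_divide_less_eq mult.commute)
  qed
  then show "\<exists>no. \<forall>m\<ge>no. norm ((\<Sum>i<m. a i) / real m - 0) < e" by blast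
qed

definition (in finite_measure) unit_ball :: "('a \<Rightarrow> real) set" where
  "unit_ball = {f \<in> borel_measurable M. AE x in M. \<bar>f x\<bar> \<le> 1}"

context finite_measure
begin

lemma unit_ball_L_infty: "f \<in> unit_ball \<Longrightarrow> f \<in> L_infty M"
  by (auto simp: unit_ball_def intro: L_inftyI)

lemma unit_ball_AE: "f \<in> unit_ball \<Longrightarrow> AE x in M. \<bar>f x\<bar> \<le> 1"
  by (simp add: unit_ball_def)

lemma unit_ball_mult:
  assumes "f \<in> unit_ball" "g \<in> unit_ball" shows "(\<lambda>x. f x * g x) \<in> unit_ball"
proof -
  have "AE x in M. \<bar>f x * g x\<bar> \<le> 1"
    using assms[THEN unit_ball_AE] by eventually_elim (simp add: abs_mult mult_le_one)
  then show ?thesis using assms by (auto simp: unit_ball_def)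
qed

lemma unit_ball_prod: "(\<And>i. i \<in> I \<Longrightarrow> f i \<in> unit_ball) \<Longrightarrow> (\<lambda>x. \<Prod>i\<in>I. f i x) \<in> unit_ball"
proof (induction I rule: infinite_finite_induct)
  case (insert i I)
  then show ?case using unit_ball_mult[of "f i" "\<lambda>x. \<Prod>i\<in>I. f i x"] by simp
qed (auto simp: unit_ball_def)

lemma unit_ball_square_integral_le:
  assumes "f \<in> unit_ball" shows "(\<integral>x. (f x)\<^sup>2 \<partial>M) \<le> measure M (space M)"
proof -
  have "(\<integral>x. (f x)\<^sup>2 \<partial>M) \<le> (\<integral>x. 1 \<partial>M)"
    by (intro integral_mono_AE L_infty_integrable L_infty_power2 L_infty_const unit_ball_L_infty assms)
      (use unit_ball_AE[OF assms] in \<open>auto elim!: eventually_mono simp: abs_square_le_1\<close>)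
  then show ?thesis by simp
qed

lemma integral_unit_ball_mult_le:
  assumes f: "f \<in> unit_ball" and g: "g \<in> L_infty M"
  shows "(\<integral>x. f x * g x \<partial>M) \<le> (\<integral>x. \<bar>g x\<bar> \<partial>M)" "(\<integral>x. \<bar>f x * g x\<bar> \<partial>M) \<le> (\<integral>x. \<bar>g x\<bar> \<partial>M)"
proof -
  have le: "AE x in M. \<bar>f x * g x\<bar> \<le> \<bar>g x\<bar>"
    using unit_ball_AE[OF f] by eventually_elim (simp add: abs_mult mult_left_le_one_le)
  have i: "integrable M (\<lambda>x. f x * g x)" "integrable M g"
    by (intro L_infty_integrable L_infty_mult unit_ball_L_infty f g)+
  show 2: "(\<integral>x. \<bar>f x * g x\<bar> \<partial>M) \<le> (\<integral>x. \<bar>g x\<bar> \<partial>M)"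
    by (rule integral_mono_AE[OF _ _ le]) (use i in auto)
  show "(\<integral>x. f x * g x \<partial>M) \<le> (\<integral>x. \<bar>g x\<bar> \<partial>M)"
    using integral_abs_bound[of M "\<lambda>x. f x * g x"] 2 by linarith
qed

end

lemma (in measure_preserving_system) unit_ball_Tn: "f \<in> unit_ball \<Longrightarrow> (\<lambda>x. f ((T ^^ n) x)) \<in> unit_ball"
  unfolding unit_ball_def using AE_Tn[of "\<lambda>x. \<bar>f x\<bar> \<le> 1" n] by (auto intro: measurable_compose[OF measurable_Tn])

lemma (in system_factor) unit_ball_E: "f \<in> unit_ball \<Longrightarrow> E f \<in> unit_ball"
  using E_bound[of f 1] unit_ball_L_infty[of f] by (simp add: unit_ball_def)

lemma (in system_factor) integral_abs_E_le:
  assumes "f \<in> L_infty M" shows "(\<integral>x. \<bar>E f x\<bar> \<partial>M) \<le> (\<integral>x. \<bar>f x\<bar> \<partial>M)"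
proof -
  have i: "integrable M f" "integrable M (\<lambda>x. \<bar>f x\<bar>)" using L_infty_integrable[OF assms] by auto
  have "AE x in M. E f x \<le> E (\<lambda>x. \<bar>f x\<bar>) x" by (rule E_mono) (use i in auto)
  moreover have "AE x in M. E (\<lambda>x. -1 * f x) x \<le> E (\<lambda>x. \<bar>f x\<bar>) x" by (rule E_mono) (use i in auto)
  ultimately have "AE x in M. \<bar>E f x\<bar> \<le> E (\<lambda>x. \<bar>f x\<bar>) x" using E_cmult[OF i(1), of "-1"] by eventually_elim auto
  then have "(\<integral>x. \<bar>E f x\<bar> \<partial>M) \<le> (\<integral>x. E (\<lambda>x. \<bar>f x\<bar>) x \<partial>M)"
    by (intro integral_mono_AE E_integrable i integrable_abs)
  then show ?thesis using E_integral[OF i(2)] by simp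
qed


section \<open>Multiple correlations\<close>

abbreviation (in measure_preserving_system) tower :: "('a \<Rightarrow> real) set \<Rightarrow> nat \<Rightarrow> ('a \<Rightarrow> real) set" where
  "tower Y n \<equiv> (max_compact_ext M T ^^ n) Y"

context system_factor
begin

lemma system_factor_tower: "system_factor M T (tower Y n)"
proof (induction n)
  case 0
  show ?case by (simp add: system_factor_axioms)
next
  case (Suc n)
  then show ?case using system_factor.system_factor_Z[OF Suc] by simp
qed

lemma equivariant_tower:
  assumes "equivariant Y" shows "equivariant (tower Y n)"
proof (induction n)
  case (Suc n)
  then show ?case using system_factor.equivariant_Z[OF system_factor_tower, of n] by simp
qed (simp add: assms)

text \<open>The factor \<open>f \<circ> T\<^bsup>bi\<^esup>\<close> is freed from \<open>i\<close> by composing the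
  \<open>i\<close>-th summand with \<open>T\<^bsup>b(m-i)\<^esup>\<close>, which also works if \<open>T\<close> is not invertible; Cauchy-Schwarz
  then removes it.\<close>

lemma remove_one_function:
  fixes a :: "nat \<Rightarrow> nat" and b :: nat and f :: "'a \<Rightarrow> real" and F :: "nat \<Rightarrow> 'a \<Rightarrow> real"
  assumes f: "f \<in> unit_ball" and L: "finite L" and F: "\<And>l. l \<in> L \<Longrightarrow> F l \<in> unit_ball"
  defines "A i \<equiv> (\<integral>x. (E (\<lambda>x. f ((T ^^ (b * i)) x) * (\<Prod>l\<in>L. F l ((T ^^ (a l * i)) x))) x)\<^sup>2 \<partial>M)"
    and "\<kappa> d i \<equiv> (\<integral>x. \<bar>E (\<lambda>x. \<Prod>l\<in>L. F l ((T ^^ (b * d)) ((T ^^ (a l * i)) x))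
        * F l ((T ^^ (a l * d)) ((T ^^ (a l * i)) x))) x\<bar> \<partial>M)"
  shows "(real R)\<^sup>2 * (\<Sum>i<m. A i)\<^sup>2
    \<le> measure M (space M) * (real (m + R) * (\<Sum>r<R. \<Sum>r'<R. \<Sum>i<m. \<kappa> (gap r r') i))"
proof -
  define P where "P i x = (\<Prod>l\<in>L. F l ((T ^^ (a l * i)) x))" for i x
  define h where "h i = E (\<lambda>x. f ((T ^^ (b * i)) x) * P i x)" for i
  define u where "u i x = h i ((T ^^ (b * (m - i))) x) * P i ((T ^^ (b * (m - i))) x)" for i x
  have P: "P i \<in> unit_ball" for i unfolding P_def by (intro unit_ball_prod unit_ball_Tn F)
  have fP: "(\<lambda>x. f ((T ^^ (b * i)) x) * P i x) \<in> unit_ball" for i by (intro unit_ball_mult unit_ball_Tn f P)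
  have h: "h i \<in> unit_ball" for i unfolding h_def by (rule unit_ball_E[OF fP])
  have h\<F>: "h i \<in> borel_measurable \<F>" for i by (simp add: h_def)
  have hP: "(\<lambda>x. h i x * P i x) \<in> unit_ball" for i by (intro unit_ball_mult h P)
  have u: "u i \<in> unit_ball" for i unfolding u_def by (intro unit_ball_mult unit_ball_Tn h P)
  have A: "A i = (\<integral>x. f ((T ^^ (b * m)) x) * u i x \<partial>M)" if i: "i < m" for i
  proof -
    have "A i = (\<integral>x. h i x * E (\<lambda>x. f ((T ^^ (b * i)) x) * P i x) x \<partial>M)"
      by (simp add: A_def h_def P_def power2_eq_square)
    also have "\<dots> = (\<integral>x. h i x * (f ((T ^^ (b * i)) x) * P i x) \<partial>M)"
      by (intro E_intg h\<F> L_infty_measurable L_infty_integrable unit_ball_L_infty unit_ball_mult h fP)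
    also have "\<dots> = (\<integral>x. (\<lambda>x. h i x * (f ((T ^^ (b * i)) x) * P i x)) ((T ^^ (b * (m - i))) x) \<partial>M)"
      by (rule integral_Tn[symmetric]) (intro L_infty_measurable unit_ball_L_infty unit_ball_mult h fP)
    also have "\<dots> = (\<integral>x. f ((T ^^ (b * m)) x) * u i x \<partial>M)"
    proof -
      have "(T ^^ (b * i)) ((T ^^ (b * (m - i))) x) = (T ^^ (b * m)) x" for x
      proof -
        have "b * m = b * i + b * (m - i)" using i by (simp flip: distrib_left)
        then show ?thesis by (simp add: funpow_add)
      qed
      then show ?thesis by (simp add: u_def mult_ac)
    qed
    finally show ?thesis .
  qed
  have sum_u: "(\<lambda>x. \<Sum>i<m. u i x) \<in> L_infty M" by (intro L_infty_sum unit_ball_L_infty u)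
  have "(\<Sum>i<m. A i) = (\<Sum>i<m. \<integral>x. f ((T ^^ (b * m)) x) * u i x \<partial>M)" by (intro sum.cong refl A) simp
  also have "\<dots> = (\<integral>x. f ((T ^^ (b * m)) x) * (\<Sum>i<m. u i x) \<partial>M)"
    unfolding sum_distrib_left
    by (rule Bochner_Integration.integral_sum[symmetric])
      (intro L_infty_integrable L_infty_mult unit_ball_L_infty unit_ball_Tn f u)
  finally have "(\<Sum>i<m. A i)\<^sup>2 \<le> (\<integral>x. (f ((T ^^ (b * m)) x))\<^sup>2 \<partial>M) * (\<integral>x. (\<Sum>i<m. u i x)\<^sup>2 \<partial>M)"
    using L2_cauchy_schwarz[OF L_infty_L2[OF unit_ball_L_infty[OF unit_ball_Tn[OF f, of "b * m"]]] L_infty_L2[OF sum_u]]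
    by simp
  also have "\<dots> \<le> measure M (space M) * (\<integral>x. (\<Sum>i<m. u i x)\<^sup>2 \<partial>M)"
    by (intro mult_right_mono unit_ball_square_integral_le unit_ball_Tn f) simp
  finally have "(real R)\<^sup>2 * (\<Sum>i<m. A i)\<^sup>2 \<le> (real R)\<^sup>2 * (measure M (space M) * (\<integral>x. (\<Sum>i<m. u i x)\<^sup>2 \<partial>M))"
    by (intro mult_left_mono) auto
  also have "\<dots> = measure M (space M) * ((real R)\<^sup>2 * (\<integral>x. (\<Sum>i<m. u i x)\<^sup>2 \<partial>M))" by simp
  also have "\<dots> \<le> measure M (space M) * (real (m + R) * (\<Sum>r<R. \<Sum>r'<R. \<Sum>i<m. \<kappa> (gap r r') i))"
  proof (intro mult_left_mono van_der_Corput unit_ball_L_infty u)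
    show "0 \<le> \<kappa> d i" for d i by (simp add: \<kappa>_def)
    fix i d assume id: "i + d < m"
    let ?Q = "\<lambda>x. \<Prod>l\<in>L. F l ((T ^^ (b * d)) ((T ^^ (a l * i)) x)) * F l ((T ^^ (a l * d)) ((T ^^ (a l * i)) x))"
    let ?H = "\<lambda>x. h i ((T ^^ (b * d)) x) * h (i + d) x"
    have Q: "?Q \<in> unit_ball"
      by (intro unit_ball_prod unit_ball_mult unit_ball_Tn[of "\<lambda>x. F _ ((T ^^ _) x)"] unit_ball_Tn[of "F _"] F)
    have H: "?H \<in> unit_ball" by (intro unit_ball_mult unit_ball_Tn h)
    have H\<F>: "?H \<in> borel_measurable \<F>"
      by (intro borel_measurable_times h\<F> measurable_compose[OF Tn_\<F> h\<F>])
    have PQ: "P i ((T ^^ (b * d)) x) * P (i + d) x = ?Q x" for x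
      unfolding P_def prod.distrib[symmetric]
    proof (intro prod.cong refl arg_cong2[where f = "(*)"] arg_cong[where f = "F _"])
      fix l
      show "(T ^^ (a l * i)) ((T ^^ (b * d)) x) = (T ^^ (b * d)) ((T ^^ (a l * i)) x)"
        by (metis add.commute comp_apply funpow_add)
      show "(T ^^ (a l * (i + d))) x = (T ^^ (a l * d)) ((T ^^ (a l * i)) x)"
        by (metis add.commute comp_apply distrib_left funpow_add)
    qed
    have "b * (m - i) = b * d + b * (m - (i + d))" using id by (simp flip: distrib_left)
    then have "(T ^^ (b * (m - i))) x = (T ^^ (b * d)) ((T ^^ (b * (m - (i + d)))) x)" for x
      by (simp add: funpow_add)
    then have "(\<integral>x. u i x * u (i + d) x \<partial>M)
      = (\<integral>x. (\<lambda>x. (h i ((T ^^ (b * d)) x) * P i ((T ^^ (b * d)) x)) * (h (i + d) x * P (i + d) x)) ((T ^^ (b * (m - (i + d)))) x) \<partial>M)"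
      by (simp add: u_def)
    also have "\<dots> = (\<integral>x. (h i ((T ^^ (b * d)) x) * P i ((T ^^ (b * d)) x)) * (h (i + d) x * P (i + d) x) \<partial>M)"
      by (rule integral_Tn) (intro L_infty_measurable unit_ball_L_infty unit_ball_mult unit_ball_Tn h P)
    also have "\<dots> = (\<integral>x. ?H x * ?Q x \<partial>M)"
    proof (rule Bochner_Integration.integral_cong[OF refl])
      fix x
      have "(h i ((T ^^ (b * d)) x) * P i ((T ^^ (b * d)) x)) * (h (i + d) x * P (i + d) x)
          = ?H x * (P i ((T ^^ (b * d)) x) * P (i + d) x)" by (simp only: mult_ac)
      then show "(h i ((T ^^ (b * d)) x) * P i ((T ^^ (b * d)) x)) * (h (i + d) x * P (i + d) x) = ?H x * ?Q x"
        by (simp only: PQ)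
    qed
    also have "\<dots> = (\<integral>x. ?H x * E ?Q x \<partial>M)"
      by (intro E_intg[symmetric] H\<F> L_infty_measurable L_infty_integrable unit_ball_L_infty unit_ball_mult[OF H Q] Q)
    also have "\<dots> \<le> (\<integral>x. \<bar>E ?Q x\<bar> \<partial>M)"
      by (intro integral_unit_ball_mult_le(1) H E_L_infty unit_ball_L_infty Q)
    finally show "(\<integral>x. u i x * u (i + d) x \<partial>M) \<le> \<kappa> d i" by (simp add: \<kappa>_def)
  qed simp
  finally show ?thesis .
qed

lemma orthogonal_to_factor:
  assumes f: "f \<in> L_infty M" and E0: "AE x in M. E f x = 0" and h: "h \<in> Y"
  shows "(\<integral>x. f x * h x \<partial>M) = 0"
proof -
  have "(\<integral>x. (f x - E f x) * h x \<partial>M) = 0"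
    by (rule cond_exp_projection(2)[OF finite_M factor_Y L_infty_L2[OF f] h])
  moreover have "(\<integral>x. (f x - E f x) * h x \<partial>M) = (\<integral>x. f x * h x \<partial>M)"
    using E0 h factor_iff L_infty_measurable[OF f] L2_measurable
    by (intro integral_cong_AE) (auto elim: eventually_mono)
  ultimately show ?thesis by simp
qed

text \<open>In the inductive step a function \<open>f p\<close> with \<open>p \<noteq> j\<close> is removed. Any such \<open>p\<close> will do because the exponents
are arbitrary distinct numbers; in particular no exponent has to be zero or the largest one. The
products \<open>g d l\<close> that replace the remaining functions have the same exponents \<open>a l\<close>. The projection \<open>e d\<close>
of \<open>g d j\<close> to \<open>tower Y k\<close> contributes \<open>\<rho> d\<close> and what is left of \<open>g d j\<close> contributes \<open>\<xi> d\<close>.\<close>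

lemma multiple_correlation_tendsto_zero:
  fixes a :: "nat \<Rightarrow> nat"
  assumes eqv: "equivariant Y" and "finite L" "card L = Suc k" "inj_on a L" "j \<in> L"
    and "\<And>l. l \<in> L \<Longrightarrow> f l \<in> unit_ball"
    and "AE x in M. cond_exp M (tower Y k) (f j) x = 0"
  shows "null_average (\<lambda>i. \<integral>x. (E (\<lambda>x. \<Prod>l\<in>L. f l ((T ^^ (a l * i)) x)) x)\<^sup>2 \<partial>M)"
  using assms(2-)
proof (induction k arbitrary: L f)
  case 0
  then have L: "L = {j}" by (metis card_1_singletonE singletonD One_nat_def)
  have z: "AE x in M. E (\<lambda>x. f j ((T ^^ n) x)) x = 0" for n
  proof -
    have "AE x in M. E (f j) x = 0" using 0 by simp
    from AE_Tn[OF this, of n] equivariant_Tn[OF eqv unit_ball_L_infty[OF 0(5)[OF 0(4)]], of n]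
    show ?thesis by eventually_elim auto
  qed
  have "(\<integral>x. (E (\<lambda>x. f j ((T ^^ n) x)) x)\<^sup>2 \<partial>M) = (\<integral>x. 0 \<partial>M)" for n
    by (rule integral_cong_AE) (use z[of n] in auto)
  then show ?case by (simp add: L null_average_zero)
next
  case (Suc k)
  interpret Z: system_factor M T "tower Y k" by (rule system_factor_tower)
  interpret Z': system_factor M T "tower Y (Suc k)" by (rule system_factor_tower)
  have eqvZ: "equivariant (tower Y k)" by (rule equivariant_tower[OF eqv])
  note [simp] = Suc.prems(1)
  note f = Suc.prems(5)
  have "L \<noteq> {j}" using Suc.prems(2) by auto
  then obtain p where p: "p \<in> L" "p \<noteq> j" using Suc.prems(4) by blast
  define L' where "L' = L - {p}"
  define b where "b = a p"
  have L': "finite L'" "card L' = Suc k" "inj_on a L'" "j \<in> L'" "\<And>l. l \<in> L' \<Longrightarrow> f l \<in> unit_ball"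
    using Suc.prems p by (auto simp: L'_def inj_on_def)
  have abj: "a j \<noteq> b" using Suc.prems(3,4) p by (auto simp: b_def dest: inj_onD)
  let ?\<mu> = "measure M (space M)"
  define g where "g d l x = f l ((T ^^ (b * d)) x) * f l ((T ^^ (a l * d)) x)" for d l x
  define \<kappa> where "\<kappa> d i = (\<integral>x. \<bar>E (\<lambda>x. \<Prod>l\<in>L'. g d l ((T ^^ (a l * i)) x)) x\<bar> \<partial>M)" for d i
  define e where "e d = Z.E (g d j)" for d
  define \<rho> where "\<rho> d = sqrt ?\<mu> * sqrt (\<integral>x. (e d x)\<^sup>2 \<partial>M)" for d
  \<comment> \<open>The factor \<open>1/2\<close> keeps the difference in the unit ball.\<close>
  define g' where "g' d l = (if l = j then (\<lambda>x. (1/2) * (g d j x - e d x)) else g d l)" for d l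
  define \<xi> where "\<xi> d i = 2 * (sqrt ?\<mu> * sqrt (\<integral>x. (E (\<lambda>x. \<Prod>l\<in>L'. g' d l ((T ^^ (a l * i)) x)) x)\<^sup>2 \<partial>M))" for d i
  have g: "g d l \<in> unit_ball" if "l \<in> L'" for d l
    unfolding g_def by (intro unit_ball_mult unit_ball_Tn L' that)
  have e: "e d \<in> unit_ball" for d unfolding e_def by (intro Z.unit_ball_E g L')
  have g': "g' d l \<in> unit_ball" if l: "l \<in> L'" for d l
  proof (cases "l = j")
    case True
    have "AE x in M. \<bar>(1/2) * (g d j x - e d x)\<bar> \<le> 1"
      using unit_ball_AE[OF g[OF L'(4), of d]] unit_ball_AE[OF e[of d]] by eventually_elim auto
    moreover have "(\<lambda>x. (1/2) * (g d j x - e d x)) \<in> borel_measurable M"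
      using g[OF L'(4), of d] e[of d] by (auto simp: unit_ball_def)
    ultimately show ?thesis using True by (simp add: g'_def unit_ball_def)
  qed (use g l in \<open>simp add: g'_def\<close>)
  have \<xi>0: "null_average (\<xi> d)" for d
    unfolding \<xi>_def
  proof (intro null_average_cmult null_average_sqrt)
    show "null_average (\<lambda>i. \<integral>x. (E (\<lambda>x. \<Prod>l\<in>L'. g' d l ((T ^^ (a l * i)) x)) x)\<^sup>2 \<partial>M)"
    proof (rule Suc.IH[OF L'(1-4) g'])
      have i: "integrable M (g d j)" "integrable M (e d)"
        using g[OF L'(4)] e by (auto intro: L_infty_integrable unit_ball_L_infty)
      have e\<F>: "e d \<in> borel_measurable Z.\<F>" by (simp add: e_def)
      have "AE x in M. Z.E (\<lambda>x. (1/2) * (g d j x - e d x)) x = (1/2) * Z.E (\<lambda>x. g d j x - e d x) x"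
        by (rule Z.E_cmult) (use i in auto)
      with Z.E_diff[OF i] Z.E_ident[OF e\<F> i(2)]
      show "AE x in M. Z.E (g' d j) x = 0" by eventually_elim (simp add: g'_def e_def)
    qed
  qed simp
  have \<kappa>le: "\<kappa> d i \<le> \<rho> d + \<xi> d i" for d i
  proof -
    define W where "W x = (\<Prod>l\<in>L' - {j}. g d l ((T ^^ (a l * i)) x))" for x
    have W: "W \<in> unit_ball" unfolding W_def by (intro unit_ball_prod unit_ball_Tn g) auto
    let ?e = "\<lambda>x. e d ((T ^^ (a j * i)) x)"
    let ?G = "\<lambda>x. \<Prod>l\<in>L'. g' d l ((T ^^ (a l * i)) x)"
    have e': "?e \<in> L_infty M" by (intro unit_ball_L_infty unit_ball_Tn e)
    have G: "?G \<in> L_infty M" by (intro unit_ball_L_infty unit_ball_prod unit_ball_Tn g')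
    have G_eq: "?G x = (1/2) * (g d j ((T ^^ (a j * i)) x) - ?e x) * W x" for x
    proof -
      have "?G x = g' d j ((T ^^ (a j * i)) x) * (\<Prod>l\<in>L' - {j}. g' d l ((T ^^ (a l * i)) x))"
        by (rule prod.remove) (use L' in auto)
      then show ?thesis by (simp add: g'_def W_def)
    qed
    have "(\<Prod>l\<in>L'. g d l ((T ^^ (a l * i)) x)) = W x * ?e x + 2 * ?G x" for x
    proof -
      have "(\<Prod>l\<in>L'. g d l ((T ^^ (a l * i)) x)) = g d j ((T ^^ (a j * i)) x) * W x"
        unfolding W_def by (rule prod.remove) (use L' in auto)
      then show ?thesis unfolding G_eq by (simp add: algebra_simps)
    qed
    then have \<kappa>eq: "\<kappa> d i = (\<integral>x. \<bar>E (\<lambda>x. W x * ?e x + 2 * ?G x) x\<bar> \<partial>M)" by (simp add: \<kappa>_def)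
    have We: "(\<lambda>x. W x * ?e x) \<in> L_infty M" by (intro L_infty_mult unit_ball_L_infty[OF W] e')
    have "AE x in M. E (\<lambda>x. W x * ?e x + 2 * ?G x) x = E (\<lambda>x. W x * ?e x) x + E (\<lambda>x. 2 * ?G x) x"
      by (intro E_add L_infty_integrable We L_infty_cmult G)
    with E_cmult[OF L_infty_integrable[OF G], of 2]
    have "AE x in M. \<bar>E (\<lambda>x. W x * ?e x + 2 * ?G x) x\<bar> \<le> \<bar>E (\<lambda>x. W x * ?e x) x\<bar> + 2 * \<bar>E ?G x\<bar>"
      by eventually_elim linarith
    then have "\<kappa> d i \<le> (\<integral>x. \<bar>E (\<lambda>x. W x * ?e x) x\<bar> + 2 * \<bar>E ?G x\<bar> \<partial>M)"
      unfolding \<kappa>eq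
      by (intro integral_mono_AE Bochner_Integration.integrable_add integrable_mult_right integrable_abs
          L_infty_integrable E_L_infty L_infty_add L_infty_cmult We G)
    also have "\<dots> = (\<integral>x. \<bar>E (\<lambda>x. W x * ?e x) x\<bar> \<partial>M) + 2 * (\<integral>x. \<bar>E ?G x\<bar> \<partial>M)"
      using L_infty_integrable[OF E_L_infty[OF We]] L_infty_integrable[OF E_L_infty[OF G]] by simp
    also have "(\<integral>x. \<bar>E (\<lambda>x. W x * ?e x) x\<bar> \<partial>M) \<le> (\<integral>x. \<bar>W x * ?e x\<bar> \<partial>M)" by (rule integral_abs_E_le[OF We])
    also have "\<dots> \<le> (\<integral>x. \<bar>?e x\<bar> \<partial>M)" by (rule integral_unit_ball_mult_le(2)[OF W e'])
    also have "\<dots> = (\<integral>x. \<bar>e d x\<bar> \<partial>M)"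
      by (rule integral_Tn[of "\<lambda>x. \<bar>e d x\<bar>"]) (use e[of d] in \<open>auto simp: unit_ball_def\<close>)
    also have "\<dots> \<le> \<rho> d" unfolding \<rho>_def by (rule L2_integral_abs_le[OF L_infty_L2[OF unit_ball_L_infty[OF e]]])
    also have "2 * (\<integral>x. \<bar>E ?G x\<bar> \<partial>M) \<le> \<xi> d i"
      unfolding \<xi>_def by (intro mult_left_mono L2_integral_abs_le L_infty_L2 E_L_infty G) simp
    finally show ?thesis by simp
  qed
  have \<rho>0: "null_average \<rho>"
  proof -
    define \<gamma> where "\<gamma> i = (\<integral>x. (Z.E (\<lambda>x. f j x * f j ((T ^^ i) x)) x)\<^sup>2 \<partial>M)" for i
    have fj: "f j \<in> L_infty M" using f Suc.prems(4) by (intro unit_ball_L_infty) auto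
    have \<gamma>0: "null_average \<gamma>"
      unfolding null_average_def \<gamma>_def
    proof (rule Z.correlation_averages_tendsto_zero[OF eqvZ fj])
      fix \<psi> assume "Z.AP \<psi>"
      then have "\<psi> \<in> tower Y (Suc k)" using Z.AP_Z by simp
      then show "(\<integral>x. f j x * \<psi> x \<partial>M) = 0" by (rule Z'.orthogonal_to_factor[OF fj Suc.prems(6)])
    qed
    \<comment> \<open>After a translation by \<open>s * d\<close>, harmless by equivariance, \<open>g d j\<close> is a product of \<open>f j\<close> with one of its translates.\<close>
    define D where "D = gap b (a j)"
    define s where "s = min b (a j)"
    have D: "D \<ge> 1" using abj by (auto simp: D_def)
    have \<rho>eq: "\<rho> d = sqrt ?\<mu> * sqrt (\<gamma> (D * d))" for d
    proof -
      let ?F = "\<lambda>x. f j x * f j ((T ^^ (D * d)) x)"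
      have F: "?F \<in> L_infty M" by (intro L_infty_mult L_infty_Tn fj)
      have "g d j x = ?F ((T ^^ (s * d)) x)" for x
      proof (cases "b \<le> a j")
        case True
        then have "s = b" "a j * d = D * d + s * d" by (auto simp: s_def D_def simp flip: distrib_right)
        then show ?thesis by (simp add: g_def funpow_add)
      next
        case False
        then have "s = a j" "b * d = D * d + s * d" by (auto simp: s_def D_def simp flip: distrib_right)
        then show ?thesis by (simp add: g_def funpow_add)
      qed
      then have "g d j = (\<lambda>x. ?F ((T ^^ (s * d)) x))" by auto
      then have "AE x in M. e d x = Z.E ?F ((T ^^ (s * d)) x)"
        unfolding e_def using Z.equivariant_Tn[OF eqvZ F, of "s * d"] by simp
      then have "(\<integral>x. (e d x)\<^sup>2 \<partial>M) = (\<integral>x. (Z.E ?F ((T ^^ (s * d)) x))\<^sup>2 \<partial>M)"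
        by (intro integral_cong_AE) (auto simp: e_def elim: eventually_mono intro: measurable_compose[OF measurable_Tn])
      also have "\<dots> = \<gamma> (D * d)" unfolding \<gamma>_def by (rule integral_Tn[of "\<lambda>x. (Z.E ?F x)\<^sup>2"]) simp
      finally show ?thesis by (simp add: \<rho>_def)
    qed
    have "null_average (\<lambda>d. sqrt ?\<mu> * sqrt (\<gamma> (D * d)))"
      by (intro null_average_cmult null_average_sqrt null_average_dilate \<gamma>0 D) (auto simp: \<gamma>_def)
    then show ?thesis by (simp add: \<rho>eq[abs_def])
  qed
  have split: "(\<Prod>l\<in>L. f l ((T ^^ (a l * i)) x)) = f p ((T ^^ (b * i)) x) * (\<Prod>l\<in>L'. f l ((T ^^ (a l * i)) x))" for i x
    unfolding b_def L'_def by (rule prod.remove) (use p in auto)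
  show ?case
    unfolding split
  proof (rule null_average_by_van_der_Corput[where \<kappa> = \<kappa> and \<rho> = \<rho> and \<xi> = \<xi> and K = ?\<mu>])
    show "(real R)\<^sup>2 * (\<Sum>i<m. \<integral>x. (E (\<lambda>x. f p ((T ^^ (b * i)) x) * (\<Prod>l\<in>L'. f l ((T ^^ (a l * i)) x))) x)\<^sup>2 \<partial>M)\<^sup>2
      \<le> ?\<mu> * (real (m + R) * (\<Sum>r<R. \<Sum>r'<R. \<Sum>i<m. \<kappa> (gap r r') i))" for m R
      unfolding \<kappa>_def g_def by (rule remove_one_function[OF f[OF p(1)] L'(1,5)])
  qed (use \<kappa>le \<rho>0 \<xi>0 in \<open>auto simp: \<rho>_def \<xi>_def\<close>)
qed

end


section \<open>Finite levels of the tower\<close>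

text \<open>The finite ordinal \<open>n\<close> is the Cantor normal form with the single digit \<open>n\<close> at the exponent zero, which in
turn is the normal form without nonzero digits.\<close>

definition exponent_zero :: "nat \<Rightarrow> nat" where
  "exponent_zero = (\<lambda>_. 0)"

definition finite_ordinal :: "nat \<Rightarrow> (nat \<Rightarrow> nat) \<Rightarrow> nat" where
  "finite_ordinal n x = (if x = exponent_zero then n else 0)"

lemma natLeq_iff: "(a, b) \<in> natLeq \<longleftrightarrow> a \<le> b"
  by (simp add: natLeq_def)

lemma ord_zero_natLeq: "ord_zero natLeq = 0"
proof -
  interpret wo_rel natLeq using natLeq_Well_order by (simp add: wo_rel_def)
  have "minim UNIV \<in> UNIV \<and> (minim UNIV, 0) \<in> natLeq"
    using minim_least[of UNIV 0] by (simp add: Field_natLeq)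
  then show ?thesis by (simp add: ord_zero_def Field_natLeq natLeq_iff)
qed

lemma Field_ord_exp: "Field (ord_exp r s) = fin_supp_funs r s"
  by (auto simp: Field_def ord_exp_def)

lemma fin_supp_funs_natLeq:
  "f \<in> fin_supp_funs natLeq s \<longleftrightarrow> (\<forall>x. x \<notin> Field s \<longrightarrow> f x = 0) \<and> finite {x. f x \<noteq> 0}"
  by (simp add: fin_supp_funs_def ord_zero_natLeq Field_natLeq)

lemma natLeq_less_iff: "(a, b) \<in> natLeq - Id \<longleftrightarrow> a < b"
  by (auto simp: natLeq_iff)

lemma exponent_zero_Field: "exponent_zero \<in> Field (ord_exp natLeq natLeq)"
  by (simp add: Field_ord_exp fin_supp_funs_natLeq Field_natLeq exponent_zero_def)

lemma exponent_zero_least: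
  assumes y: "y \<in> Field (ord_exp natLeq natLeq)" "y \<noteq> exponent_zero"
  shows "(exponent_zero, y) \<in> ord_exp natLeq natLeq - Id"
proof -
  have fin: "finite {x. y x \<noteq> 0}" using y(1) by (simp add: Field_ord_exp fin_supp_funs_natLeq)
  have ne: "{x. y x \<noteq> 0} \<noteq> {}" using y(2) by (auto simp: exponent_zero_def fun_eq_iff)
  define x where "x = Max {x. y x \<noteq> 0}"
  have "y x \<noteq> 0" using Max_in[OF fin ne] by (simp add: x_def)
  moreover have "y z = 0" if "x < z" for z
    using Max_ge[OF fin, of z] that by (auto simp: x_def)
  ultimately have "\<exists>x\<in>Field natLeq. (exponent_zero x, y x) \<in> natLeq - Id \<and>
      (\<forall>z. (x, z) \<in> natLeq - Id \<longrightarrow> exponent_zero z = y z)"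
    by (intro bexI[of _ x]) (auto simp: natLeq_less_iff exponent_zero_def Field_natLeq simp del: Diff_iff)
  moreover have "y \<in> fin_supp_funs natLeq natLeq" "exponent_zero \<in> fin_supp_funs natLeq natLeq"
    using y(1) exponent_zero_Field by (simp_all add: Field_ord_exp)
  ultimately show ?thesis
    using y(2) unfolding ord_exp_def[of natLeq natLeq] by blast
qed

lemma finite_ordinal_Field: "finite_ordinal n \<in> Field omega_omega_omega"
proof -
  have "{x. finite_ordinal n x \<noteq> 0} \<subseteq> {exponent_zero}" by (auto simp: finite_ordinal_def)
  then have "finite {x. finite_ordinal n x \<noteq> 0}" using finite_subset by blast
  then show ?thesis unfolding omega_omega_omega_def Field_ord_exp[of natLeq "ord_exp natLeq natLeq"]
    using exponent_zero_Field by (auto simp: fin_supp_funs_natLeq finite_ordinal_def)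
qed

lemma below_finite_ordinal_iff:
  "(g, finite_ordinal n) \<in> omega_omega_omega \<longleftrightarrow> (\<exists>i\<le>n. g = finite_ordinal i)"
proof
  let ?s = "ord_exp natLeq natLeq"
  assume g: "(g, finite_ordinal n) \<in> omega_omega_omega"
  then have gF: "g \<in> fin_supp_funs natLeq ?s" by (simp add: omega_omega_omega_def ord_exp_def[of natLeq ?s])
  have "g = finite_ordinal n \<or> (\<exists>x. (g x, finite_ordinal n x) \<in> natLeq - Id \<and>
      (\<forall>y. (x, y) \<in> ?s - Id \<longrightarrow> g y = finite_ordinal n y))"
    using g unfolding omega_omega_omega_def ord_exp_def[of natLeq ?s] by blast
  then show "\<exists>i\<le>n. g = finite_ordinal i"
  proof
    assume "\<exists>x. (g x, finite_ordinal n x) \<in> natLeq - Id \<and> (\<forall>y. (x, y) \<in> ?s - Id \<longrightarrow> g y = finite_ordinal n y)"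
    then obtain x where x: "g x < finite_ordinal n x" "\<And>y. (x, y) \<in> ?s - Id \<Longrightarrow> g y = finite_ordinal n y"
      unfolding natLeq_less_iff by blast
    have x0: "x = exponent_zero" "g x < n" using x(1) by (auto simp: finite_ordinal_def split: if_splits)
    have "g y = finite_ordinal (g exponent_zero) y" for y
    proof (cases "y = exponent_zero")
      case False
      have "g y = 0"
      proof (cases "y \<in> Field ?s")
        case True
        then show ?thesis using x(2)[of y] exponent_zero_least[OF True False] x0 False by (simp add: finite_ordinal_def)
      qed (use gF in \<open>simp add: fin_supp_funs_natLeq\<close>)
      then show ?thesis using False by (simp add: finite_ordinal_def)
    qed (simp add: finite_ordinal_def)
    then have "g = finite_ordinal (g exponent_zero)" by blast
    then show ?thesis using x0 by (intro exI[of _ "g exponent_zero"]) auto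
  qed auto
next
  let ?s = "ord_exp natLeq natLeq"
  assume "\<exists>i\<le>n. g = finite_ordinal i"
  then obtain i where i: "i \<le> n" "g = finite_ordinal i" by blast
  have F: "finite_ordinal i \<in> fin_supp_funs natLeq ?s" for i
    using finite_ordinal_Field[of i] unfolding omega_omega_omega_def Field_ord_exp[of natLeq ?s] .
  have "finite_ordinal i = finite_ordinal n \<or> (\<exists>x\<in>Field ?s. (finite_ordinal i x, finite_ordinal n x) \<in> natLeq - Id \<and>
      (\<forall>y. (x, y) \<in> ?s - Id \<longrightarrow> finite_ordinal i y = finite_ordinal n y))"
  proof (cases "i = n")
    case False
    then have "(finite_ordinal i exponent_zero, finite_ordinal n exponent_zero) \<in> natLeq - Id"
      unfolding natLeq_less_iff using i by (simp add: finite_ordinal_def)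
    moreover have "finite_ordinal i y = finite_ordinal n y" if "(exponent_zero, y) \<in> ?s - Id" for y
      using that by (auto simp: finite_ordinal_def)
    ultimately show ?thesis using exponent_zero_Field by blast
  qed simp
  then show "(g, finite_ordinal n) \<in> omega_omega_omega"
    unfolding omega_omega_omega_def ord_exp_def[of natLeq ?s] i(2) using F by blast
qed

lemma finite_ordinal_inject: "finite_ordinal i = finite_ordinal j \<longleftrightarrow> i = j"
  by (metis finite_ordinal_def)

lemma under_finite_ordinal: "under omega_omega_omega (finite_ordinal n) = finite_ordinal ` {..n}"
  by (auto simp: under_def below_finite_ordinal_iff)

lemma underS_finite_ordinal: "underS omega_omega_omega (finite_ordinal n) = finite_ordinal ` {..<n}"
  by (auto simp: underS_def below_finite_ordinal_iff finite_ordinal_inject)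

lemma fz_tower_finite_ordinal:
  "fz_tower M T omega_omega_omega (finite_ordinal n) = (max_compact_ext M T ^^ n) (trivial_factor M)"
proof (induction n)
  case 0
  show ?case
    by (simp add: fz_tower_zero[OF Well_order_omega_omega_omega] underS_finite_ordinal)
next
  case (Suc n)
  have "underS omega_omega_omega (finite_ordinal (Suc n)) = under omega_omega_omega (finite_ordinal n)"
    unfolding under_finite_ordinal underS_finite_ordinal by (simp add: lessThan_Suc_atMost)
  from fz_tower_succ[OF Well_order_omega_omega_omega finite_ordinal_Field this, of M T] Suc show ?case by simp
qed

lemma prod_diff_telescope:
  fixes x y :: "nat \<Rightarrow> real"
  shows "(\<Prod>l<K. x l) - (\<Prod>l<K. y l)
    = (\<Sum>j<K. \<Prod>l<K. if l < j then y l else if l = j then x j - y j else x l)"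
proof (induction K)
  case (Suc K)
  let ?c = "\<lambda>j l. if l < j then y l else if l = j then x j - y j else x l"
  have "(\<Sum>j<Suc K. \<Prod>l<Suc K. ?c j l) = (\<Sum>j<K. (\<Prod>l<K. ?c j l) * x K) + (\<Prod>l<K. y l) * (x K - y K)"
    by simp
  also have "(\<Sum>j<K. (\<Prod>l<K. ?c j l) * x K) = ((\<Prod>l<K. x l) - (\<Prod>l<K. y l)) * x K"
    unfolding Suc.IH sum_distrib_right ..
  finally show ?case by (simp add: algebra_simps)
qed simp

context measure_preserving_system
begin

lemma system_factor_trivial: "system_factor M T (trivial_factor M)"
  by unfold_locales (rule trivial_factor_factor)

lemma system_factor_level: "system_factor M T (tower (trivial_factor M) n)"
  by (rule system_factor.system_factor_tower[OF system_factor_trivial])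

lemma equivariant_level: "equivariant (tower (trivial_factor M) n)"
  by (rule system_factor.equivariant_tower[OF system_factor_trivial equivariant_trivial])

lemma level_mono: "tower (trivial_factor M) n \<subseteq> tower (trivial_factor M) (n + k)"
proof (induction k)
  case (Suc k)
  interpret system_factor M T "tower (trivial_factor M) (n + k)" by (rule system_factor_level)
  show ?case using Suc factor_subset_Z by simp
qed simp

text \<open>Pythagoras: the projection to the larger factor minus the projection to the smaller one is orthogonal to
the smaller factor.\<close>

lemma cond_exp_nested_distance:
  assumes Y: "system_factor M T Y" and Y': "system_factor M T Y'" and sub: "Y \<subseteq> Y'" and f: "f \<in> L2 M"
  shows "(\<integral>x. (cond_exp M Y' f x - cond_exp M Y f x)\<^sup>2 \<partial>M)
    = (\<integral>x. (cond_exp M Y' f x)\<^sup>2 \<partial>M) - (\<integral>x. (cond_exp M Y f x)\<^sup>2 \<partial>M)"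
proof -
  interpret Y: system_factor M T Y by (rule Y)
  interpret Y': system_factor M T Y' by (rule Y')
  let ?e = "Y.E f" and ?e' = "Y'.E f"
  have e: "?e \<in> Y" "?e \<in> Y'" "?e \<in> L2 M" and e': "?e' \<in> L2 M"
    using Y.E_factor[OF f] sub Y.E_L2[OF f] Y'.E_L2[OF f] by auto
  have i: "integrable M (\<lambda>x. f x * ?e x)" "integrable M (\<lambda>x. ?e' x * ?e x)" "integrable M (\<lambda>x. ?e x * ?e x)"
    "integrable M (\<lambda>x. ?e' x * ?e' x)"
    by (intro L2_mult_integrable f e e')+
  have "(\<integral>x. (f x - ?e x) * ?e x \<partial>M) = 0" "(\<integral>x. (f x - ?e' x) * ?e x \<partial>M) = 0"
    by (rule cond_exp_projection(2)[OF Y.finite_M Y.factor_Y f e(1)],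
        rule cond_exp_projection(2)[OF Y.finite_M Y'.factor_Y f e(2)])
  then have eq: "(\<integral>x. ?e' x * ?e x \<partial>M) = (\<integral>x. ?e x * ?e x \<partial>M)"
    using i by (simp add: left_diff_distrib)
  have "(\<integral>x. (?e' x - ?e x)\<^sup>2 \<partial>M) = (\<integral>x. ?e' x * ?e' x - 2 * (?e' x * ?e x) + ?e x * ?e x \<partial>M)"
    by (intro Bochner_Integration.integral_cong) (auto simp: power2_eq_square algebra_simps)
  also have "\<dots> = (\<integral>x. ?e' x * ?e' x \<partial>M) - (\<integral>x. ?e x * ?e x \<partial>M)"
    using i eq by simp
  finally show ?thesis by (simp add: power2_eq_square)
qed

text \<open>The norms of the projections of finitely many functions increase along the tower and are
  bounded.\<close>

lemma stable_level:
  assumes f: "\<And>l. l < K \<Longrightarrow> f l \<in> L2 M" and \<eta>: "\<eta> > 0"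
  shows "\<exists>n. (\<Sum>l<K. \<integral>x. (cond_exp M (tower (trivial_factor M) (n + k)) (f l) x
      - cond_exp M (tower (trivial_factor M) n) (f l) x)\<^sup>2 \<partial>M) < \<eta>"
proof -
  define a where "a n = (\<Sum>l<K. \<integral>x. (cond_exp M (tower (trivial_factor M) n) (f l) x)\<^sup>2 \<partial>M)" for n
  have diff: "(\<Sum>l<K. \<integral>x. (cond_exp M (tower (trivial_factor M) (n + k)) (f l) x
      - cond_exp M (tower (trivial_factor M) n) (f l) x)\<^sup>2 \<partial>M) = a (n + k) - a n" for n k
    unfolding a_def sum_subtractf[symmetric]
    by (intro sum.cong refl cond_exp_nested_distance system_factor_level level_mono f) simp
  have "a n \<le> a (Suc n)" for n
    using diff[of n 1] sum_nonneg[of "{..<K}" "\<lambda>l. \<integral>x. (cond_exp M (tower (trivial_factor M) (n + 1)) (f l) x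
      - cond_exp M (tower (trivial_factor M) n) (f l) x)\<^sup>2 \<partial>M"] by simp
  then have "incseq a" by (rule incseq_SucI)
  moreover have "a n \<le> (\<Sum>l<K. \<integral>x. (f l x)\<^sup>2 \<partial>M)" for n
    unfolding a_def by (intro sum_mono system_factor.E_square_integral_le[OF system_factor_level] f) simp
  ultimately obtain L where "a \<longlonglongrightarrow> L" using incseq_convergent[of a] by blast
  then have "Cauchy a" by (rule LIMSEQ_imp_Cauchy)
  then obtain n where "\<And>p q. p \<ge> n \<Longrightarrow> q \<ge> n \<Longrightarrow> dist (a p) (a q) < \<eta>"
    using \<eta> unfolding Cauchy_def by blast
  then have "dist (a (n + k)) (a n) < \<eta>" by simp
  then have "a (n + k) - a n < \<eta>" by (simp add: dist_real_def)
  then show ?thesis using diff by metis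
qed

lemma unit_ball_halved_diff:
  assumes "f \<in> unit_ball" "g \<in> unit_ball" shows "(\<lambda>x. (1/2) * (f x - g x)) \<in> unit_ball"
proof -
  have "AE x in M. \<bar>(1/2) * (f x - g x)\<bar> \<le> 1"
    using assms[THEN unit_ball_AE] by eventually_elim auto
  moreover have "(\<lambda>x. (1/2) * (f x - g x)) \<in> borel_measurable M"
    using assms by (intro borel_measurable_times borel_measurable_const borel_measurable_diff) (auto simp: unit_ball_def)
  ultimately show ?thesis by (simp add: unit_ball_def)
qed

definition defect :: "('a \<Rightarrow> real) set \<Rightarrow> nat \<Rightarrow> (nat \<Rightarrow> 'a \<Rightarrow> real) \<Rightarrow> nat \<Rightarrow> real" where
  "defect Y K f i = (\<integral>x. (cond_exp M Y (\<lambda>z. \<Prod>l<K. f l ((T ^^ (l * i)) z)) x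
     - (\<Prod>l<K. cond_exp M Y (f l) ((T ^^ (l * i)) x)))\<^sup>2 \<partial>M)"

text \<open>Telescoping reduces the defect to products with one factor \<open>f j - E(f j | Y)\<close>. This is the sum
  of \<open>f j - E(f j | tower Y k)\<close>, to which the multiple correlation theorem applies, and of
  \<open>E(f j | tower Y k) - E(f j | Y)\<close>, whose norm
  remains in the bound.\<close>

lemma defect_le:
  assumes Y: "system_factor M T Y" and eqv: "equivariant Y" and f: "\<And>l. l < Suc k \<Longrightarrow> f l \<in> unit_ball"
  obtains a where "null_average a" "\<And>i. defect Y (Suc k) f i \<le> a i + 2 * real (Suc k)
    * (\<Sum>j<Suc k. \<integral>x. (cond_exp M (tower Y k) (f j) x - cond_exp M Y (f j) x)\<^sup>2 \<partial>M)"
proof -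
  interpret system_factor M T Y by (rule Y)
  interpret Z: system_factor M T "tower Y k" by (rule system_factor_tower)
  let ?K = "Suc k"
  define e where "e l = E (f l)" for l
  define e' where "e' l = Z.E (f l)" for l
  \<comment> \<open>\<open>w j\<close> and \<open>v j\<close> have half of \<open>f j - e' j\<close> and half of \<open>e' j - e j\<close> at place \<open>j\<close>; halving keeps them in the unit ball.\<close>
  define w where "w j l = (if l < j then e l else if l = j then (\<lambda>x. (1/2) * (f j x - e' j x)) else f l)" for j l
  define v where "v j l = (if l < j then e l else if l = j then (\<lambda>x. (1/2) * (e' j x - e j x)) else f l)" for j l
  define W where "W j i x = (\<Prod>l<?K. w j l ((T ^^ (l * i)) x))" for j i x
  define V where "V j i x = (\<Prod>l<?K. v j l ((T ^^ (l * i)) x))" for j i x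
  have e: "e l \<in> unit_ball" and e': "e' l \<in> unit_ball" if "l < ?K" for l
    unfolding e_def e'_def by (intro unit_ball_E Z.unit_ball_E f that)+
  have w: "w j l \<in> unit_ball" and v: "v j l \<in> unit_ball" if "j < ?K" "l < ?K" for j l
    using e[OF that(2)] f[OF that(2)] unit_ball_halved_diff[OF f[OF that(1)] e'[OF that(1)]]
      unit_ball_halved_diff[OF e'[OF that(1)] e[OF that(1)]] by (auto simp: w_def v_def)
  have WV: "W j i \<in> unit_ball" "V j i \<in> unit_ball" if "j < ?K" for j i
    unfolding W_def V_def by (intro unit_ball_prod unit_ball_Tn w v that; simp)+
  define a where "a i = 8 * real ?K * (\<Sum>j<?K. \<integral>x. (E (W j i) x)\<^sup>2 \<partial>M)" for i
  have "null_average a"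
    unfolding a_def
  proof (intro null_average_cmult null_average_sum)
    fix j assume "j \<in> {..<?K}"
    then have j: "j < ?K" by simp
    have i: "integrable M (f j)" "integrable M (e' j)"
      using f[OF j] e'[OF j] by (auto intro: L_infty_integrable unit_ball_L_infty)
    have m: "e' j \<in> borel_measurable Z.\<F>" by (simp add: e'_def)
    have "AE x in M. Z.E (\<lambda>x. (1/2) * (f j x - e' j x)) x = (1/2) * Z.E (\<lambda>x. f j x - e' j x) x"
      by (rule Z.E_cmult) (use i in auto)
    with Z.E_diff[OF i] Z.E_ident[OF m i(2)] have "AE x in M. Z.E (w j j) x = 0"
      by eventually_elim (simp add: w_def e'_def)
    then show "null_average (\<lambda>i. \<integral>x. (E (W j i) x)\<^sup>2 \<partial>M)"
      unfolding W_def using j w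
      by (intro multiple_correlation_tendsto_zero[OF eqv, where a = "\<lambda>l. l" and j = j and k = k]) auto
  qed
  moreover have "defect Y ?K f i \<le> a i + 2 * real ?K * (\<Sum>j<?K. \<integral>x. (e' j x - e j x)\<^sup>2 \<partial>M)" for i
  proof -
    let ?F = "\<lambda>x. \<Prod>l<?K. f l ((T ^^ (l * i)) x)" and ?H = "\<lambda>x. \<Prod>l<?K. e l ((T ^^ (l * i)) x)"
    have F: "?F \<in> unit_ball" by (intro unit_ball_prod unit_ball_Tn f) simp
    have H: "?H \<in> unit_ball" by (intro unit_ball_prod unit_ball_Tn e) simp
    have H\<F>: "?H \<in> borel_measurable \<F>"
      unfolding e_def by (intro borel_measurable_prod measurable_compose[OF Tn_\<F> E_measurable(1)])
    note int = L_infty_integrable[OF unit_ball_L_infty]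
    have tele: "?F x - ?H x = (\<Sum>j<?K. 2 * W j i x + 2 * V j i x)" for x
      unfolding prod_diff_telescope
    proof (intro sum.cong refl)
      fix j assume "j \<in> {..<?K}"
      then have j: "j \<in> {..<?K}" "finite {..<?K}" by auto
      let ?t = "\<lambda>l. if l < j then e l ((T ^^ (l * i)) x) else if l = j
          then f j ((T ^^ (j * i)) x) - e j ((T ^^ (j * i)) x) else f l ((T ^^ (l * i)) x)"
      let ?R = "\<Prod>l\<in>{..<?K} - {j}. w j l ((T ^^ (l * i)) x)"
      have rest: "prod ?t ({..<?K} - {j}) = ?R" "(\<Prod>l\<in>{..<?K} - {j}. v j l ((T ^^ (l * i)) x)) = ?R"
        by (rule prod.cong; auto simp: w_def v_def)+
      have "prod ?t {..<?K} = (f j ((T ^^ (j * i)) x) - e j ((T ^^ (j * i)) x)) * ?R"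
        using prod.remove[OF j(2,1), of ?t] rest(1) by simp
      moreover have "W j i x = (1/2) * (f j ((T ^^ (j * i)) x) - e' j ((T ^^ (j * i)) x)) * ?R"
        unfolding W_def by (subst prod.remove[OF j(2,1)]) (simp add: w_def)
      moreover have "V j i x = (1/2) * (e' j ((T ^^ (j * i)) x) - e j ((T ^^ (j * i)) x)) * ?R"
        unfolding V_def prod.remove[OF j(2,1)] rest(2) by (simp add: v_def)
      ultimately show "(\<Prod>l<?K. if l < j then e l ((T ^^ (l * i)) x) else if l = j
          then f j ((T ^^ (j * i)) x) - e j ((T ^^ (j * i)) x) else f l ((T ^^ (l * i)) x))
        = 2 * W j i x + 2 * V j i x"
        by (simp add: algebra_simps)
    qed
    have "AE x in M. E (\<lambda>x. ?F x - ?H x) x = E ?F x - E ?H x" by (intro E_diff int F H)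
    moreover have "AE x in M. E ?H x = ?H x" by (intro E_ident H\<F> int H)
    moreover have "AE x in M. E (\<lambda>x. \<Sum>j<?K. 2 * W j i x + 2 * V j i x) x = (\<Sum>j<?K. E (\<lambda>x. 2 * W j i x + 2 * V j i x) x)"
      by (intro E_sum L_infty_integrable L_infty_add L_infty_cmult unit_ball_L_infty WV) auto
    moreover have "AE x in M. \<forall>j\<in>{..<?K}. E (\<lambda>x. 2 * W j i x + 2 * V j i x) x = 2 * E (W j i) x + 2 * E (V j i) x"
    proof (intro AE_finite_allI)
      fix j assume "j \<in> {..<?K}"
      then have j: "j < ?K" by simp
      have "AE x in M. E (\<lambda>x. 2 * W j i x + 2 * V j i x) x = E (\<lambda>x. 2 * W j i x) x + E (\<lambda>x. 2 * V j i x) x"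
        by (intro E_add L_infty_integrable L_infty_cmult unit_ball_L_infty WV j)
      with E_cmult[OF int[OF WV(1)[OF j]], of 2 i] E_cmult[OF int[OF WV(2)[OF j]], of 2 i]
      show "AE x in M. E (\<lambda>x. 2 * W j i x + 2 * V j i x) x = 2 * E (W j i) x + 2 * E (V j i) x"
        by eventually_elim simp
    qed simp
    ultimately have "AE x in M. (E ?F x - ?H x)\<^sup>2 \<le> real ?K * (\<Sum>j<?K. 8 * (E (W j i) x)\<^sup>2 + 8 * (E (V j i) x)\<^sup>2)"
    proof eventually_elim
      case (elim x)
      have "E ?F x - ?H x = (\<Sum>j<?K. 2 * E (W j i) x + 2 * E (V j i) x)"
        using elim unfolding tele by simp
      also have "(\<dots>)\<^sup>2 \<le> (\<Sum>j<?K. (2 * E (W j i) x + 2 * E (V j i) x)\<^sup>2) * real ?K"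
        using sum_squared_le_sum_of_squares[of "\<lambda>j. 2 * E (W j i) x + 2 * E (V j i) x" "{..<?K}"] by simp
      also have "\<dots> \<le> (\<Sum>j<?K. 8 * (E (W j i) x)\<^sup>2 + 8 * (E (V j i) x)\<^sup>2) * real ?K"
      proof (intro mult_right_mono sum_mono)
        fix j
        show "(2 * E (W j i) x + 2 * E (V j i) x)\<^sup>2 \<le> 8 * (E (W j i) x)\<^sup>2 + 8 * (E (V j i) x)\<^sup>2"
          using square_sum_le[of "2 * E (W j i) x" "2 * E (V j i) x"] by (simp add: power_mult_distrib)
      qed simp
      finally show ?case by (simp only: mult.commute)
    qed
    then have "defect Y ?K f i \<le> (\<integral>x. real ?K * (\<Sum>j<?K. 8 * (E (W j i) x)\<^sup>2 + 8 * (E (V j i) x)\<^sup>2) \<partial>M)"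
      unfolding defect_def e_def[symmetric]
      by (intro integral_mono_AE L_infty_integrable L_infty_power2 L_infty_diff L_infty_cmult L_infty_sum L_infty_add
          E_L_infty unit_ball_L_infty F H WV) auto
    also have "\<dots> = real ?K * (\<Sum>j<?K. \<integral>x. 8 * (E (W j i) x)\<^sup>2 + 8 * (E (V j i) x)\<^sup>2 \<partial>M)"
    proof -
      have "integrable M (\<lambda>x. 8 * (E (W j i) x)\<^sup>2 + 8 * (E (V j i) x)\<^sup>2)" if "j \<in> {..<?K}" for j
        using that by (intro L_infty_integrable L_infty_add L_infty_cmult L_infty_power2 E_L_infty unit_ball_L_infty WV) auto
      then show ?thesis
        unfolding integral_mult_right_zero by (subst Bochner_Integration.integral_sum) auto
    qed
    also have "\<dots> = real ?K * (\<Sum>j<?K. 8 * (\<integral>x. (E (W j i) x)\<^sup>2 \<partial>M) + 8 * (\<integral>x. (E (V j i) x)\<^sup>2 \<partial>M))"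
    proof (intro arg_cong2[where f = "(*)"] sum.cong refl)
      fix j assume "j \<in> {..<?K}"
      then have j: "j < ?K" by simp
      have "integrable M (\<lambda>x. (E (W j i) x)\<^sup>2)" "integrable M (\<lambda>x. (E (V j i) x)\<^sup>2)"
        by (intro L_infty_integrable L_infty_power2 E_L_infty unit_ball_L_infty WV j)+
      then show "(\<integral>x. 8 * (E (W j i) x)\<^sup>2 + 8 * (E (V j i) x)\<^sup>2 \<partial>M)
        = 8 * (\<integral>x. (E (W j i) x)\<^sup>2 \<partial>M) + 8 * (\<integral>x. (E (V j i) x)\<^sup>2 \<partial>M)" by simp
    qed
    also have "\<dots> \<le> real ?K * (\<Sum>j<?K. 8 * (\<integral>x. (E (W j i) x)\<^sup>2 \<partial>M) + 2 * (\<integral>x. (e' j x - e j x)\<^sup>2 \<partial>M))"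
    proof (intro mult_left_mono sum_mono add_left_mono)
      fix j assume "j \<in> {..<?K}"
      then have j: "j < ?K" "j \<in> {..<?K}" "finite {..<?K}" by auto
      have "(\<integral>x. (E (V j i) x)\<^sup>2 \<partial>M) \<le> (\<integral>x. (V j i x)\<^sup>2 \<partial>M)"
        by (intro E_square_integral_le L_infty_L2 unit_ball_L_infty WV j)
      also have "\<dots> \<le> (\<integral>x. (v j j ((T ^^ (j * i)) x))\<^sup>2 \<partial>M)"
      proof (rule integral_mono_AE)
        let ?R = "\<lambda>x. \<Prod>l\<in>{..<?K} - {j}. v j l ((T ^^ (l * i)) x)"
        have "?R \<in> unit_ball" by (intro unit_ball_prod unit_ball_Tn v j) auto
        then have "AE x in M. \<bar>?R x\<bar> \<le> 1" by (rule unit_ball_AE)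
        then show "AE x in M. (V j i x)\<^sup>2 \<le> (v j j ((T ^^ (j * i)) x))\<^sup>2"
        proof eventually_elim
          case (elim x)
          have "V j i x = v j j ((T ^^ (j * i)) x) * ?R x"
            unfolding V_def by (rule prod.remove[OF j(3,2)])
          moreover have "(?R x)\<^sup>2 \<le> 1" using elim by (simp add: abs_square_le_1)
          ultimately show ?case by (simp add: power_mult_distrib mult_left_le)
        qed
      qed (intro L_infty_integrable L_infty_power2 unit_ball_L_infty WV unit_ball_Tn v j)+
      also have "\<dots> = (\<integral>x. (v j j x)\<^sup>2 \<partial>M)"
        by (rule integral_Tn[of "\<lambda>x. (v j j x)\<^sup>2"])
          (intro L_infty_measurable L_infty_power2 unit_ball_L_infty v j)
      also have "\<dots> = 1/4 * (\<integral>x. (e' j x - e j x)\<^sup>2 \<partial>M)"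
        by (simp add: v_def power_mult_distrib power_divide)
      finally show "8 * (\<integral>x. (E (V j i) x)\<^sup>2 \<partial>M) \<le> 2 * (\<integral>x. (e' j x - e j x)\<^sup>2 \<partial>M)" by simp
    qed simp
    also have "\<dots> = a i + 2 * real ?K * (\<Sum>j<?K. \<integral>x. (e' j x - e j x)\<^sup>2 \<partial>M)"
      by (simp only: a_def sum.distrib sum_distrib_left[symmetric] distrib_left mult_ac)
    finally show ?thesis .
  qed
  ultimately show ?thesis using that unfolding e_def e'_def by blast
qed

lemma defect_small_unit_ball:
  assumes f: "\<And>l. l < K \<Longrightarrow> f l \<in> unit_ball" and \<epsilon>: "\<epsilon> > 0"
  shows "\<exists>n N. N \<ge> 1 \<and> (\<forall>m\<ge>N. (\<Sum>i<m. defect (tower (trivial_factor M) n) K f i) / real m < \<epsilon>)"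
proof (cases K)
  case 0
  interpret system_factor M T "tower (trivial_factor M) 0" by (rule system_factor_level)
  have "defect (tower (trivial_factor M) 0) 0 f i = (\<integral>x. 0 \<partial>M)" for i
    unfolding defect_def by (rule integral_cong_AE) (use E_const[of 1] E_measurable(2)[of "\<lambda>_. 1"] in auto)
  then show ?thesis using 0 \<epsilon> by (intro exI[of _ 0] exI[of _ 1]) auto
next
  case (Suc k)
  define \<eta> where "\<eta> = \<epsilon> / (4 * real K)"
  have \<eta>: "\<eta> > 0" using \<epsilon> Suc by (simp add: \<eta>_def)
  obtain n where n: "(\<Sum>l<K. \<integral>x. (cond_exp M (tower (trivial_factor M) (n + k)) (f l) x
      - cond_exp M (tower (trivial_factor M) n) (f l) x)\<^sup>2 \<partial>M) < \<eta>"
    using stable_level[of K f \<eta> k, OF L_infty_L2[OF unit_ball_L_infty[OF f]] \<eta>] by blast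
  let ?Y = "tower (trivial_factor M) n"
  have tt: "tower ?Y k = tower (trivial_factor M) (n + k)"
    by (simp add: funpow_add add.commute[of n k])
  obtain a where a: "null_average a" "\<And>i. defect ?Y (Suc k) f i \<le> a i + 2 * real (Suc k)
    * (\<Sum>j<Suc k. \<integral>x. (cond_exp M (tower ?Y k) (f j) x - cond_exp M ?Y (f j) x)\<^sup>2 \<partial>M)"
    using defect_le[OF system_factor_level equivariant_level, of k f n] f Suc by blast
  have le: "defect ?Y K f i \<le> a i + \<epsilon> / 2" for i
  proof -
    have "2 * real K * (\<Sum>j<K. \<integral>x. (cond_exp M (tower ?Y k) (f j) x - cond_exp M ?Y (f j) x)\<^sup>2 \<partial>M) \<le> 2 * real K * \<eta>"
      unfolding tt using n by (intro mult_left_mono) auto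
    also have "\<dots> = \<epsilon> / 2"
    proof -
      have "real K \<noteq> 0" using Suc by simp
      then show ?thesis unfolding \<eta>_def by (simp add: field_simps)
    qed
    finally show ?thesis using a(2)[of i] Suc by simp
  qed
  have "eventually (\<lambda>m. (\<Sum>i<m. a i) / real m < \<epsilon> / 2) sequentially"
    using a(1) \<epsilon> unfolding null_average_def by (intro order_tendstoD(2)) auto
  then obtain N where N: "\<And>m. m \<ge> N \<Longrightarrow> (\<Sum>i<m. a i) / real m < \<epsilon> / 2" by (auto simp: eventually_sequentially)
  have "(\<Sum>i<m. defect ?Y K f i) / real m < \<epsilon>" if m: "m \<ge> Suc N" for m
  proof -
    have mp: "real m > 0" using m by simp
    have "(\<Sum>i<m. defect ?Y K f i) \<le> (\<Sum>i<m. a i + \<epsilon> / 2)" by (intro sum_mono le)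
    then have "(\<Sum>i<m. defect ?Y K f i) / real m \<le> (\<Sum>i<m. a i + \<epsilon> / 2) / real m"
      using mp by (intro divide_right_mono) auto
    also have "\<dots> = (\<Sum>i<m. a i) / real m + \<epsilon> / 2" using mp by (simp add: sum.distrib add_divide_distrib)
    finally show ?thesis using N[of m] m by linarith
  qed
  then show ?thesis by (intro exI[of _ n] exI[of _ "Suc N"]) auto
qed

text \<open>Both terms of the defect are homogeneous of degree \<open>K\<close>, so bounded functions can be scaled into the unit
ball.\<close>

lemma defect_cmult:
  assumes Y: "system_factor M T Y" and f: "\<And>l. l < K \<Longrightarrow> f l \<in> L_infty M"
  shows "defect Y K (\<lambda>l x. c * f l x) i = (c ^ K)\<^sup>2 * defect Y K f i"
proof -
  interpret system_factor M T Y by (rule Y)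
  let ?F = "\<lambda>z. \<Prod>l<K. f l ((T ^^ (l * i)) z)"
  have F: "?F \<in> L_infty M" by (intro L_infty_prod L_infty_Tn f) simp
  have cF: "(\<lambda>z. \<Prod>l<K. c * f l ((T ^^ (l * i)) z)) = (\<lambda>z. c ^ K * ?F z)" by (simp add: prod.distrib)
  have "AE x in M. \<forall>l\<in>{..<K}. E (\<lambda>x. c * f l x) ((T ^^ (l * i)) x) = c * E (f l) ((T ^^ (l * i)) x)"
    by (intro AE_finite_allI AE_Tn E_cmult L_infty_integrable f) auto
  moreover have "AE x in M. E (\<lambda>z. c ^ K * ?F z) x = c ^ K * E ?F x"
    by (intro E_cmult L_infty_integrable F)
  ultimately have ae: "AE x in M. (E (\<lambda>z. c ^ K * ?F z) x - (\<Prod>l<K. E (\<lambda>x. c * f l x) ((T ^^ (l * i)) x)))\<^sup>2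
      = (c ^ K)\<^sup>2 * (E ?F x - (\<Prod>l<K. E (f l) ((T ^^ (l * i)) x)))\<^sup>2"
  proof eventually_elim
    case (elim x)
    have "(\<Prod>l<K. E (\<lambda>x. c * f l x) ((T ^^ (l * i)) x)) = c ^ K * (\<Prod>l<K. E (f l) ((T ^^ (l * i)) x))"
      using elim(1) by (simp add: prod.distrib)
    then show ?case using elim(2) by (simp add: power_mult_distrib flip: right_diff_distrib)
  qed
  have m: "(\<lambda>x. E h ((T ^^ n) x)) \<in> borel_measurable M" for h n
    by (rule measurable_compose[OF measurable_Tn E_measurable(2)])
  have "defect Y K (\<lambda>l x. c * f l x) i = (\<integral>x. (c ^ K)\<^sup>2 * (E ?F x - (\<Prod>l<K. E (f l) ((T ^^ (l * i)) x)))\<^sup>2 \<partial>M)"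
    unfolding defect_def cF
    by (rule integral_cong_AE[OF _ _ ae]; intro borel_measurable_power borel_measurable_diff borel_measurable_times
        borel_measurable_const borel_measurable_prod m E_measurable)
  then show ?thesis by (simp add: defect_def)
qed

lemma defect_small:
  assumes f: "\<And>l. l < K \<Longrightarrow> f l \<in> L_infty M" and \<epsilon>: "\<epsilon> > 0"
  shows "\<exists>n N. N \<ge> 1 \<and> (\<forall>m\<ge>N. (\<Sum>i<m. defect (tower (trivial_factor M) n) K f i) / real m < \<epsilon>)"
proof -
  have "\<exists>C. C > 0 \<and> (AE x in M. \<bar>f l x\<bar> \<le> C)" if "l < K" for l
    using L_inftyE[OF f[OF that]] by metis
  then obtain B where B: "\<And>l. l < K \<Longrightarrow> B l > 0" "\<And>l. l < K \<Longrightarrow> AE x in M. \<bar>f l x\<bar> \<le> B l" by metis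
  define C where "C = 1 + (\<Sum>l<K. B l)"
  have sB: "0 \<le> (\<Sum>l<K. B l)" using B(1) by (intro sum_nonneg) (auto intro: less_imp_le)
  then have C: "C > 0" by (simp add: C_def)
  define f' where "f' l x = (1 / C) * f l x" for l x
  have f': "f' l \<in> unit_ball" if l: "l < K" for l
  proof -
    have "B l \<le> (\<Sum>l<K. B l)" using B(1) l by (intro member_le_sum) (auto intro: less_imp_le)
    then have BC: "B l \<le> C" by (simp add: C_def)
    have "AE x in M. \<bar>f' l x\<bar> \<le> 1"
      using B(2)[OF l] by eventually_elim (use C BC in \<open>simp add: f'_def abs_mult\<close>)
    moreover have "f' l \<in> borel_measurable M"
      unfolding f'_def by (intro borel_measurable_times borel_measurable_const L_infty_measurable f l)
    ultimately show ?thesis by (simp add: unit_ball_def)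
  qed
  have pos: "\<epsilon> / (C ^ K)\<^sup>2 > 0" using \<epsilon> C by simp
  obtain n N where nN: "N \<ge> 1" "\<And>m. m \<ge> N \<Longrightarrow> (\<Sum>i<m. defect (tower (trivial_factor M) n) K f' i) / real m < \<epsilon> / (C ^ K)\<^sup>2"
    using defect_small_unit_ball[of K f', OF f' pos] by metis
  have ff': "f = (\<lambda>l x. C * f' l x)" using C by (auto simp: f'_def fun_eq_iff)
  have "(\<Sum>i<m. defect (tower (trivial_factor M) n) K f i) / real m < \<epsilon>" if "m \<ge> N" for m
  proof -
    have "defect (tower (trivial_factor M) n) K f i = (C ^ K)\<^sup>2 * defect (tower (trivial_factor M) n) K f' i" for i
      by (subst ff', rule defect_cmult[OF system_factor_level unit_ball_L_infty[OF f']])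
    then have "(\<Sum>i<m. defect (tower (trivial_factor M) n) K f i) / real m
      = (C ^ K)\<^sup>2 * ((\<Sum>i<m. defect (tower (trivial_factor M) n) K f' i) / real m)"
      by (simp add: sum_distrib_left)
    also have "\<dots> < (C ^ K)\<^sup>2 * (\<epsilon> / (C ^ K)\<^sup>2)"
      using nN(2)[OF that] C by (intro mult_strict_left_mono) auto
    finally show ?thesis using C by simp
  qed
  then show ?thesis using nN(1) by blast
qed

end

section \<open>The theorem\<close>

theorem theorem3p1:
  fixes M :: "'a measure" and T :: "'a \<Rightarrow> 'a"
    and k :: nat and f :: "nat \<Rightarrow> 'a \<Rightarrow> real" and \<epsilon> :: real
  assumes "measure_preserving_system M T"
    and "\<forall>l<k. f l \<in> L_infty M"
    and "\<epsilon> > 0"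
  shows "\<exists>n::nat. n \<ge> 1 \<and> (\<exists>\<alpha>\<in>Field omega_omega_omega.
    \<forall>m\<ge>n. (1 / real m) * (\<Sum>i<m. \<integral>x.
        (cond_exp M (fz_tower M T omega_omega_omega \<alpha>) (\<lambda>z. \<Prod>l<k. f l ((T ^^ (l * i)) z)) x
         - (\<Prod>l<k. cond_exp M (fz_tower M T omega_omega_omega \<alpha>) (f l) ((T ^^ (l * i)) x)))\<^sup>2 \<partial>M) < \<epsilon>)"
proof -
  interpret measure_preserving_system M T by (rule assms(1))
  obtain n N where "N \<ge> 1" "\<And>m. m \<ge> N \<Longrightarrow> (\<Sum>i<m. defect (tower (trivial_factor M) n) k f i) / real m < \<epsilon>"
    using defect_small[of k f \<epsilon>] assms(2,3) by metis
  then show ?thesis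
    using finite_ordinal_Field[of n]
    by (intro exI[of _ N] conjI bexI[of _ "finite_ordinal n"]) (auto simp: fz_tower_finite_ordinal defect_def)
qed

end
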